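(* Let $f$ be a quasi-expanding polynomial diffeomorphism of $\mathbb C^2$ of dynamical degree $d>1$, with expansion constant $\kappa>1$ (i.e. $|\lambda_x|\ge\kappa$ for all $x\in S$), and let $\nu$ be an ergodic $f$-invariant probability measure supported on $J^*$. Then the Lyapunov exponent of $\nu$ satisfies $\Lambda(\nu)\ge\log\kappa>0$. If $\mathcal J_k$ has full measure for $\nu$, then $\Lambda(\nu)\ge k\log\kappa>0$.
   Context: $f:\mathbb C^2\to\mathbb C^2$ is a polynomial diffeomorphism of dynamical degree $d>1$ (up to polynomial conjugacy, a finite composition of generalized Hénon maps, of degree $d$). $K^\pm$ is the set of points with bounded forward/backward orbit, $J^\pm=\partial K^\pm$, $G^+(x)=\lim_{n\to\infty}d^{-n}\log^+\|f^n(x)\|$. $J^*$ is the closure of the set of saddle (periodic) points. Fix a normalized invariant family $\psi_S=\{\psi_x:x\in S\}$: $S\subset J^*$ is a dense set with $f(S)=S$, and each $\psi_x:\mathbb C\to\mathbb C^2$ is an injective holomorphic immersion such that (i) $x\in\psi_x(\mathbb C)\subset J^-$; (ii) $f(\psi_x(\mathbb C))=\psi_{fx}(\mathbb C)$, and for $x_1,x_2\in S$ the sets $\psi_{x_1}(\mathbb C),\psi_{x_2}(\mathbb C)$ are disjoint or equal; (iii) $\psi_x(0)=x$ and $\max_{|\zeta|\le1}G^+(\psi_x(\zeta))=1$. (Example: $S$ the saddle points, $\psi_x$ normalized uniformizations of unstable manifolds.) Let $\lambda_x$ satisfy $f(\psi_x(\zeta))=\psi_{fx}(\lambda_x\zeta)$.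 $f$ is quasi-expanding if $\psi_S$ is a normal family; equivalently, there is $\kappa>1$ with $|\lambda_x|\ge\kappa$ for all $x\in S$. When $f$ is quasi-expanding, for $x\in J^*$ let $\Psi_x$ be the set of entire maps $\psi:\mathbb C\to\mathbb C^2$ that are locally uniform limits of $\psi_{y_j}$ for sequences $S\ni y_j\to x$; all of these are non-constant. $\mathrm{Ord}(\psi)=\min\{n\ge1:\psi^{(n)}(0)\ne0\}$, $\tau(x)=\sup_{\psi\in\Psi_x}\mathrm{Ord}(\psi)$, and $\mathcal J_k=\{x\in J^*:\tau(x)=k\}$. The (largest) Lyapunov exponent is $\Lambda(\nu)=\lim_{n\to\infty}\frac1n\int\log\|Df^n_x\|\,d\nu(x)$. *)

theory Defs
  imports "HOL-Complex_Analysis.Complex_Analysis" "HOL-Probability.Probability"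
    "HOL-Library.Extended_Nat"
begin

type_synonym C2 = "complex ^ 2"

section \<open>Polynomial diffeomorphisms and the dynamical degree\<close>

text \<open>Complex polynomials in two variables are identified with the functions they induce.\<close>

definition poly_fun_deg_le :: "nat \<Rightarrow> (C2 \<Rightarrow> complex) \<Rightarrow> bool" where
  "poly_fun_deg_le n g \<longleftrightarrow>
     (\<exists>c :: nat \<Rightarrow> nat \<Rightarrow> complex. \<forall>z. g z = (\<Sum>i\<le>n. \<Sum>j\<le>n - i. c i j * (z $ 1) ^ i * (z $ 2) ^ j))"

definition poly_map_deg_le :: "nat \<Rightarrow> (C2 \<Rightarrow> C2) \<Rightarrow> bool" where
  "poly_map_deg_le n F \<longleftrightarrow> (\<forall>i. poly_fun_deg_le n (\<lambda>z. F z $ i))"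

definition polynomial_map :: "(C2 \<Rightarrow> C2) \<Rightarrow> bool" where
  "polynomial_map F \<longleftrightarrow> (\<exists>n. poly_map_deg_le n F)"

definition poly_map_degree :: "(C2 \<Rightarrow> C2) \<Rightarrow> nat" where
  "poly_map_degree F = (LEAST n. poly_map_deg_le n F)"

definition polynomial_diffeo :: "(C2 \<Rightarrow> C2) \<Rightarrow> bool" where
  "polynomial_diffeo F \<longleftrightarrow> bij F \<and> polynomial_map F \<and> polynomial_map (inv F)"

definition dynamical_degree :: "(C2 \<Rightarrow> C2) \<Rightarrow> real" where
  "dynamical_degree F = lim (\<lambda>n. root n (real (poly_map_degree (F ^^ n))))"

definition henon_map :: "complex poly \<Rightarrow> complex \<Rightarrow> C2 \<Rightarrow> C2" where
  "henon_map p a z = vector [z $ 2, poly p (z $ 2) - a * z $ 1]"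

text \<open>Finite nonempty compositions of generalized Henon maps. The second argument is the
  degree of the composition, which is the product of the degrees of its factors.\<close>

inductive henon_composition :: "(C2 \<Rightarrow> C2) \<Rightarrow> nat \<Rightarrow> bool" where
  single: "degree p \<ge> 2 \<Longrightarrow> a \<noteq> 0 \<Longrightarrow> henon_composition (henon_map p a) (degree p)"
| comp: "henon_composition h m \<Longrightarrow> degree p \<ge> 2 \<Longrightarrow> a \<noteq> 0 \<Longrightarrow>
           henon_composition (henon_map p a \<circ> h) (degree p * m)"

text \<open>By Friedland and Milnor, every polynomial diffeomorphism of dynamical degree \<open>d > 1\<close>
  has this property.\<close>

definition conjugate_to_henon_composition :: "(C2 \<Rightarrow> C2) \<Rightarrow> nat \<Rightarrow> bool" where
  "conjugate_to_henon_composition F d \<longleftrightarrow>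
     (\<exists>\<phi> h. polynomial_diffeo \<phi> \<and> henon_composition h d \<and> F = inv \<phi> \<circ> h \<circ> \<phi>)"

section \<open>Dynamically defined sets and the Green function\<close>

definition K_minus :: "(C2 \<Rightarrow> C2) \<Rightarrow> C2 set" where
  "K_minus f = {x. bounded (range (\<lambda>n. (inv f ^^ n) x))}"

definition J_minus :: "(C2 \<Rightarrow> C2) \<Rightarrow> C2 set" where
  "J_minus f = frontier (K_minus f)"

definition G_plus :: "(C2 \<Rightarrow> C2) \<Rightarrow> C2 \<Rightarrow> real" where
  "G_plus f x = lim (\<lambda>n. max 0 (ln (norm ((f ^^ n) x))) / dynamical_degree f ^ n)"

text \<open>The real Frechet derivative of a holomorphic map is its complex derivative. It acts on a
  complex two-dimensional space, so the eigenvalues \<open>a\<close> and \<open>b\<close> below are all its eigenvalues.\<close>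

definition saddle_points :: "(C2 \<Rightarrow> C2) \<Rightarrow> C2 set" where
  "saddle_points f = {p. \<exists>n>0. (f ^^ n) p = p \<and>
     (\<exists>a b u v. u \<noteq> 0 \<and> v \<noteq> 0 \<and>
        frechet_derivative (f ^^ n) (at p) u = a *s u \<and> cmod a < 1 \<and>
        frechet_derivative (f ^^ n) (at p) v = b *s v \<and> cmod b > 1)}"

definition J_star :: "(C2 \<Rightarrow> C2) \<Rightarrow> C2 set" where
  "J_star f = closure (saddle_points f)"

section \<open>Entire curves and normalized invariant families\<close>

definition entire_curve :: "(complex \<Rightarrow> C2) \<Rightarrow> bool" where
  "entire_curve \<psi> \<longleftrightarrow> (\<forall>i. (\<lambda>\<zeta>. \<psi> \<zeta> $ i) holomorphic_on UNIV)"

definition curve_deriv :: "nat \<Rightarrow> (complex \<Rightarrow> C2) \<Rightarrow> complex \<Rightarrow> C2" where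
  "curve_deriv n \<psi> z = (\<chi> i. (deriv ^^ n) (\<lambda>\<zeta>. \<psi> \<zeta> $ i) z)"

definition injective_immersion :: "(complex \<Rightarrow> C2) \<Rightarrow> bool" where
  "injective_immersion \<psi> \<longleftrightarrow> entire_curve \<psi> \<and> inj \<psi> \<and> (\<forall>\<zeta>. curve_deriv 1 \<psi> \<zeta> \<noteq> 0)"

definition normalized_invariant_family ::
    "(C2 \<Rightarrow> C2) \<Rightarrow> C2 set \<Rightarrow> (C2 \<Rightarrow> complex \<Rightarrow> C2) \<Rightarrow> bool" where
  "normalized_invariant_family f S \<psi> \<longleftrightarrow>
     S \<subseteq> J_star f \<and> J_star f \<subseteq> closure S \<and> f ` S = S \<and>
     (\<forall>x\<in>S. injective_immersion (\<psi> x)) \<and>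
     (\<forall>x\<in>S. x \<in> range (\<psi> x) \<and> range (\<psi> x) \<subseteq> J_minus f) \<and>
     (\<forall>x\<in>S. f ` range (\<psi> x) = range (\<psi> (f x))) \<and>
     (\<forall>x\<in>S. \<forall>y\<in>S. range (\<psi> x) \<inter> range (\<psi> y) = {} \<or> range (\<psi> x) = range (\<psi> y)) \<and>
     (\<forall>x\<in>S. \<psi> x 0 = x) \<and>
     (\<forall>x\<in>S. (\<exists>\<zeta>\<in>cball 0 1. G_plus f (\<psi> x \<zeta>) = 1) \<and>
             (\<forall>\<zeta>\<in>cball 0 1. G_plus f (\<psi> x \<zeta>) \<le> 1))"

definition locally_uniform_limit ::
    "(nat \<Rightarrow> complex \<Rightarrow> C2) \<Rightarrow> (complex \<Rightarrow> C2) \<Rightarrow> bool" where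
  "locally_uniform_limit g \<phi> \<longleftrightarrow> (\<forall>K. compact K \<longrightarrow> uniform_limit K g \<phi> sequentially)"

text \<open>Divergence to infinity is not admitted as a limit. For the families considered here it
  cannot occur, because the points \<open>\<psi> x 0 = x\<close> lie in the bounded set \<open>J_star f\<close>.\<close>

definition normal_family :: "C2 set \<Rightarrow> (C2 \<Rightarrow> complex \<Rightarrow> C2) \<Rightarrow> bool" where
  "normal_family S \<psi> \<longleftrightarrow>
     (\<forall>s :: nat \<Rightarrow> C2. range s \<subseteq> S \<longrightarrow>
        (\<exists>r \<phi>. strict_mono r \<and> entire_curve \<phi> \<and>
               locally_uniform_limit (\<lambda>n. \<psi> (s (r n))) \<phi>))"

definition limit_curves :: "C2 set \<Rightarrow> (C2 \<Rightarrow> complex \<Rightarrow> C2) \<Rightarrow> C2 \<Rightarrow> (complex \<Rightarrow> C2) set" where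
  "limit_curves S \<psi> x = {\<phi>. entire_curve \<phi> \<and>
     (\<exists>y. range y \<subseteq> S \<and> y \<longlonglongrightarrow> x \<and> locally_uniform_limit (\<lambda>j. \<psi> (y j)) \<phi>)}"

definition Ord :: "(complex \<Rightarrow> C2) \<Rightarrow> nat" where
  "Ord \<phi> = (LEAST n. n \<ge> 1 \<and> curve_deriv n \<phi> 0 \<noteq> 0)"

text \<open>The supremum is taken in \<open>enat\<close>, because on \<open>nat\<close> an unbounded set would not have
  a meaningful supremum.\<close>

definition tau :: "C2 set \<Rightarrow> (C2 \<Rightarrow> complex \<Rightarrow> C2) \<Rightarrow> C2 \<Rightarrow> enat" where
  "tau S \<psi> x = (SUP \<phi>\<in>limit_curves S \<psi> x. enat (Ord \<phi>))"

definition J_level :: "(C2 \<Rightarrow> C2) \<Rightarrow> C2 set \<Rightarrow> (C2 \<Rightarrow> complex \<Rightarrow> C2) \<Rightarrow> nat \<Rightarrow> C2 set" where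
  "J_level f S \<psi> k = {x \<in> J_star f. tau S \<psi> x = enat k}"

section \<open>Ergodic measures and the Lyapunov exponent\<close>

definition ergodic_invariant :: "(C2 \<Rightarrow> C2) \<Rightarrow> C2 measure \<Rightarrow> bool" where
  "ergodic_invariant f \<nu> \<longleftrightarrow>
     prob_space \<nu> \<and> sets \<nu> = sets borel \<and> f \<in> measurable \<nu> \<nu> \<and> distr \<nu> \<nu> f = \<nu> \<and>
     (\<forall>A\<in>sets \<nu>. f -` A = A \<longrightarrow> measure \<nu> A = 0 \<or> measure \<nu> A = 1)"

definition lyapunov_exponent :: "(C2 \<Rightarrow> C2) \<Rightarrow> C2 measure \<Rightarrow> real" where
  "lyapunov_exponent f \<nu> =
     lim (\<lambda>n. (\<integral>x. ln (onorm (frechet_derivative (f ^^ n) (at x))) \<partial>\<nu>) / real n)"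

end

theory Submission imports Defs begin

text \<open>The derivative of an iterate is bounded from below by transporting limit curves. Let \<open>x\<close> lie
in \<open>J_star f\<close> and let \<open>\<omega>\<close> be a limit curve at \<open>(f ^^ n) x\<close>, so that
\<open>\<omega>\<close> is a limit of \<open>\<psi> y\<^sub>j\<close>. Normality applied to the points
\<open>(inv f ^^ n) y\<^sub>j\<close> gives a limit curve \<open>\<phi>\<close> at \<open>x\<close> with
\<open>\<omega> \<zeta> = (f ^^ n) (\<phi> (\<sigma> * \<zeta>))\<close> and
\<open>cmod \<sigma> \<le> inverse (\<kappa> ^ n)\<close> (\<open>pull_back_limit_curve\<close>). If \<open>\<omega>\<close> has order
\<open>k\<close> at \<open>0\<close>, comparison of leading coefficients shows that the derivative of \<open>f ^^ n\<close> at
\<open>x\<close> sends \<open>\<sigma> ^ k\<close> times the \<open>k\<close>-th derivative of \<open>\<phi>\<close> to the one of \<open>\<omega>\<close>. The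
\<open>k\<close>-th derivatives at \<open>0\<close> of all limit curves are bounded, so the norm of the derivative
at \<open>x\<close> is at least a constant multiple of \<open>\<kappa> ^ (n * k)\<close> as soon as \<open>(f ^^ n) x\<close> lies in the
set \<open>order_set S \<psi> k \<epsilon>\<close> of points that carry a limit curve with vanishing derivatives of orders
\<open>1, ..., k - 1\<close> and with \<open>k\<close>-th derivative of norm at least \<open>\<epsilon>\<close>
(\<open>derivative_lower_bound\<close>).

These sets are closed, and finite unions of them have measure tending to \<open>1\<close>. By invariance of
\<open>\<nu>\<close> the same is true of their preimages under \<open>f ^^ n\<close>, uniformly in \<open>n\<close>. On the small
remaining set the logarithm of the norm of the derivative is at least \<open>- C * n\<close>, by compactness
of \<open>J_star f\<close>. Integration gives the bound (\<open>lyapunov_lower_bound\<close>). The limit that defines the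
Lyapunov exponent exists by Fekete's lemma. No recurrence and no ergodic theorem are needed.

The order of a limit curve makes sense only if the curve is not constant. The normalization gives
points of the approximating curves, over the closed unit disc, at which the Green function equals
\<open>1\<close>. If the limit were the constant \<open>x\<close>, these points would converge to \<open>x\<close>, a
point with bounded orbit, whereas the Green function is smaller than \<open>1\<close> near such a point
(\<open>G_plus_less_one_near_bounded_orbit\<close>). The last fact rests on upper bounds of the growth of
iterates, but it also requires that the limit defining the Green function exists at \<^emph>\<open>every\<close>
point, for every polynomial conjugate \<open>inv \<phi> \<circ> h \<circ> \<phi>\<close> of a composition \<open>h\<close> of Henon
maps, where degrees of iterates need not be multiplicative.

So \<open>ln (cmod (Q ((h ^^ n) z))) / d ^ n\<close> must be shown to converge along unbounded orbits for each
polynomial \<open>Q\<close>. The coordinates along the orbit form a sequence with \<open>u\<^sub>n\<^sub>+\<^sub>2 = P\<^sub>n(u\<^sub>n\<^sub>+\<^sub>1) - A\<^sub>n u\<^sub>n\<close>, and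
an unbounded orbit satisfies \<open>u\<^sub>n\<^sub>+\<^sub>1 \<sim> c u\<^sub>n ^ e\<close>. If the part of \<open>Q\<close> of top weight, for the
weights \<open>1\<close> and \<open>e\<close>, does not vanish at \<open>(1, c)\<close>, then \<open>Q\<close> grows like a power of
\<open>u\<^sub>n\<close>. Otherwise one step of the recursion is substituted into \<open>Q\<close>; this divides by at
least two the largest exponent of the first variable among the monomials of top weight, so that
after finitely many substitutions the favourable case occurs (\<open>poly_log_convergent_aux\<close>).\<close>

section \<open>Two-variable polynomials and the Henon substitution\<close>

text \<open>Evaluation of the polynomial whose coefficient of \<open>x ^ j * y ^ i\<close> is \<open>r j i\<close>, where both
exponents range up to \<open>N\<close>. Coefficient arrays make the exchange of the two variables trivial.\<close>

definition bipoly :: "nat \<Rightarrow> (nat \<Rightarrow> nat \<Rightarrow> complex) \<Rightarrow> complex \<Rightarrow> complex \<Rightarrow> complex" where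
  "bipoly N r x y = (\<Sum>j\<le>N. \<Sum>i\<le>N. r j i * x ^ j * y ^ i)"

text \<open>All exponents of the polynomial with coefficients \<open>r\<close> are at most \<open>N\<close>.\<close>

definition supp_le :: "nat \<Rightarrow> (nat \<Rightarrow> nat \<Rightarrow> complex) \<Rightarrow> bool" where
  "supp_le N r \<longleftrightarrow> (\<forall>j i. r j i \<noteq> 0 \<longrightarrow> j \<le> N \<and> i \<le> N)"

text \<open>The part of weight \<open>W\<close>, where \<open>x\<close> has weight \<open>1\<close> and \<open>y\<close> has weight \<open>e\<close>,
evaluated at \<open>x = 1\<close>, as a polynomial in \<open>y\<close>.\<close>

definition lead_form :: "nat \<Rightarrow> (nat \<Rightarrow> nat \<Rightarrow> complex) \<Rightarrow> nat \<Rightarrow> nat \<Rightarrow> complex poly" where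
  "lead_form N r e W = (\<Sum>i\<le>N. monom (if e * i \<le> W then r (W - e * i) i else 0) i)"

lemma coeff_lead_form:
  assumes "supp_le N r"
  shows "coeff (lead_form N r e W) i = (if e * i \<le> W then r (W - e * i) i else 0)"
proof -
  have "coeff (lead_form N r e W) i = (\<Sum>k\<le>N. if k = i then (if e * i \<le> W then r (W - e * i) i else 0) else 0)"
    unfolding lead_form_def by (simp add: coeff_sum cong: if_cong)
  also have "\<dots> = (if e * i \<le> W then r (W - e * i) i else 0)"
    using assms by (auto simp: supp_le_def)
  finally show ?thesis .
qed

lemma bipoly_asymp:
  fixes X Y :: "nat \<Rightarrow> complex"
  assumes X: "filterlim X at_infinity sequentially"
    and Y: "(\<lambda>t. Y t / X t ^ e) \<longlonglongrightarrow> c"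
    and supp: "supp_le N r"
    and W: "\<And>j i. r j i \<noteq> 0 \<Longrightarrow> j + e * i \<le> W"
  shows "(\<lambda>t. bipoly N r (X t) (Y t) / X t ^ W) \<longlonglongrightarrow> poly (lead_form N r e W) c"
proof -
  have Xnz: "eventually (\<lambda>t. X t \<noteq> 0) sequentially"
    using X by (simp add: filterlim_at_infinity_imp_eventually_ne)
  have inv0: "(\<lambda>t. inverse (X t)) \<longlonglongrightarrow> 0"
    using X by (rule tendsto_inverse_0[THEN filterlim_compose])
  have trm: "(\<lambda>t. r j i * X t ^ j * Y t ^ i / X t ^ W) \<longlonglongrightarrow> (if j + e * i = W then r j i * c ^ i else 0)" for j i
  proof (cases "r j i = 0")
    case True then show ?thesis by simp
  next
    case False
    define s where "s = W - (j + e * i)"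
    have s: "W = j + e * i + s" using W[OF False] s_def by simp
    have eq: "eventually (\<lambda>t. r j i * (Y t / X t ^ e) ^ i * inverse (X t) ^ s = r j i * X t ^ j * Y t ^ i / X t ^ W) sequentially"
      using Xnz
    proof eventually_elim
      case (elim t)
      have "X t ^ W = X t ^ j * (X t ^ e) ^ i * X t ^ s"
        by (simp add: s power_add power_mult)
      then show ?case using elim
        by (simp add: field_simps)
    qed
    have "(\<lambda>t. r j i * (Y t / X t ^ e) ^ i * inverse (X t) ^ s) \<longlonglongrightarrow> r j i * c ^ i * 0 ^ s"
      by (intro tendsto_intros Y inv0)
    then have "(\<lambda>t. r j i * X t ^ j * Y t ^ i / X t ^ W) \<longlonglongrightarrow> r j i * c ^ i * 0 ^ s"
      using eq by (rule Lim_transform_eventually)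
    moreover have "r j i * c ^ i * 0 ^ s = (if j + e * i = W then r j i * c ^ i else 0)"
      using s by (auto simp: power_0_left)
    ultimately show ?thesis by simp
  qed
  have "(\<lambda>t. \<Sum>j\<le>N. \<Sum>i\<le>N. r j i * X t ^ j * Y t ^ i / X t ^ W) \<longlonglongrightarrow>
      (\<Sum>j\<le>N. \<Sum>i\<le>N. if j + e * i = W then r j i * c ^ i else 0)"
    by (intro tendsto_sum trm)
  moreover have "(\<Sum>j\<le>N. \<Sum>i\<le>N. if j + e * i = W then r j i * c ^ i else 0) = poly (lead_form N r e W) c"
  proof -
    have "(\<Sum>j\<le>N. \<Sum>i\<le>N. if j + e * i = W then r j i * c ^ i else 0)
        = (\<Sum>i\<le>N. \<Sum>j\<le>N. if j + e * i = W then r j i * c ^ i else 0)"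
      by (rule sum.swap)
    also have "\<dots> = (\<Sum>i\<le>N. (if e * i \<le> W then r (W - e * i) i else 0) * c ^ i)"
    proof (rule sum.cong[OF refl])
      fix i
      show "(\<Sum>j\<le>N. if j + e * i = W then r j i * c ^ i else 0) = (if e * i \<le> W then r (W - e * i) i else 0) * c ^ i"
      proof (cases "e * i \<le> W")
        case True
        then have "(\<Sum>j\<le>N. if j + e * i = W then r j i * c ^ i else 0) = (\<Sum>j\<le>N. if j = W - e * i then r j i * c ^ i else 0)"
          by (intro sum.cong) auto
        also have "\<dots> = r (W - e * i) i * c ^ i"
          using supp by (auto simp: supp_le_def)
        finally show ?thesis using True by simp
      next
        case False
        then show ?thesis by (auto intro!: sum.neutral)
      qed
    qed
    also have "\<dots> = poly (lead_form N r e W) c"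
      by (simp add: lead_form_def poly_sum poly_monom)
    finally show ?thesis .
  qed
  moreover have "(\<lambda>t. \<Sum>j\<le>N. \<Sum>i\<le>N. r j i * X t ^ j * Y t ^ i / X t ^ W) = (\<lambda>t. bipoly N r (X t) (Y t) / X t ^ W)"
    by (simp add: bipoly_def sum_divide_distrib)
  ultimately show ?thesis by simp
qed

lemma coeff_linear_power:
  fixes c :: complex
  shows "coeff ([:c, 1:] ^ i) e = of_nat (i choose e) * c ^ (i - e)"
proof (cases "e \<le> i")
  case True then show ?thesis by (simp add: coeff_linear_poly_power)
next
  case False
  then have "degree ([:c, 1:] ^ i) < e" by (simp add: degree_power_eq)
  then show ?thesis using False by (simp add: coeff_eq_0)
qed

lemma pcompose_pow: "pcompose (p ^ n) q = pcompose p q ^ n" for p q :: "'a::comm_semiring_1 poly"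
  by (induction n) (simp_all add: pcompose_mult one_pCons pcompose_pCons)

lemma pcompose_monom: "pcompose (monom a n) q = smult a (q ^ n)" for q :: "'a::comm_ring_1 poly"
  by (simp only: monom_altdef pcompose_smult pcompose_pow) (simp add: pcompose_pCons)

lemma coeff_taylor_shift:
  fixes F :: "complex poly"
  assumes "degree F \<le> N"
  shows "coeff (pcompose F [:c, 1:]) e = (\<Sum>i\<le>N. of_nat (i choose e) * c ^ (i - e) * coeff F i)"
proof -
  have "F = (\<Sum>i\<le>N. monom (coeff F i) i)"
    using assms by (simp add: poly_as_sum_of_monoms')
  then have "pcompose F [:c, 1:] = (\<Sum>i\<le>N. pcompose (monom (coeff F i) i) [:c, 1:])"
    by (metis (no_types, lifting) pcompose_sum sum.cong)
  also have "\<dots> = (\<Sum>i\<le>N. smult (coeff F i) ([:c, 1:] ^ i))"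
    by (simp only: pcompose_monom)
  finally show ?thesis
    by (simp add: coeff_sum coeff_linear_power mult_ac)
qed

text \<open>A polynomial \<open>F\<close> that is divisible by the \<open>i0\<close>-th power of the variable and has degree at most
\<open>i1\<close> vanishes at \<open>c \<noteq> 0\<close> to order at most \<open>i1 - i0\<close>.\<close>

lemma low_taylor_coeff_nonzero:
  fixes F :: "complex poly"
  assumes "F \<noteq> 0" "c \<noteq> 0" "degree F \<le> i1" and low: "\<And>i. i < i0 \<Longrightarrow> coeff F i = 0"
  shows "\<exists>m. m + i0 \<le> i1 \<and> coeff (pcompose F [:c, 1:]) m \<noteq> 0"
proof (rule ccontr)
  assume no: "\<not> ?thesis"
  have "i0 \<le> degree F" using low assms(1) by (meson leading_coeff_0_iff not_less)
  then have le: "i0 \<le> i1" using assms(3) by simp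
  define s where "s = i1 - i0"
  let ?T = "pcompose F [:c, 1:]"
  \<comment> \<open>All low Taylor coefficients at c vanish, so c is a root of order at least s + 1.\<close>
  have "monom 1 (Suc s) dvd ?T"
    unfolding monom_1_dvd_iff' using no le by (auto simp: s_def)
  then obtain Q where "?T = monom 1 (Suc s) * Q" by (auto elim: dvdE)
  then have "pcompose ?T [:-c, 1:] = pcompose (monom 1 (Suc s)) [:-c, 1:] * pcompose Q [:-c, 1:]"
    by (simp add: pcompose_mult)
  moreover have "pcompose ?T [:-c, 1:] = F"
    by (simp add: pcompose_assoc[symmetric] pcompose_pCons)
  moreover have "pcompose (monom 1 (Suc s)) [:-c, 1:] = [:-c, 1:] ^ Suc s"
    by (simp add: pcompose_monom)
  ultimately have "[:-c, 1:] ^ Suc s dvd F" by (metis dvd_triv_left)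
  then have oc: "Suc s \<le> order c F" using assms(1) by (metis order_divides)
  have "monom 1 i0 dvd F" unfolding monom_1_dvd_iff' using low by auto
  then have o0: "i0 \<le> order 0 F" using assms(1) by (simp add: monom_1_dvd_iff)
  \<comment> \<open>The orders of the roots \<open>0\<close> and \<open>c\<close> together exceed the degree.\<close>
  have "order 0 F + order c F = (\<Sum>x\<in>{0, c}. order x F)"
    using assms(2) by simp
  also have "\<dots> = (\<Sum>x\<in>{0, c} \<inter> {x. poly F x = 0}. order x F)"
    using assms(1) by (intro sum.mono_neutral_right) (auto simp: order_root)
  also have "\<dots> \<le> (\<Sum>x\<in>{x. poly F x = 0}. order x F)"
    using assms(1) by (intro sum_mono2) (auto simp: poly_roots_finite)
  also have "\<dots> \<le> degree F" using assms(1) by (rule sum_order_le_degree)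
  finally show False using oc o0 assms(3) le s_def by linarith
qed

text \<open>The coefficient of \<open>x' ^ e\<close>, a polynomial in \<open>x\<close>, after the substitution
\<open>y = poly p x - a * x'\<close>.\<close>

definition subst_row :: "nat \<Rightarrow> (nat \<Rightarrow> nat \<Rightarrow> complex) \<Rightarrow> complex poly \<Rightarrow> complex \<Rightarrow> nat \<Rightarrow> complex poly" where
  "subst_row N r p a e =
     (\<Sum>i\<le>N. smult (of_nat (i choose e) * (- a) ^ e) (p ^ (i - e) * (\<Sum>j\<le>N. monom (r j i) j)))"

text \<open>The coefficients of the polynomial in \<open>(x', x)\<close> that arises from the polynomial \<open>r\<close> in
\<open>(x, y)\<close> by the substitution \<open>y = poly p x - a * x'\<close>. The variable \<open>x'\<close> now comes first.\<close>

definition henon_subst :: "nat \<Rightarrow> (nat \<Rightarrow> nat \<Rightarrow> complex) \<Rightarrow> complex poly \<Rightarrow> complex \<Rightarrow> nat \<Rightarrow> nat \<Rightarrow> complex" where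
  "henon_subst N r p a e l = coeff (subst_row N r p a e) l"

lemma supp_henon_subst: "supp_le (N + N * degree p) (henon_subst N r p a)"
  unfolding supp_le_def
proof (intro allI impI)
  fix e l assume nz: "henon_subst N r p a e l \<noteq> 0"
  have "e \<le> N"
  proof (rule ccontr)
    assume "\<not> e \<le> N"
    then have "subst_row N r p a e = 0"
      unfolding subst_row_def by (intro sum.neutral) (auto simp: binomial_eq_0)
    with nz show False by (simp add: henon_subst_def)
  qed
  moreover have "degree (subst_row N r p a e) \<le> N + N * degree p"
    unfolding subst_row_def
  proof (intro degree_sum_le)
    fix i assume "i \<in> {..N}"
    then have i: "i \<le> N" by simp
    have 1: "degree (\<Sum>j\<le>N. monom (r j i) j) \<le> N"
      by (intro degree_sum_le) (auto intro: order.trans[OF degree_monom_le])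
    have 2: "degree (p ^ (i - e)) \<le> N * degree p"
      using degree_power_le[of p "i - e"] i
      by (metis diff_le_self le_trans mult.commute mult_le_mono1)
    have "degree (p ^ (i - e) * (\<Sum>j\<le>N. monom (r j i) j)) \<le> N + N * degree p"
      using degree_mult_le[of "p ^ (i - e)" "\<Sum>j\<le>N. monom (r j i) j"] 1 2 by linarith
    then show "degree (smult (of_nat (i choose e) * (- a) ^ e) (p ^ (i - e) * (\<Sum>j\<le>N. monom (r j i) j))) \<le> N + N * degree p"
      using degree_smult_le le_trans by blast
  qed simp
  then have "l \<le> N + N * degree p"
    using nz unfolding henon_subst_def by (meson le_degree le_trans)
  ultimately show "e \<le> N + N * degree p \<and> l \<le> N + N * degree p" by simp
qed

lemma bipoly_henon_subst:
  "bipoly (N + N * degree p) (henon_subst N r p a) x' x = bipoly N r x (poly p x - a * x')"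
proof -
  let ?M = "N + N * degree p"
  have deg: "degree (subst_row N r p a e) \<le> ?M" for e
  proof (rule degree_le, intro allI impI)
    fix l assume "?M < l"
    then show "coeff (subst_row N r p a e) l = 0"
      using supp_henon_subst[of N p r a] unfolding supp_le_def henon_subst_def
      by (metis not_le)
  qed
  have row: "(\<Sum>l\<le>?M. henon_subst N r p a e l * x ^ l) = poly (subst_row N r p a e) x" for e
    unfolding henon_subst_def using poly_altdef[of "subst_row N r p a e" x] deg[of e]
    by (metis (no_types, lifting) poly_as_sum_of_monoms' poly_monom poly_sum sum.cong)
  have binom: "(\<Sum>e\<le>?M. of_nat (i choose e) * (- a) ^ e * poly p x ^ (i - e) * x' ^ e) = (poly p x - a * x') ^ i"
    if "i \<le> N" for i
  proof -
    have "(poly p x - a * x') ^ i = ((- a * x') + poly p x) ^ i" by simp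
    also have "\<dots> = (\<Sum>e\<le>i. of_nat (i choose e) * (- a * x') ^ e * poly p x ^ (i - e))"
      by (rule binomial_ring)
    also have "\<dots> = (\<Sum>e\<le>?M. of_nat (i choose e) * (- a * x') ^ e * poly p x ^ (i - e))"
      using that by (intro sum.mono_neutral_left) (auto simp: binomial_eq_0)
    finally show ?thesis
      by (simp only: power_mult_distrib mult_ac)
  qed
  have "bipoly ?M (henon_subst N r p a) x' x = (\<Sum>e\<le>?M. x' ^ e * (\<Sum>l\<le>?M. henon_subst N r p a e l * x ^ l))"
    unfolding bipoly_def by (simp add: sum_distrib_left mult_ac)
  also have "\<dots> = (\<Sum>e\<le>?M. x' ^ e * (\<Sum>i\<le>N. of_nat (i choose e) * (- a) ^ e * (poly p x ^ (i - e) * (\<Sum>j\<le>N. r j i * x ^ j))))"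
    unfolding row subst_row_def by (simp add: poly_sum poly_monom)
  also have "\<dots> = (\<Sum>e\<le>?M. \<Sum>i\<le>N. (\<Sum>j\<le>N. r j i * x ^ j) * (of_nat (i choose e) * (- a) ^ e * poly p x ^ (i - e) * x' ^ e))"
    by (simp add: sum_distrib_left sum_distrib_right mult_ac)
  also have "\<dots> = (\<Sum>i\<le>N. \<Sum>e\<le>?M. (\<Sum>j\<le>N. r j i * x ^ j) * (of_nat (i choose e) * (- a) ^ e * poly p x ^ (i - e) * x' ^ e))"
    by (rule sum.swap)
  also have "\<dots> = (\<Sum>i\<le>N. (\<Sum>j\<le>N. r j i * x ^ j) * (poly p x - a * x') ^ i)"
    by (intro sum.cong refl) (simp add: sum_distrib_left[symmetric] binom)
  also have "\<dots> = (\<Sum>i\<le>N. \<Sum>j\<le>N. r j i * x ^ j * (poly p x - a * x') ^ i)"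
    by (simp add: sum_distrib_right)
  also have "\<dots> = bipoly N r x (poly p x - a * x')"
    unfolding bipoly_def by (rule sum.swap)
  finally show ?thesis .
qed

lemma coeff_mult_top:
  fixes p q :: "complex poly"
  assumes "degree p \<le> m" "degree q \<le> n"
  shows "coeff (p * q) (m + n) = coeff p m * coeff q n"
proof -
  have "coeff (p * q) (m + n) = (\<Sum>k\<le>m + n. coeff p k * coeff q (m + n - k))"
    by (rule coeff_mult)
  also have "\<dots> = (\<Sum>k\<in>{m}. coeff p k * coeff q (m + n - k))"
  proof (rule sum.mono_neutral_right)
    show "\<forall>k\<in>{..m + n} - {m}. coeff p k * coeff q (m + n - k) = 0"
    proof
      fix k assume k: "k \<in> {..m + n} - {m}"
      show "coeff p k * coeff q (m + n - k) = 0"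
      proof (cases "k > m")
        case True then show ?thesis using assms by (simp add: coeff_eq_0)
      next
        case False
        then have "m + n - k > n" using k by auto
        then show ?thesis using assms by (simp add: coeff_eq_0)
      qed
    qed
  qed auto
  finally show ?thesis by simp
qed

lemma coeff_power_top:
  fixes p :: "complex poly"
  assumes "degree p \<le> n"
  shows "degree (p ^ k) \<le> n * k \<and> coeff (p ^ k) (n * k) = coeff p n ^ k"
proof (induction k)
  case (Suc k)
  have "degree (p * p ^ k) \<le> n + n * k"
    using degree_mult_le[of p "p ^ k"] Suc assms by linarith
  moreover have "coeff (p * p ^ k) (n + n * k) = coeff p n * coeff p n ^ k"
    using coeff_mult_top[OF assms, of "p ^ k" "n * k"] Suc by simp
  ultimately show ?case by simp
qed simp

text \<open>Since \<open>x'\<close> has weight \<open>degree p\<close> here, the substitution does not raise the weight, and the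
coefficients of top weight are, up to powers of \<open>- a\<close>, the Taylor coefficients of the leading
form at the leading coefficient of \<open>p\<close>.\<close>

lemma henon_subst_weight:
  assumes supp: "supp_le N r" and W: "\<And>j i. r j i \<noteq> 0 \<Longrightarrow> j + degree p * i \<le> W"
  shows "henon_subst N r p a e l \<noteq> 0 \<Longrightarrow> l + degree p * e \<le> W"
    and "degree p * e \<le> W \<Longrightarrow> henon_subst N r p a e (W - degree p * e)
           = (- a) ^ e * coeff (pcompose (lead_form N r (degree p) W) [:lead_coeff p, 1:]) e"
proof -
  let ?d = "degree p"
  define q where "q i = (\<Sum>j\<le>N. monom (r j i) j)" for i
  have cq: "coeff (q i) l = r l i" for i l
  proof -
    have "coeff (q i) l = (\<Sum>j\<le>N. if j = l then r l i else 0)"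
      unfolding q_def by (simp add: coeff_sum cong: if_cong)
    then show ?thesis using supp by (auto simp: supp_le_def)
  qed
  have qz: "q i = 0" if "W < ?d * i" for i
    using W that by (intro poly_eqI) (metis add_leD2 cq coeff_0 not_le)
  have dq: "degree (q i) \<le> W - ?d * i" for i
    by (rule degree_le) (metis W cq add_le_imp_le_diff not_le)
  have trm: "degree (p ^ (i - e) * q i) \<le> W - ?d * e \<and>
      coeff (p ^ (i - e) * q i) (W - ?d * e) = lead_coeff p ^ (i - e) * coeff (lead_form N r ?d W) i"
    if "e \<le> i" "?d * i \<le> W" for i
  proof -
    have eq: "W - ?d * e = ?d * (i - e) + (W - ?d * i)"
      using that by (metis Nat.add_diff_assoc2 diff_mult_distrib2 le_add_diff_inverse mult_le_mono2 Nat.add_diff_assoc)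
    have pw: "degree (p ^ (i - e)) \<le> ?d * (i - e)" "coeff (p ^ (i - e)) (?d * (i - e)) = lead_coeff p ^ (i - e)"
      using coeff_power_top[of p ?d "i - e"] by auto
    have "degree (p ^ (i - e) * q i) \<le> ?d * (i - e) + (W - ?d * i)"
      using degree_mult_le[of "p ^ (i - e)" "q i"] dq[of i] pw by linarith
    moreover have "coeff (p ^ (i - e) * q i) (?d * (i - e) + (W - ?d * i)) = lead_coeff p ^ (i - e) * r (W - ?d * i) i"
      using coeff_mult_top[OF pw(1) dq[of i]] pw(2) cq by simp
    ultimately show ?thesis
      using that by (simp add: eq coeff_lead_form[OF supp])
  qed
  have sr: "subst_row N r p a e = (\<Sum>i\<le>N. smult (of_nat (i choose e) * (- a) ^ e) (p ^ (i - e) * q i))" for e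
    by (simp add: subst_row_def q_def)
  have dterm: "coeff (smult (of_nat (i choose e) * (- a) ^ e) (p ^ (i - e) * q i)) l = 0"
    if l: "\<not> l + ?d * e \<le> W" for i l
  proof (cases "e \<le> i \<and> ?d * i \<le> W")
    case True
    then have "degree (p ^ (i - e) * q i) \<le> W - ?d * e" using trm by blast
    moreover have "?d * e \<le> W" using True by (meson le_trans mult_le_mono2)
    then have "W - ?d * e < l" using l
      by (metis add.commute add_diff_inverse_nat nat_add_left_cancel_le not_le)
    ultimately show ?thesis by (simp add: coeff_eq_0)
  next
    case False
    then show ?thesis using qz by (auto simp: binomial_eq_0 not_le)
  qed
  show "henon_subst N r p a e l \<noteq> 0 \<Longrightarrow> l + ?d * e \<le> W"
    using dterm unfolding henon_subst_def sr by (metis (no_types, lifting) coeff_sum sum.neutral)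
  assume eW: "?d * e \<le> W"
  have degF: "degree (lead_form N r ?d W) \<le> N"
    unfolding lead_form_def by (intro degree_sum_le) (auto intro: order.trans[OF degree_monom_le])
  have "henon_subst N r p a e (W - ?d * e) =
     (\<Sum>i\<le>N. of_nat (i choose e) * (- a) ^ e * coeff (p ^ (i - e) * q i) (W - ?d * e))"
    unfolding henon_subst_def sr by (simp add: coeff_sum)
  also have "\<dots> = (\<Sum>i\<le>N. (- a) ^ e * (of_nat (i choose e) * lead_coeff p ^ (i - e) * coeff (lead_form N r ?d W) i))"
  proof (rule sum.cong[OF refl])
    fix i
    show "of_nat (i choose e) * (- a) ^ e * coeff (p ^ (i - e) * q i) (W - ?d * e)
      = (- a) ^ e * (of_nat (i choose e) * lead_coeff p ^ (i - e) * coeff (lead_form N r ?d W) i)"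
    proof (cases "e \<le> i")
      case False then show ?thesis by (simp add: binomial_eq_0)
    next
      case ei: True
      show ?thesis
      proof (cases "?d * i \<le> W")
        case True then show ?thesis using trm[OF ei True] by simp
      next
        case False then show ?thesis by (simp add: qz coeff_lead_form[OF supp])
      qed
    qed
  qed
  also have "\<dots> = (- a) ^ e * coeff (pcompose (lead_form N r ?d W) [:lead_coeff p, 1:]) e"
    by (simp add: coeff_taylor_shift[OF degF] sum_distrib_left)
  finally show "henon_subst N r p a e (W - ?d * e)
           = (- a) ^ e * coeff (pcompose (lead_form N r ?d W) [:lead_coeff p, 1:]) e" .
qed

section \<open>Orbits of second-order polynomial recursions\<close>

text \<open>A sequence \<open>u\<close> whose consecutive pairs \<open>(u n, u (n + 1))\<close> form the orbit of a point under
a word of \<open>k\<close> Henon maps that is repeated periodically.\<close>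

locale henon_orbit =
  fixes k :: nat and P :: "nat \<Rightarrow> complex poly" and A :: "nat \<Rightarrow> complex" and u :: "nat \<Rightarrow> complex"
  assumes k_pos: "k > 0"
    and P_per: "P (n + k) = P n" and A_per: "A (n + k) = A n"
    and deg_ge: "degree (P n) \<ge> 2" and A_nz: "A n \<noteq> 0"
    and rec: "u (Suc (Suc n)) = poly (P n) (u (Suc n)) - A n * u n"
begin

text \<open>The degree of the composition of the first \<open>n\<close> maps.\<close>

definition deg_prod :: "nat \<Rightarrow> real" where "deg_prod n = (\<Prod>j<n. real (degree (P j)))"

lemma P_per_mult: "P (n + t * k) = P n"
proof (induction t)
  case (Suc t)
  have "P (n + Suc t * k) = P ((n + t * k) + k)" by (simp add: algebra_simps)
  then show ?case using Suc P_per by simp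
qed simp

lemma A_per_mult: "A (n + t * k) = A n"
proof (induction t)
  case (Suc t)
  have "A (n + Suc t * k) = A ((n + t * k) + k)" by (simp add: algebra_simps)
  then show ?case using Suc A_per by simp
qed simp

lemma lead_nz: "lead_coeff (P n) \<noteq> 0"
  using deg_ge[of n] by auto

lemma deg_prod_pos: "deg_prod n > 0"
  unfolding deg_prod_def using deg_ge by (intro prod_pos) (metis of_nat_0_less_iff pos2 order_less_le_trans)

lemma deg_prod_ge: "deg_prod n \<ge> 2 ^ n"
proof (induction n)
  case (Suc n)
  have "2 * 2 ^ n \<le> real (degree (P n)) * deg_prod n"
    using Suc deg_ge[of n] by (intro mult_mono) auto
  then show ?case by (simp add: deg_prod_def mult.commute)
qed (simp add: deg_prod_def)

lemma deg_prod_add_k: "deg_prod (n + k) = deg_prod n * deg_prod k"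
proof (induction n)
  case (Suc n)
  have "deg_prod (Suc n + k) = deg_prod (n + k) * real (degree (P (n + k)))" by (simp add: deg_prod_def)
  then show ?case using Suc by (simp add: P_per) (simp add: deg_prod_def)
qed (simp add: deg_prod_def)

lemma deg_prod_mult: "deg_prod (n + t * k) = deg_prod n * deg_prod k ^ t"
proof (induction t)
  case (Suc t)
  have "deg_prod (n + Suc t * k) = deg_prod ((n + t * k) + k)" by (simp add: algebra_simps)
  then show ?case using Suc by (simp add: deg_prod_add_k)
qed simp

lemma deg_prod_k_gt_1: "deg_prod k > 1"
  using deg_prod_ge[of k] k_pos by (metis one_less_numeral_iff one_less_power order_less_le_trans semiring_norm(76))

end

lemma henon_growth:
  fixes p :: "complex poly"
  assumes "degree p \<ge> 2"
  shows "\<exists>R. \<forall>x y. R \<le> norm y \<longrightarrow> norm x \<le> norm y \<longrightarrow> norm (poly p y - a * x) \<ge> 2 * norm y"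
proof -
  have "p \<noteq> 0" using assms by auto
  then have c: "lead_coeff p \<noteq> 0" by simp
  define \<delta> where "\<delta> = norm (lead_coeff p) / 2"
  have \<delta>: "\<delta> > 0" "\<delta> < norm (lead_coeff p)" using c by (auto simp: \<delta>_def)
  have "((\<lambda>y. norm (poly p y / y ^ degree p)) \<longlongrightarrow> norm (lead_coeff p)) at_infinity"
    by (intro tendsto_norm poly_divide_tendsto_aux)
  then have "eventually (\<lambda>y. \<delta> < norm (poly p y / y ^ degree p)) at_infinity"
    using \<delta>(2) by (rule order_tendstoD)
  then obtain R1 where R1: "\<And>y. R1 \<le> norm y \<Longrightarrow> \<delta> < norm (poly p y / y ^ degree p)"
    by (auto simp: eventually_at_infinity)
  define R where "R = max (max R1 1) ((2 + norm a) / \<delta>)"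
  show ?thesis
  proof (intro exI allI impI)
    fix x y :: complex assume y: "R \<le> norm y" and xy: "norm x \<le> norm y"
    have y1: "norm y \<ge> 1" "R1 \<le> norm y" "(2 + norm a) / \<delta> \<le> norm y" using y by (auto simp: R_def)
    have "norm y ^ 2 \<le> norm y ^ degree p" using y1 assms by (intro power_increasing) auto
    then have "\<delta> * norm y ^ 2 \<le> \<delta> * norm y ^ degree p" using \<delta> by simp
    also have "\<dots> \<le> norm (poly p y)"
    proof -
      have "norm y ^ degree p > 0" using y1(1) by (intro zero_less_power) linarith
      then show ?thesis
        using R1[OF y1(2)] pos_less_divide_eq[of "norm y ^ degree p" \<delta> "norm (poly p y)"]
        by (simp add: norm_divide norm_power)
    qed
    finally have 1: "\<delta> * norm y ^ 2 \<le> norm (poly p y)" .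
    have "(2 + norm a) \<le> \<delta> * norm y" using y1(3) \<delta>(1) by (simp add: field_simps)
    then have "(2 + norm a) * norm y \<le> \<delta> * norm y * norm y" by (intro mult_right_mono) auto
    then have 2: "(2 + norm a) * norm y \<le> norm (poly p y)" using 1 by (simp add: power2_eq_square mult.assoc)
    have "norm (a * x) \<le> norm a * norm y" using xy by (simp add: norm_mult mult_left_mono)
    then show "norm (poly p y - a * x) \<ge> 2 * norm y"
      using 2 norm_triangle_ineq2[of "poly p y" "a * x"] by (simp add: algebra_simps)
  qed
qed

context henon_orbit
begin

lemma growth_radius:
  "\<exists>R>0. \<forall>n x y. R \<le> norm y \<longrightarrow> norm x \<le> norm y \<longrightarrow> norm (poly (P n) y - A n * x) \<ge> 2 * norm y"
proof -
  obtain R where R: "\<And>n x y. R n \<le> norm y \<Longrightarrow> norm x \<le> norm y \<Longrightarrow> norm (poly (P n) y - A n * x) \<ge> 2 * norm y"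
    using choice[of "\<lambda>n R. \<forall>x y. R \<le> norm y \<longrightarrow> norm x \<le> norm y \<longrightarrow> norm (poly (P n) y - A n * x) \<ge> 2 * norm y"]
      henon_growth[OF deg_ge] by blast
  define R0 where "R0 = Max (insert 1 (R ` {..<k}))"
  show ?thesis
  proof (intro exI conjI allI impI)
    have "1 \<le> R0" unfolding R0_def by (intro Max_ge) auto
    then show "R0 > 0" by simp
    fix n and x y :: complex assume "R0 \<le> norm y" "norm x \<le> norm y"
    moreover have "R (n mod k) \<le> R0" unfolding R0_def using k_pos by (intro Max_ge) auto
    ultimately show "norm (poly (P n) y - A n * x) \<ge> 2 * norm y"
      using R[of "n mod k" y x] P_per_mult[of "n mod k" "n div k"] A_per_mult[of "n mod k" "n div k"]
      by simp
  qed
qed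

text \<open>An unbounded orbit must enter the region where the second coordinate is large and dominates the
first, and it never leaves this region.\<close>

lemma bounded_or_escaping:
  "bounded (range u) \<or>
    (\<exists>n0. (\<forall>n\<ge>n0. norm (u n) \<le> norm (u (Suc n))) \<and> filterlim u at_infinity sequentially)"
proof -
  obtain R where R: "R > 0"
      "\<And>n x y. R \<le> norm y \<Longrightarrow> norm x \<le> norm y \<Longrightarrow> norm (poly (P n) y - A n * x) \<ge> 2 * norm y"
    using growth_radius by blast
  show ?thesis
  proof (cases "\<exists>n. R \<le> norm (u (Suc n)) \<and> norm (u n) \<le> norm (u (Suc n))")
    case True
    then obtain n0 where n0: "R \<le> norm (u (Suc n0))" "norm (u n0) \<le> norm (u (Suc n0))" by blast
    have grow: "R * 2 ^ s \<le> norm (u (Suc (n0 + s))) \<and> norm (u (n0 + s)) \<le> norm (u (Suc (n0 + s)))" for s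
    proof (induction s)
      case 0 then show ?case using n0 by simp
    next
      case (Suc s)
      have "R * 1 \<le> R * 2 ^ s" using R(1) by (intro mult_left_mono) auto
      then have "2 * norm (u (Suc (n0 + s))) \<le> norm (u (Suc (Suc (n0 + s))))"
        using R(2)[of "u (Suc (n0 + s))" "u (n0 + s)" "n0 + s"] Suc by (simp add: rec)
      then show ?case using Suc norm_ge_zero[of "u (Suc (n0 + s))"]
        by (simp only: add_Suc_right power_Suc) linarith
    qed
    have "filterlim (\<lambda>s. R * 2 ^ s) at_top sequentially"
      using R(1) filterlim_at_infinity_imp_norm_at_top[OF filterlim_realpow_sequentially_gt1[of "2::real"]]
      by (intro filterlim_tendsto_pos_mult_at_top[OF tendsto_const]) auto
    then have "filterlim (\<lambda>s. norm (u (s + Suc n0))) at_top sequentially"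
      using grow by (elim filterlim_at_top_mono) (auto simp: add.commute)
    then have "filterlim (\<lambda>n. norm (u n)) at_top sequentially"
      unfolding filterlim_at_top
      using eventually_sequentially_seg[of "\<lambda>n. _ \<le> norm (u n)" "Suc n0"] by blast
    then have "filterlim u at_infinity sequentially"
      by (rule filterlim_norm_at_top_imp_at_infinity)
    moreover have "norm (u n) \<le> norm (u (Suc n))" if "n \<ge> n0" for n
      using grow[of "n - n0"] that by simp
    ultimately show ?thesis by blast
  next
    case False
    have "norm (u n) \<le> max R (norm (u 0))" for n
    proof (induction n)
      case (Suc n) then show ?case using False[rule_format] by (smt (verit))
    qed simp
    then have "bounded (range u)" by (auto intro!: boundedI)
    then show ?thesis by blast
  qed
qed

end

text \<open>An orbit in the second alternative of \<open>bounded_or_escaping\<close>.\<close>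

locale escaping_orbit = henon_orbit +
  fixes n0
  assumes mono: "n \<ge> n0 \<Longrightarrow> norm (u n) \<le> norm (u (Suc n))"
    and esc: "filterlim u at_infinity sequentially"
begin

lemma filterlim_residue: "filterlim (\<lambda>t. \<rho> + t * k) sequentially sequentially"
proof (rule filterlim_subseq)
  show "strict_mono (\<lambda>t. \<rho> + t * k)" using k_pos by (intro strict_monoI) auto
qed

lemma esc_residue: "filterlim (\<lambda>t. u (\<rho> + t * k)) at_infinity sequentially"
  using filterlim_compose[OF esc filterlim_residue] .

text \<open>Along a residue class modulo the period, \<open>u (n + 1)\<close> is asymptotic to a fixed multiple of a
fixed power of \<open>u n\<close>.\<close>

lemma ratio_tendsto:
  "(\<lambda>t. u (Suc (Suc (\<rho> + t * k))) / u (Suc (\<rho> + t * k)) ^ degree (P \<rho>)) \<longlonglongrightarrow> lead_coeff (P \<rho>)"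
proof -
  let ?X = "\<lambda>t. u (Suc (\<rho> + t * k))" and ?e = "degree (P \<rho>)"
  have X: "filterlim ?X at_infinity sequentially" using esc_residue[of "Suc \<rho>"] by simp
  have "(\<lambda>t. poly (P \<rho>) (?X t) / ?X t ^ ?e) \<longlonglongrightarrow> lead_coeff (P \<rho>)"
    by (rule filterlim_compose[OF poly_divide_tendsto_aux X])
  moreover have "(\<lambda>t. A \<rho> * u (\<rho> + t * k) / ?X t ^ ?e) \<longlonglongrightarrow> 0"
  proof (rule Lim_null_comparison)
    have "(\<lambda>t. norm (A \<rho>) * norm (inverse (?X t))) \<longlonglongrightarrow> norm (A \<rho>) * norm (0 :: complex)"
      by (intro tendsto_intros filterlim_compose[OF tendsto_inverse_0 X])
    then show "(\<lambda>t. norm (A \<rho>) * norm (inverse (?X t))) \<longlonglongrightarrow> 0" by simp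
    have "eventually (\<lambda>t. norm (?X t) \<ge> 1) sequentially"
      using X unfolding filterlim_at_infinity_conv_norm_at_top filterlim_at_top by blast
    moreover have "eventually (\<lambda>t. \<rho> + t * k \<ge> n0) sequentially"
      using filterlim_residue[of \<rho>] unfolding filterlim_at_top by blast
    ultimately show "eventually (\<lambda>t. norm (A \<rho> * u (\<rho> + t * k) / ?X t ^ ?e) \<le> norm (A \<rho>) * norm (inverse (?X t))) sequentially"
    proof eventually_elim
      case (elim t)
      have "norm (u (\<rho> + t * k)) \<le> norm (?X t)" using mono elim by simp
      moreover have "norm (?X t) ^ 2 \<le> norm (?X t) ^ ?e" using elim deg_ge by (intro power_increasing) auto
      ultimately have "norm (u (\<rho> + t * k)) * norm (?X t) \<le> norm (?X t) ^ ?e"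
        by (smt (verit) mult_right_mono norm_ge_zero power2_eq_square)
      then have "norm (u (\<rho> + t * k)) / norm (?X t) ^ ?e \<le> inverse (norm (?X t))"
        using elim pos_divide_le_eq[of "norm (?X t) ^ ?e" "norm (u (\<rho> + t * k))" "inverse (norm (?X t))"]
          pos_le_divide_eq[of "norm (?X t)" "norm (u (\<rho> + t * k))" "norm (?X t) ^ ?e"]
        by (smt (verit) divide_inverse mult.commute zero_less_power)
      then have "norm (A \<rho>) * (norm (u (\<rho> + t * k)) / norm (?X t) ^ ?e) \<le> norm (A \<rho>) * inverse (norm (?X t))"
        by (intro mult_left_mono) auto
      then show ?case by (simp add: norm_mult norm_divide norm_power norm_inverse)
    qed
  qed
  ultimately have "(\<lambda>t. poly (P \<rho>) (?X t) / ?X t ^ ?e - A \<rho> * u (\<rho> + t * k) / ?X t ^ ?e) \<longlonglongrightarrow> lead_coeff (P \<rho>) - 0"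
    by (rule tendsto_diff)
  then show ?thesis by (simp add: rec P_per_mult A_per_mult diff_divide_distrib)
qed

lemma eventually_nz_residue: "eventually (\<lambda>t. u (\<rho> + t * k) \<noteq> 0) sequentially"
  using esc_residue by (rule filterlim_at_infinity_imp_eventually_ne)

lemma log_convergent: "convergent (\<lambda>n. ln (norm (u (Suc n))) / deg_prod n)"
proof -
  define b where "b n = ln (norm (u (Suc (Suc n)))) - real (degree (P n)) * ln (norm (u (Suc n)))" for n
  have conv_b: "(\<lambda>t. b (\<rho> + t * k)) \<longlonglongrightarrow> ln (norm (lead_coeff (P \<rho>)))" for \<rho>
  proof (rule Lim_transform_eventually)
    show "(\<lambda>t. ln (norm (u (Suc (Suc (\<rho> + t * k))) / u (Suc (\<rho> + t * k)) ^ degree (P \<rho>)))) \<longlonglongrightarrow> ln (norm (lead_coeff (P \<rho>)))"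
      using lead_nz by (intro tendsto_ln tendsto_norm ratio_tendsto) auto
    show "eventually (\<lambda>t. ln (norm (u (Suc (Suc (\<rho> + t * k))) / u (Suc (\<rho> + t * k)) ^ degree (P \<rho>))) = b (\<rho> + t * k)) sequentially"
      using eventually_nz_residue[of "Suc \<rho>"] eventually_nz_residue[of "Suc (Suc \<rho>)"]
    proof eventually_elim
      case (elim t)
      then show ?case by (simp add: b_def norm_divide norm_power ln_div ln_realpow P_per_mult)
    qed
  qed
  have "\<exists>C. \<forall>t. norm (b (\<rho> + t * k)) \<le> C" for \<rho>
    using convergentI[OF conv_b, THEN convergent_imp_Bseq, of \<rho>] by (auto simp: Bseq_def)
  then obtain C where C: "\<And>\<rho> t. norm (b (\<rho> + t * k)) \<le> C \<rho>" by metis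
  define C0 where "C0 = Max (C ` {..<k})"
  have b: "norm (b n) \<le> C0" for n
  proof -
    have "norm (b n) \<le> C (n mod k)" using C[of "n mod k" "n div k"] by simp
    also have "\<dots> \<le> C0" unfolding C0_def using k_pos by (intro Max_ge) auto
    finally show ?thesis .
  qed
  define x where "x n = ln (norm (u (Suc n))) / deg_prod n" for n
  have step: "x (Suc n) - x n = b n / deg_prod (Suc n)" for n
  proof -
    have "deg_prod (Suc n) = deg_prod n * real (degree (P n))" by (simp add: deg_prod_def)
    moreover have "real (degree (P n)) > 0" using deg_ge[of n] by simp
    ultimately show ?thesis using deg_prod_pos[of n] by (simp add: x_def b_def field_simps)
  qed
  have "summable (\<lambda>n. x (Suc n) - x n)"
  proof (rule summable_comparison_test')
    show "summable (\<lambda>n. C0 * (1/2) ^ n :: real)" by (intro summable_mult summable_geometric) simp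
    fix n
    have "norm (x (Suc n) - x n) = norm (b n) / deg_prod (Suc n)"
      using deg_prod_pos[of "Suc n"] by (simp add: step)
    also have "\<dots> \<le> C0 / 2 ^ n"
    proof (intro frac_le b)
      show "0 \<le> C0" using b[of 0] norm_ge_zero order_trans by blast
      have "(2::real) ^ n \<le> 2 ^ Suc n" by simp
      then show "2 ^ n \<le> deg_prod (Suc n)" using deg_prod_ge[of "Suc n"] by linarith
    qed simp
    finally show "norm (x (Suc n) - x n) \<le> C0 * (1/2) ^ n" by (simp add: power_divide)
  qed
  then have "convergent (\<lambda>n. \<Sum>i<n. x (Suc i) - x i)" by (simp add: summable_iff_convergent)
  then have "convergent (\<lambda>n. x n - x 0)" by (simp add: sum_lessThan_telescope)
  then have "convergent (\<lambda>n. (x n - x 0) + x 0)" by (intro convergent_add convergent_const)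
  then show ?thesis by (simp add: x_def)
qed

lemma log_residue_convergent: "convergent (\<lambda>t. ln (norm (u (Suc (\<rho> + t * k)))) / deg_prod k ^ t)"
proof -
  obtain G where "(\<lambda>n. ln (norm (u (Suc n))) / deg_prod n) \<longlonglongrightarrow> G"
    using log_convergent by (auto simp: convergent_def)
  then have "(\<lambda>t. deg_prod \<rho> * (ln (norm (u (Suc (\<rho> + t * k)))) / deg_prod (\<rho> + t * k))) \<longlonglongrightarrow> deg_prod \<rho> * G"
    by (intro tendsto_mult tendsto_const filterlim_compose[OF _ filterlim_residue])
  moreover have "deg_prod \<rho> * (ln (norm (u (Suc (\<rho> + t * k)))) / deg_prod (\<rho> + t * k)) = ln (norm (u (Suc (\<rho> + t * k)))) / deg_prod k ^ t" for t
    using deg_prod_pos[of \<rho>] by (simp add: deg_prod_mult)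
  ultimately show ?thesis by (auto simp: convergent_def)
qed

text \<open>The favourable case: the leading form does not vanish in the direction of the orbit.\<close>

lemma generic_convergent:
  assumes supp: "supp_le N r" and W: "\<And>j i. r j i \<noteq> 0 \<Longrightarrow> j + degree (P \<rho>) * i \<le> W"
    and nz: "poly (lead_form N r (degree (P \<rho>)) W) (lead_coeff (P \<rho>)) \<noteq> 0"
  shows "convergent (\<lambda>t. ln (norm (bipoly N r (u (Suc (\<rho> + t * k))) (u (Suc (Suc (\<rho> + t * k)))))) / deg_prod k ^ t)"
proof -
  let ?X = "\<lambda>t. u (Suc (\<rho> + t * k))" and ?Y = "\<lambda>t. u (Suc (Suc (\<rho> + t * k)))"
  let ?L = "poly (lead_form N r (degree (P \<rho>)) W) (lead_coeff (P \<rho>))"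
  have lim: "(\<lambda>t. bipoly N r (?X t) (?Y t) / ?X t ^ W) \<longlonglongrightarrow> ?L"
    using esc_residue[of "Suc \<rho>"] by (intro bipoly_asymp[OF _ ratio_tendsto supp W]) auto
  then have nz': "eventually (\<lambda>t. bipoly N r (?X t) (?Y t) / ?X t ^ W \<noteq> 0) sequentially"
    using nz by (rule tendsto_imp_eventually_ne)
  have d0: "(\<lambda>t. 1 / deg_prod k ^ t) \<longlonglongrightarrow> 0"
    using deg_prod_k_gt_1 LIMSEQ_inverse_realpow_zero[OF deg_prod_k_gt_1] by (simp add: inverse_eq_divide)
  obtain G where G: "(\<lambda>t. ln (norm (?X t)) / deg_prod k ^ t) \<longlonglongrightarrow> G"
    using log_residue_convergent by (auto simp: convergent_def)
  have "(\<lambda>t. ln (norm (bipoly N r (?X t) (?Y t) / ?X t ^ W)) * (1 / deg_prod k ^ t) + real W * (ln (norm (?X t)) / deg_prod k ^ t))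
     \<longlonglongrightarrow> ln (norm ?L) * 0 + real W * G"
    using nz by (intro tendsto_add tendsto_mult tendsto_const tendsto_ln tendsto_norm lim d0 G) auto
  moreover have "eventually (\<lambda>t. ln (norm (bipoly N r (?X t) (?Y t) / ?X t ^ W)) * (1 / deg_prod k ^ t) + real W * (ln (norm (?X t)) / deg_prod k ^ t)
     = ln (norm (bipoly N r (?X t) (?Y t))) / deg_prod k ^ t) sequentially"
    using nz' eventually_nz_residue[of "Suc \<rho>"]
  proof eventually_elim
    case (elim t)
    then have "ln (norm (bipoly N r (?X t) (?Y t) / ?X t ^ W)) = ln (norm (bipoly N r (?X t) (?Y t))) - real W * ln (norm (?X t))"
      by (simp add: norm_divide norm_power ln_div ln_realpow)
    then show ?case by (simp add: diff_divide_distrib)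
  qed
  ultimately have "(\<lambda>t. ln (norm (bipoly N r (?X t) (?Y t))) / deg_prod k ^ t) \<longlonglongrightarrow> ln (norm ?L) * 0 + real W * G"
    by (rule Lim_transform_eventually)
  then show ?thesis by (auto simp: convergent_def)
qed

text \<open>Here \<open>W\<close> is the largest weight of a monomial, and \<open>m\<close> bounds the exponent of the first
variable among the monomials of weight \<open>W\<close>. The induction is on \<open>m\<close>. One step of the recursion is
undone each time, so the residue \<open>\<rho>\<close> is first replaced by \<open>\<rho> + k\<close>.\<close>

lemma poly_log_convergent_aux:
  assumes "supp_le N r" and "\<And>j i. r j i \<noteq> 0 \<Longrightarrow> j + degree (P (\<rho> + k - 1)) * i \<le> W"
    and "r j1 i1 \<noteq> 0" "j1 + degree (P (\<rho> + k - 1)) * i1 = W"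
    and "\<And>j i. r j i \<noteq> 0 \<Longrightarrow> j + degree (P (\<rho> + k - 1)) * i = W \<Longrightarrow> j \<le> m"
  shows "convergent (\<lambda>t. ln (norm (bipoly N r (u (\<rho> + t * k)) (u (Suc (\<rho> + t * k))))) / deg_prod k ^ t)"
  using assms
proof (induction m arbitrary: N r \<rho> W j1 i1 rule: less_induct)
  case (less m)
  \<comment> \<open>The index one step before the residue \<open>\<rho> + k\<close>, so that no index is negative.\<close>
  define \<sigma> where "\<sigma> = \<rho> + k - 1"
  have \<sigma>: "Suc \<sigma> = \<rho> + k" using k_pos by (simp add: \<sigma>_def)
  define e where "e = degree (P \<sigma>)"
  define c where "c = lead_coeff (P \<sigma>)"
  have e2: "e \<ge> 2" and c: "c \<noteq> 0" using deg_ge lead_nz by (auto simp: e_def c_def)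
  note supp = less.prems(1)
  have W: "j + e * i \<le> W" if "r j i \<noteq> 0" for j i
    using less.prems(2)[OF that] by (simp add: e_def \<sigma>_def)
  have att: "r j1 i1 \<noteq> 0" "j1 + e * i1 = W" using less.prems(3,4) by (simp_all add: e_def \<sigma>_def)
  have Lm: "j \<le> m" if "r j i \<noteq> 0" "j + e * i = W" for j i
    using less.prems(5)[OF that(1)] that(2) by (simp add: e_def \<sigma>_def)
  let ?a = "\<lambda>t. ln (norm (bipoly N r (u (\<rho> + t * k)) (u (Suc (\<rho> + t * k))))) / deg_prod k ^ t"
  have shift: "convergent ?a"
    if "convergent (\<lambda>t. ln (norm (bipoly N r (u (Suc (\<sigma> + t * k))) (u (Suc (Suc (\<sigma> + t * k)))))) / deg_prod k ^ t)"
  proof -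
    have eq: "Suc (\<sigma> + t * k) = \<rho> + Suc t * k" for t using \<sigma> by simp
    have "convergent (\<lambda>t. (1 / deg_prod k) * (ln (norm (bipoly N r (u (Suc (\<sigma> + t * k))) (u (Suc (Suc (\<sigma> + t * k)))))) / deg_prod k ^ t))"
      using that by (intro convergent_mult convergent_const)
    then have "convergent (\<lambda>t. ?a (Suc t))" by (simp only: eq) simp
    then show ?thesis by (rule convergent_Suc_iff[THEN iffD1])
  qed
  define F where "F = lead_form N r e W"
  have cF: "coeff F i = (if e * i \<le> W then r (W - e * i) i else 0)" for i
    unfolding F_def by (rule coeff_lead_form[OF supp])
  show ?case
  proof (cases "poly F c = 0")
    case False
    show ?thesis
      by (rule shift, rule generic_convergent[OF supp]) (use W False in \<open>auto simp: F_def c_def e_def\<close>)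
  next
    case bad: True
    have Fi1: "coeff F i1 \<noteq> 0" using att by (auto simp: cF)
    then have F0: "F \<noteq> 0" by auto
    define i0 where "i0 = (LEAST i. coeff F i \<noteq> 0)"
    have i0: "coeff F i0 \<noteq> 0" unfolding i0_def using Fi1 by (rule LeastI)
    have i0_low: "coeff F i = 0" if "i < i0" for i using that not_less_Least unfolding i0_def by blast
    \<comment> \<open>The exponents in \<open>F\<close> range over an interval of length at most \<open>m / e\<close>, which bounds the order of the root \<open>c\<close>.\<close>
    obtain \<mu> where \<mu>: "\<mu> + i0 \<le> degree F" "coeff (pcompose F [:c, 1:]) \<mu> \<noteq> 0"
      using low_taylor_coeff_nonzero[OF F0 c order_refl i0_low] by blast
    have dF: "e * degree F \<le> W" using F0 cF[of "degree F"] leading_coeff_0_iff[of F] by (metis (full_types))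
    have "W - e * i0 \<le> m" using i0 Lm[of "W - e * i0" i0] by (auto simp: cF split: if_splits)
    moreover have "e * \<mu> + e * i0 \<le> W" using \<mu>(1) dF by (metis add_mult_distrib2 le_trans mult_le_mono2)
    ultimately have e\<mu>: "e * \<mu> \<le> m" "e * \<mu> \<le> W" by linarith+
    have "\<mu> \<noteq> 0"
    proof
      assume "\<mu> = 0"
      then have "coeff (pcompose F [:c, 1:]) 0 \<noteq> 0" using \<mu> by simp
      then show False using bad by (simp add: poly_0_coeff_0[symmetric] poly_pcompose)
    qed
    then have "\<mu> < e * \<mu>" using e2 by simp
    then have \<mu>m: "\<mu> < m" using e\<mu> by linarith
    define r' where "r' = henon_subst N r (P \<sigma>) (A \<sigma>)"
    define N' where "N' = N + N * degree (P \<sigma>)"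
    have supp': "supp_le N' r'" unfolding N'_def r'_def by (rule supp_henon_subst)
    have w': "l + e * j \<le> W" if "r' j l \<noteq> 0" for j l
      using henon_subst_weight(1)[OF supp, of "P \<sigma>" W "A \<sigma>" j l] W that by (auto simp: r'_def e_def)
    define l0 where "l0 = W - e * \<mu>"
    have nz0: "r' \<mu> l0 \<noteq> 0"
      using henon_subst_weight(2)[OF supp, of "P \<sigma>" W \<mu> "A \<sigma>"] W \<mu>(2) e\<mu>(2) A_nz[of \<sigma>]
      by (auto simp: r'_def l0_def e_def F_def c_def)
    define e' where "e' = degree (P (\<sigma> + k - 1))"
    have e'2: "e' \<ge> 2" using deg_ge by (simp add: e'_def)
    let ?S = "(\<lambda>(j, l). j + e' * l) ` {(j, l). r' j l \<noteq> 0}"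
    have "{(j, l). r' j l \<noteq> 0} \<subseteq> {..N'} \<times> {..N'}" using supp' by (auto simp: supp_le_def)
    then have fin: "finite ?S" by (intro finite_imageI) (rule finite_subset, auto)
    define W' where "W' = Max ?S"
    have "W' \<in> ?S" unfolding W'_def using nz0 by (intro Max_in fin) auto
    then obtain j2 l2 where att': "r' j2 l2 \<noteq> 0" "j2 + e' * l2 = W'" by auto
    have W': "j + e' * l \<le> W'" if "r' j l \<noteq> 0" for j l
      unfolding W'_def using that by (intro Max_ge fin) force
    \<comment> \<open>A monomial with exponent above \<open>\<mu>\<close> has smaller new weight than the one with exponents \<open>(\<mu>, l0)\<close>.\<close>
    have Lm': "j \<le> \<mu>" if "r' j l \<noteq> 0" "j + e' * l = W'" for j l
    proof (rule ccontr)
      assume "\<not> j \<le> \<mu>"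
      then obtain s where s: "j = \<mu> + s" "s > 0" by (metis add.commute less_imp_add_positive not_le)
      have "l + e * \<mu> + e * s \<le> W" using w'[OF that(1)] s by (simp add: algebra_simps)
      then have "l + e * s \<le> l0" unfolding l0_def by linarith
      then have "e' * (l + e * s) \<le> e' * l0" by simp
      moreover have "\<mu> + e' * l0 \<le> \<mu> + s + e' * l" using W'[OF nz0] that(2) s by simp
      ultimately have "e' * (e * s) \<le> s" unfolding add_mult_distrib2 by linarith
      moreover have "2 * s \<le> e * s" using e2 by simp
      moreover have "2 * (e * s) \<le> e' * (e * s)" using e'2 by simp
      ultimately show False using s(2) by linarith
    qed
    have "convergent (\<lambda>t. ln (norm (bipoly N' r' (u (\<sigma> + t * k)) (u (Suc (\<sigma> + t * k))))) / deg_prod k ^ t)"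
      by (rule less.IH[OF \<mu>m supp', of \<sigma> W' j2 l2]) (use W' att' Lm' in \<open>auto simp: e'_def\<close>)
    then show ?thesis
      by (intro shift) (simp add: N'_def r'_def bipoly_henon_subst rec P_per_mult A_per_mult)
  qed
qed

lemma poly_log_convergent:
  assumes supp: "supp_le N r" and nz: "r j0 i0 \<noteq> 0"
  shows "convergent (\<lambda>t. ln (norm (bipoly N r (u (\<rho> + t * k)) (u (Suc (\<rho> + t * k))))) / deg_prod k ^ t)"
proof -
  let ?e = "degree (P (\<rho> + k - 1))"
  let ?S = "(\<lambda>(j, l). j + ?e * l) ` {(j, l). r j l \<noteq> 0}"
  have "{(j, l). r j l \<noteq> 0} \<subseteq> {..N} \<times> {..N}" using supp by (auto simp: supp_le_def)
  then have fin: "finite ?S" by (intro finite_imageI) (rule finite_subset, auto)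
  have "Max ?S \<in> ?S" using nz by (intro Max_in fin) auto
  then obtain j1 i1 where "r j1 i1 \<noteq> 0" "j1 + ?e * i1 = Max ?S" by auto
  moreover have "j + ?e * l \<le> Max ?S" if "r j l \<noteq> 0" for j l
    using that by (intro Max_ge fin) force
  moreover have "j \<le> N" if "r j l \<noteq> 0" for j l using supp that by (auto simp: supp_le_def)
  ultimately show ?thesis
    using poly_log_convergent_aux[OF supp, of \<rho> "Max ?S" j1 i1 N] by blast
qed

end

section \<open>Polynomial maps of \<open>\<complex>\<^sup>2\<close> and their growth\<close>

text \<open>The function \<open>log\<^sup>+\<close> of the norm.\<close>

definition logp :: "C2 \<Rightarrow> real" where "logp z = ln (max 1 (norm z))"

lemma logp_eq: "max 0 (ln (norm z)) = logp z" for z :: C2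
proof (cases "norm z \<ge> 1")
  case True then show ?thesis by (simp add: logp_def)
next
  case False
  then have "ln (norm z) \<le> 0" by (cases "z = 0") auto
  then show ?thesis using False by (simp add: logp_def)
qed

lemma logp_nonneg: "logp z \<ge> 0" by (simp add: logp_def)

lemma norm_C2_le: "norm z \<le> norm (z $ 1) + norm (z $ 2)" for z :: C2
  using L2_set_le_sum[of UNIV "\<lambda>i. norm (z $ i)"] by (simp add: norm_vec_def sum_2)

lemma C2_eq_vector: "z = vector [z $ 1, z $ 2]" for z :: C2
  unfolding vec_eq_iff forall_2 vector_2 by simp

lemma continuous_C2:
  fixes F :: "'a::topological_space \<Rightarrow> C2"
  assumes "\<And>i. continuous_on S (\<lambda>x. F x $ i)"
  shows "continuous_on S F"
proof -
  have "continuous_on S (\<lambda>x. \<chi> i. F x $ i)" using assms by (intro continuous_on_vec_lambda)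
  then show ?thesis by simp
qed

lemma poly_fun_bipoly:
  fixes g :: "C2 \<Rightarrow> complex"
  assumes "poly_fun_deg_le n g"
  obtains r where "supp_le n r" "\<And>z :: C2. g z = bipoly n r (z $ 1) (z $ 2)"
proof -
  obtain c where c: "\<And>z. g z = (\<Sum>i\<le>n. \<Sum>j\<le>n - i. c i j * (z $ 1) ^ i * (z $ 2) ^ j)"
    using assms unfolding poly_fun_deg_le_def by blast
  define r where "r i j = (if i \<le> n \<and> j \<le> n - i then c i j else 0)" for i j
  have "supp_le n r" by (auto simp: supp_le_def r_def)
  moreover have "g z = bipoly n r (z $ 1) (z $ 2)" for z
    unfolding c bipoly_def
    by (intro sum.cong refl sum.mono_neutral_cong_left) (auto simp: r_def)
  ultimately show ?thesis using that by blast
qed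

lemma polynomial_map_bipoly:
  fixes F :: "C2 \<Rightarrow> C2"
  assumes "polynomial_map F"
  obtains n r where "\<And>i. supp_le n (r i)" "\<And>(z :: C2) i. F z $ i = bipoly n (r i) (z $ 1) (z $ 2)"
proof -
  obtain n where n: "\<And>i. poly_fun_deg_le n (\<lambda>z. F z $ i)"
    using assms unfolding polynomial_map_def poly_map_deg_le_def by blast
  have "\<exists>r. supp_le n r \<and> (\<forall>z. F z $ i = bipoly n r (z $ 1) (z $ 2))" for i
    using poly_fun_bipoly[OF n[of i]] by metis
  then show ?thesis using that by metis
qed

lemma continuous_on_bipoly [continuous_intros]:
  "continuous_on S f \<Longrightarrow> continuous_on S g \<Longrightarrow> continuous_on S (\<lambda>x. bipoly n r (f x) (g x))"
  unfolding bipoly_def by (intro continuous_intros)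

lemma polynomial_map_continuous: "polynomial_map F \<Longrightarrow> continuous_on UNIV F"
  by (erule polynomial_map_bipoly, rule continuous_C2) (simp, intro continuous_intros)

lemma henon_map_continuous: "continuous_on UNIV (henon_map p a)"
proof (rule continuous_C2)
  fix i :: 2
  have "continuous_on UNIV (\<lambda>z. henon_map p a z $ 1) \<and> continuous_on UNIV (\<lambda>z. henon_map p a z $ 2)"
    unfolding henon_map_def by (auto intro!: continuous_intros)
  then show "continuous_on UNIV (\<lambda>z. henon_map p a z $ i)" using exhaust_2[of i] by auto
qed

lemma henon_composition_continuous: "henon_composition h d \<Longrightarrow> continuous_on UNIV h"
proof (induction rule: henon_composition.induct)
  case (comp h m p a)
  then show ?case
    by (intro continuous_on_compose) (auto intro: continuous_on_subset[OF henon_map_continuous])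
qed (rule henon_map_continuous)

lemma logp_power_bound:
  assumes "norm w \<le> K * max 1 (norm z) ^ n"
  shows "logp w \<le> real n * logp z + ln (max 1 K)"
proof -
  let ?m = "max 1 (norm z)"
  have m: "?m \<ge> 1" by simp
  have "max 1 (norm w) \<le> max 1 K * ?m ^ n"
  proof -
    have 1: "(1::real) \<le> max 1 K" "1 \<le> ?m ^ n" by auto
    then have "1 * 1 \<le> max 1 K * ?m ^ n" by (intro mult_mono) auto
    moreover have "K * ?m ^ n \<le> max 1 K * ?m ^ n" using 1 by (intro mult_right_mono) auto
    ultimately show ?thesis using assms by (intro max.boundedI) linarith+
  qed
  then have "ln (max 1 (norm w)) \<le> ln (max 1 K * ?m ^ n)" by (subst ln_le_cancel_iff) auto
  also have "\<dots> = ln (max 1 K) + real n * ln ?m" using m by (simp add: ln_mult ln_realpow)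
  finally show ?thesis by (simp add: logp_def)
qed

lemma bipoly_bound:
  "norm (bipoly n r (z $ 1) (z $ 2)) \<le> (\<Sum>j\<le>n. \<Sum>i\<le>n. norm (r j i)) * max 1 (norm z) ^ (2 * n)" for z :: C2
proof -
  let ?m = "max 1 (norm z)"
  have "norm (bipoly n r (z $ 1) (z $ 2)) \<le> (\<Sum>j\<le>n. \<Sum>i\<le>n. norm (r j i * (z $ 1) ^ j * (z $ 2) ^ i))"
    unfolding bipoly_def by (intro order.trans[OF norm_sum] sum_mono norm_sum)
  also have "\<dots> \<le> (\<Sum>j\<le>n. \<Sum>i\<le>n. norm (r j i) * ?m ^ (2 * n))"
  proof (intro sum_mono)
    fix j i assume "j \<in> {..n}" "i \<in> {..n}"
    have z: "norm (z $ 1) \<le> ?m" "norm (z $ 2) \<le> ?m"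
      using Finite_Cartesian_Product.norm_nth_le[of z] by (simp_all add: le_max_iff_disj)
    have "norm (z $ 1) ^ j * norm (z $ 2) ^ i \<le> ?m ^ j * ?m ^ i"
      using z by (intro mult_mono power_mono) auto
    also have "\<dots> = ?m ^ (j + i)" by (simp add: power_add)
    also have "\<dots> \<le> ?m ^ (2 * n)" using \<open>j \<in> _\<close> \<open>i \<in> _\<close> by (intro power_increasing) auto
    finally show "norm (r j i * (z $ 1) ^ j * (z $ 2) ^ i) \<le> norm (r j i) * ?m ^ (2 * n)"
      by (simp add: norm_mult norm_power mult.assoc mult_left_mono)
  qed
  finally show ?thesis by (simp add: sum_distrib_right)
qed

lemma polynomial_map_logp_bound:
  assumes "polynomial_map F"
  obtains M C where "M \<ge> 0" "C \<ge> 0" "\<And>z. logp (F z) \<le> M * logp z + C"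
proof -
  obtain n r where F: "\<And>(z :: C2) i. F z $ i = bipoly n (r i) (z $ 1) (z $ 2)"
    using polynomial_map_bipoly[OF assms] by metis
  define K where "K i = (\<Sum>j\<le>n. \<Sum>l\<le>n. norm (r i j l))" for i
  have "norm (F z) \<le> (K 1 + K 2) * max 1 (norm z) ^ (2 * n)" for z
    using norm_C2_le[of "F z"] bipoly_bound[of n "r 1" z] bipoly_bound[of n "r 2" z]
    by (simp add: F K_def distrib_right)
  then have "logp (F z) \<le> real (2 * n) * logp z + ln (max 1 (K 1 + K 2))" for z
    by (rule logp_power_bound)
  then show ?thesis using that[of "real (2 * n)" "ln (max 1 (K 1 + K 2))"] by simp
qed

lemma henon_map_logp_bound:
  assumes "degree p \<ge> 2"
  shows "\<exists>C\<ge>0. \<forall>z. logp (henon_map p a z) \<le> real (degree p) * logp z + C"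
proof -
  define K where "K = 1 + (\<Sum>i\<le>degree p. norm (coeff p i)) + norm a"
  have "norm (henon_map p a z) \<le> K * max 1 (norm z) ^ degree p" for z
  proof -
    let ?m = "max 1 (norm z)"
    have z: "norm (z $ 1) \<le> ?m" "norm (z $ 2) \<le> ?m"
      using Finite_Cartesian_Product.norm_nth_le[of z] by (simp_all add: le_max_iff_disj)
    have m: "?m \<le> ?m ^ degree p" using power_increasing[of 1 "degree p" ?m] assms by simp
    have "norm (poly p (z $ 2)) \<le> (\<Sum>i\<le>degree p. norm (coeff p i * (z $ 2) ^ i))"
      unfolding poly_altdef by (rule norm_sum)
    also have "\<dots> \<le> (\<Sum>i\<le>degree p. norm (coeff p i) * ?m ^ degree p)"
    proof (rule sum_mono)
      fix i assume i: "i \<in> {..degree p}"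
      have "norm (z $ 2) ^ i \<le> ?m ^ i" using z by (intro power_mono) auto
      also have "\<dots> \<le> ?m ^ degree p" using i by (intro power_increasing) auto
      finally show "norm (coeff p i * (z $ 2) ^ i) \<le> norm (coeff p i) * ?m ^ degree p"
        by (simp add: norm_mult norm_power mult_left_mono)
    qed
    finally have 1: "norm (poly p (z $ 2)) \<le> (\<Sum>i\<le>degree p. norm (coeff p i)) * ?m ^ degree p"
      by (simp add: sum_distrib_right)
    have 2: "norm (a * z $ 1) \<le> norm a * ?m ^ degree p"
      using order.trans[OF z(1) m] by (simp add: norm_mult mult_left_mono)
    have "norm (henon_map p a z) \<le> norm (z $ 2) + norm (poly p (z $ 2) - a * z $ 1)"
      using norm_C2_le[of "henon_map p a z"] by (simp add: henon_map_def)
    also have "\<dots> \<le> norm (z $ 2) + (norm (poly p (z $ 2)) + norm (a * z $ 1))"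
      using norm_triangle_ineq4 by (intro add_left_mono) blast
    also have "\<dots> \<le> ?m ^ degree p + ((\<Sum>i\<le>degree p. norm (coeff p i)) * ?m ^ degree p + norm a * ?m ^ degree p)"
      using z(2) m 1 2 by linarith
    finally show ?thesis by (simp add: K_def algebra_simps)
  qed
  then have "logp (henon_map p a z) \<le> real (degree p) * logp z + ln (max 1 K)" for z
    by (rule logp_power_bound)
  then show ?thesis by (intro exI[of _ "ln (max 1 K)"]) simp
qed

lemma henon_composition_logp_bound:
  "henon_composition h d \<Longrightarrow> \<exists>C\<ge>0. \<forall>z. logp (h z) \<le> real d * logp z + C"
proof (induction rule: henon_composition.induct)
  case (single p a)
  then show ?case by (intro henon_map_logp_bound)
next
  case (comp h m p a)
  then obtain C1 where C1: "C1 \<ge> 0" "\<And>z. logp (h z) \<le> real m * logp z + C1" by blast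
  obtain C2 where C2: "C2 \<ge> 0" "\<And>z. logp (henon_map p a z) \<le> real (degree p) * logp z + C2"
    using henon_map_logp_bound[OF comp.hyps(2)] by blast
  show ?case
  proof (intro exI conjI allI)
    show "0 \<le> real (degree p) * C1 + C2" using C1 C2 by simp
    fix z
    have "logp (henon_map p a (h z)) \<le> real (degree p) * (real m * logp z + C1) + C2"
      using C2(2)[of "h z"] mult_left_mono[OF C1(2)[of z], of "real (degree p)"] by linarith
    then show "logp ((henon_map p a \<circ> h) z) \<le> real (degree p * m) * logp z + (real (degree p) * C1 + C2)"
      by (simp add: algebra_simps)
  qed
qed

lemma henon_composition_iterate_bound:
  assumes h: "henon_composition h d" and d: "d > 1"
  obtains C where "C \<ge> 0" "\<And>z n. logp ((h ^^ n) z) \<le> real d ^ n * (logp z + C)"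
proof -
  obtain C where C: "C \<ge> 0" "\<And>z. logp (h z) \<le> real d * logp z + C"
    using henon_composition_logp_bound[OF h] by blast
  have "logp ((h ^^ n) z) + C \<le> real d ^ n * (logp z + C)" for n z
  proof (induction n)
    case (Suc n)
    have "2 * C \<le> real d * C" using C(1) d by (intro mult_right_mono) auto
    then have "logp ((h ^^ Suc n) z) + C \<le> real d * (logp ((h ^^ n) z) + C)"
      using C(2)[of "(h ^^ n) z"] by (simp add: algebra_simps)
    also have "\<dots> \<le> real d * (real d ^ n * (logp z + C))" using Suc by (intro mult_left_mono) auto
    finally show ?case by simp
  qed simp
  then show ?thesis using that[OF C(1)] C(1) by (smt (verit))
qed

section \<open>Existence and smallness of the Green function\<close>

lemma henon_composition_word:
  "henon_composition h d \<Longrightarrow> \<exists>k P A. k > 0 \<and> (\<forall>j<k. degree (P j) \<ge> 2 \<and> A j \<noteq> 0) \<and> (\<Prod>j<k. degree (P j)) = d \<and>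
     (\<forall>u. (\<forall>j<k. u (Suc (Suc j)) = poly (P j) (u (Suc j)) - A j * u j) \<longrightarrow>
        h (vector [u 0, u 1]) = vector [u k, u (Suc k)])"
proof (induction rule: henon_composition.induct)
  case (single p a)
  show ?case
    by (rule exI[of _ 1], rule exI[of _ "\<lambda>_. p"], rule exI[of _ "\<lambda>_. a"])
       (use single in \<open>auto simp: henon_map_def\<close>)
next
  case (comp h m p a)
  then obtain k P A where k: "k > 0" "\<forall>j<k. degree (P j) \<ge> 2 \<and> A j \<noteq> 0" "(\<Prod>j<k. degree (P j)) = m"
    and hk: "\<And>u. (\<forall>j<k. u (Suc (Suc j)) = poly (P j) (u (Suc j)) - A j * u j) \<Longrightarrow>
        h (vector [u 0, u 1]) = vector [u k, u (Suc k)]" by metis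
  show ?case
  proof (rule exI[of _ "Suc k"], rule exI[of _ "P(k := p)"], rule exI[of _ "A(k := a)"], intro conjI allI impI)
    show "(\<Prod>j<Suc k. degree ((P(k := p)) j)) = degree p * m" using k(3) by simp
    fix u :: "nat \<Rightarrow> complex"
    assume u: "\<forall>j<Suc k. u (Suc (Suc j)) = poly ((P(k := p)) j) (u (Suc j)) - (A(k := a)) j * u j"
    have "h (vector [u 0, u 1]) = vector [u k, u (Suc k)]"
      by (rule hk) (use u in \<open>auto simp: less_Suc_eq\<close>)
    then show "(henon_map p a \<circ> h) (vector [u 0, u 1]) = vector [u (Suc k), u (Suc (Suc k))]"
      using u by (simp add: henon_map_def)
  qed (use comp.hyps k in \<open>auto simp: less_Suc_eq\<close>)
qed

lemma henon_composition_orbit: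
  assumes "henon_composition h d"
  obtains k P A u where "henon_orbit k P A u" "henon_orbit.deg_prod P k = real d"
    "\<And>n. (h ^^ n) z = vector [u (n * k), u (Suc (n * k))]"
proof -
  obtain k P A where k: "k > 0" "\<forall>j<k. degree (P j) \<ge> 2 \<and> A j \<noteq> 0" "(\<Prod>j<k. degree (P j)) = d"
    and hk: "\<And>u. (\<forall>j<k. u (Suc (Suc j)) = poly (P j) (u (Suc j)) - A j * u j) \<Longrightarrow>
        h (vector [u 0, u 1]) = vector [u k, u (Suc k)]"
    using henon_composition_word[OF assms] by metis
  define P' A' where "P' n = P (n mod k)" and "A' n = A (n mod k)" for n
  define v where "v = rec_nat z (\<lambda>i w. henon_map (P' i) (A' i) w)"
  define u where "u i = v i $ 1" for i
  have vS: "v (Suc i) = henon_map (P' i) (A' i) (v i)" for i by (simp add: v_def)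
  have u1: "u (Suc i) = v i $ 2" for i by (simp add: u_def vS henon_map_def)
  have rec: "u (Suc (Suc n)) = poly (P' n) (u (Suc n)) - A' n * u n" for n
    by (simp add: u1 vS henon_map_def) (simp add: u_def)
  have orb: "henon_orbit k P' A' u"
    by unfold_locales (use k rec in \<open>auto simp: P'_def A'_def\<close>)
  have "henon_orbit.deg_prod P' k = real d"
    unfolding henon_orbit.deg_prod_def[OF orb] using k(3) by (simp add: P'_def flip: of_nat_prod)
  moreover have "(h ^^ n) z = vector [u (n * k), u (Suc (n * k))]" for n
  proof (induction n)
    case 0
    have "u 0 = z $ 1" "u 1 = z $ 2" using u1[of 0] by (simp_all add: u_def v_def)
    then show ?case using C2_eq_vector[of z] by simp
  next
    case (Suc n)
    have "h (vector [u (n * k), u (Suc (n * k))]) = vector [u (k + n * k), u (Suc (k + n * k))]"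
      using hk[of "\<lambda>j. u (j + n * k)"] rec by (simp add: P'_def A'_def)
    then show ?case using Suc by simp
  qed
  ultimately show ?thesis using that orb by blast
qed

text \<open>The Green function of a polynomial conjugate of \<open>h\<close> is a limit of this form, with \<open>Q\<close> the
inverse of the conjugating map.\<close>

lemma henon_poly_log_convergent:
  assumes h: "henon_composition h d" and d: "d > 1" and Q: "polynomial_map Q"
  shows "convergent (\<lambda>n. logp (Q ((h ^^ n) z)) / real d ^ n)"
proof -
  obtain k P A u where orb: "henon_orbit k P A u" and Dk: "henon_orbit.deg_prod P k = real d"
    and hn: "\<And>n. (h ^^ n) z = vector [u (n * k), u (Suc (n * k))]"
    using henon_composition_orbit[OF h] by metis
  interpret henon_orbit k P A u by (rule orb)
  have d0: "(\<lambda>n. c / real d ^ n) \<longlonglongrightarrow> 0" for c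
    using tendsto_mult_left[OF LIMSEQ_inverse_realpow_zero[of "real d"], of c] d by (simp add: divide_inverse)
  consider "bounded (range u)"
    | n0 where "\<forall>n\<ge>n0. norm (u n) \<le> norm (u (Suc n))" "filterlim u at_infinity sequentially"
    using bounded_or_escaping by blast
  then show ?thesis
  proof cases
    case 1
    then obtain B where B: "\<And>n. norm (u n) \<le> B" by (auto simp: bounded_iff)
    obtain M C where M: "M \<ge> 0" "\<And>z. logp (Q z) \<le> M * logp z + C"
      using polynomial_map_logp_bound[OF Q] by metis
    have "logp (Q ((h ^^ n) z)) \<le> M * ln (max 1 (B + B)) + C" for n
    proof -
      have "norm ((h ^^ n) z) \<le> B + B"
        using norm_C2_le[of "(h ^^ n) z"] B[of "n * k"] B[of "Suc (n * k)"] by (simp add: hn)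
      then have "logp ((h ^^ n) z) \<le> ln (max 1 (B + B))"
        unfolding logp_def by (subst ln_le_cancel_iff) auto
      then have "M * logp ((h ^^ n) z) \<le> M * ln (max 1 (B + B))" using M(1) by (rule mult_left_mono)
      then show ?thesis using M(2)[of "(h ^^ n) z"] by linarith
    qed
    then have "(\<lambda>n. logp (Q ((h ^^ n) z)) / real d ^ n) \<longlonglongrightarrow> 0"
      using d by (intro tendsto_sandwich[OF _ _ tendsto_const d0[of "M * ln (max 1 (B + B)) + C"]])
        (auto simp: logp_nonneg intro!: always_eventually divide_right_mono)
    then show ?thesis by (auto simp: convergent_def)
  next
    case (2 n0)
    interpret escaping_orbit k P A u n0 by (unfold_locales; use 2 in blast)
    obtain n r where r: "\<And>i. supp_le n (r i)" "\<And>z i. Q z $ i = bipoly n (r i) (z $ 1) (z $ 2)"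
      using polynomial_map_bipoly[OF Q] by metis
    let ?q = "\<lambda>i t. Q ((h ^^ t) z) $ i"
    have comp: "convergent (\<lambda>t. max 0 (ln (norm (?q i t)) / real d ^ t))" for i
    proof -
      have "convergent (\<lambda>t. ln (norm (?q i t)) / real d ^ t)"
      proof (cases "\<exists>j l. r i j l \<noteq> 0")
        case True
        then obtain j l where jl: "r i j l \<noteq> 0" by blast
        show ?thesis using poly_log_convergent[OF r(1) jl, of 0] by (simp add: r(2) hn Dk)
      next
        case False
        then have "?q i t = 0" for t by (simp add: r(2) bipoly_def)
        then show ?thesis by (simp add: convergent_const)
      qed
      then obtain l where "(\<lambda>t. ln (norm (?q i t)) / real d ^ t) \<longlonglongrightarrow> l" by (auto simp: convergent_def)
      then show ?thesis by (intro convergentI[OF tendsto_max[OF tendsto_const]])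
    qed
    obtain l1 where l1: "(\<lambda>t. max 0 (ln (norm (?q 1 t)) / real d ^ t)) \<longlonglongrightarrow> l1" using comp[of 1] by (auto simp: convergent_def)
    obtain l2 where l2: "(\<lambda>t. max 0 (ln (norm (?q 2 t)) / real d ^ t)) \<longlonglongrightarrow> l2" using comp[of 2] by (auto simp: convergent_def)
    \<comment> \<open>The logarithm of the maximum of the two components differs from that of the norm by at most \<open>ln 2\<close>.\<close>
    define m where "m t = max (ln (max 1 (norm (?q 1 t)))) (ln (max 1 (norm (?q 2 t))))" for t
    have scal: "max 0 (ln (norm w) / real d ^ t) = ln (max 1 (norm w)) / real d ^ t" for w :: complex and t
    proof -
      have "max 0 (ln (norm w)) = ln (max 1 (norm w))"
      proof (cases "norm w \<ge> 1")
        case True then show ?thesis by simp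
      next
        case False
        then have "ln (norm w) \<le> 0" by (cases "w = 0") auto
        then show ?thesis using False by simp
      qed
      moreover have "max 0 (x / real d ^ t) = max 0 x / real d ^ t" for x
        using d by (simp add: max_divide_distrib_right)
      ultimately show ?thesis by simp
    qed
    have m: "(\<lambda>t. m t / real d ^ t) \<longlonglongrightarrow> max l1 l2"
    proof -
      have "m t / real d ^ t = max (max 0 (ln (norm (?q 1 t)) / real d ^ t)) (max 0 (ln (norm (?q 2 t)) / real d ^ t))" for t
        unfolding scal m_def using d by (simp add: max_divide_distrib_right)
      then show ?thesis using tendsto_max[OF l1 l2] by simp
    qed
    have lo: "m t \<le> logp (Q ((h ^^ t) z))" for t
      unfolding m_def logp_def using Finite_Cartesian_Product.norm_nth_le[of "Q ((h ^^ t) z)"]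
      by (auto intro!: max.boundedI simp: max.coboundedI2)
    have hi: "logp (Q ((h ^^ t) z)) \<le> m t + ln 2" for t
    proof -
      let ?a = "max 1 (norm (?q 1 t))" and ?b = "max 1 (norm (?q 2 t))"
      have "max 1 (norm (Q ((h ^^ t) z))) \<le> 2 * max ?a ?b"
        using norm_C2_le[of "Q ((h ^^ t) z)"] by (auto simp: max_def)
      then have "logp (Q ((h ^^ t) z)) \<le> ln (2 * max ?a ?b)"
        unfolding logp_def by (subst ln_le_cancel_iff) auto
      also have "\<dots> = ln 2 + ln (max ?a ?b)" by (subst ln_mult) auto
      also have "ln (max ?a ?b) = m t"
      proof -
        have "ln (max a b) = max (ln a) (ln b)" if "a \<ge> 1" "b \<ge> 1" for a b :: real
          using that by (cases "a \<le> b") (simp_all add: max_absorb1 max_absorb2)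
        then show ?thesis by (simp add: m_def)
      qed
      finally show ?thesis by simp
    qed
    have "(\<lambda>t. logp (Q ((h ^^ t) z)) / real d ^ t) \<longlonglongrightarrow> max l1 l2"
    proof (rule tendsto_sandwich[OF _ _ m])
      show "(\<lambda>t. (m t + ln 2) / real d ^ t) \<longlonglongrightarrow> max l1 l2"
        using tendsto_add[OF m d0[of "ln 2"]] by (simp add: add_divide_distrib)
    qed (use lo hi d in \<open>auto intro!: always_eventually divide_right_mono\<close>)
    then show ?thesis by (auto simp: convergent_def)
  qed
qed

text \<open>The Green function is bounded by each of the functions
\<open>M * (logp ((h ^^ m) (\<phi> p)) + C) / d ^ m\<close>, which are continuous in \<open>p\<close> and at a point with
bounded orbit become small for large \<open>m\<close>.\<close>

lemma G_plus_less_one_near_bounded_orbit: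
  assumes conj: "conjugate_to_henon_composition f d" and d: "d > 1" "dynamical_degree f = real d"
    and bdd: "bounded (range (\<lambda>n. (f ^^ n) x))"
  shows "eventually (\<lambda>p. G_plus f p < 1) (nhds x)"
proof -
  obtain \<phi> h where \<phi>: "polynomial_diffeo \<phi>" and h: "henon_composition h d" and f: "f = inv \<phi> \<circ> h \<circ> \<phi>"
    using conj unfolding conjugate_to_henon_composition_def by blast
  have bij: "bij \<phi>" and p\<phi>: "polynomial_map \<phi>" and pi: "polynomial_map (inv \<phi>)"
    using \<phi> by (auto simp: polynomial_diffeo_def)
  have fn: "(f ^^ n) p = inv \<phi> ((h ^^ n) (\<phi> p))" for n p
  proof (induction n)
    case 0 then show ?case using bij by (simp add: bij_is_inj)
  next
    case (Suc n) then show ?case using bij by (simp add: f surj_f_inv_f bij_is_surj)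
  qed
  have hn: "(h ^^ n) (\<phi> p) = \<phi> ((f ^^ n) p)" for n p
    using bij by (simp add: fn surj_f_inv_f bij_is_surj)
  have conv: "convergent (\<lambda>n. max 0 (ln (norm ((f ^^ n) p))) / dynamical_degree f ^ n)" for p
    using henon_poly_log_convergent[OF h d(1) pi] by (simp add: logp_eq fn d(2))
  obtain M C1 where M: "M \<ge> 0" "C1 \<ge> 0" "\<And>z. logp (inv \<phi> z) \<le> M * logp z + C1"
    using polynomial_map_logp_bound[OF pi] by metis
  obtain C where C: "C \<ge> 0" "\<And>z n. logp ((h ^^ n) z) \<le> real d ^ n * (logp z + C)"
    using henon_composition_iterate_bound[OF h d(1)] by metis
  obtain M2 C2 where M2: "M2 \<ge> 0" "\<And>z. logp (\<phi> z) \<le> M2 * logp z + C2"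
    using polynomial_map_logp_bound[OF p\<phi>] by metis
  obtain B where B: "\<And>n. norm ((f ^^ n) x) \<le> B" using bdd by (auto simp: bounded_iff)
  define B' where "B' = M2 * ln (max 1 B) + C2"
  have hB: "logp ((h ^^ n) (\<phi> x)) \<le> B'" for n
  proof -
    have "logp ((f ^^ n) x) \<le> ln (max 1 B)" unfolding logp_def using B[of n] by (subst ln_le_cancel_iff) auto
    then have "M2 * logp ((f ^^ n) x) \<le> M2 * ln (max 1 B)" using M2(1) by (rule mult_left_mono)
    then show ?thesis using M2(2)[of "(f ^^ n) x"] by (simp add: hn B'_def)
  qed
  have inv0: "(\<lambda>n. c / real d ^ n) \<longlonglongrightarrow> 0" for c
    using tendsto_mult_left[OF LIMSEQ_inverse_realpow_zero[of "real d"], of c] d by (simp add: divide_inverse)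
  have "eventually (\<lambda>m. M * (B' + 1 + C) / real d ^ m < 1) sequentially"
    by (rule order_tendstoD(2)[OF inv0]) simp
  then obtain m where m: "M * (B' + 1 + C) / real d ^ m < 1" by (auto simp: eventually_sequentially)
  have G_le: "G_plus f p \<le> M * (logp ((h ^^ m) (\<phi> p)) + C) / real d ^ m" for p
  proof -
    let ?L = "logp ((h ^^ m) (\<phi> p)) + C"
    have lim: "(\<lambda>n. logp ((f ^^ n) p) / real d ^ n) \<longlonglongrightarrow> G_plus f p"
      using conv[of p] unfolding convergent_LIMSEQ_iff G_plus_def by (simp add: logp_eq d(2))
    have "logp ((f ^^ (n + m)) p) / real d ^ (n + m) \<le> M * ?L / real d ^ m + C1 / real d ^ (n + m)" for n
    proof -
      have "logp ((h ^^ (n + m)) (\<phi> p)) \<le> real d ^ n * ?L"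
        using C(2)[of n "(h ^^ m) (\<phi> p)"] by (simp add: funpow_add)
      then have "logp ((f ^^ (n + m)) p) \<le> M * (real d ^ n * ?L) + C1"
        unfolding fn using M(3)[of "(h ^^ (n + m)) (\<phi> p)"] mult_left_mono[OF _ M(1)] by (meson add_right_mono order_trans)
      then have "logp ((f ^^ (n + m)) p) / real d ^ (n + m) \<le> (M * (real d ^ n * ?L) + C1) / real d ^ (n + m)"
        using d(1) by (intro divide_right_mono) auto
      also have "\<dots> = M * ?L / real d ^ m + C1 / real d ^ (n + m)"
        using d(1) by (simp add: add_divide_distrib power_add)
      finally show ?thesis .
    qed
    moreover have "(\<lambda>n. M * ?L / real d ^ m + C1 / real d ^ (n + m)) \<longlonglongrightarrow> M * ?L / real d ^ m + 0"
      by (intro tendsto_intros LIMSEQ_ignore_initial_segment[OF inv0])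
    ultimately show ?thesis
      using LIMSEQ_le[OF LIMSEQ_ignore_initial_segment[OF lim, of m]] by (simp add: add.commute)
  qed
  have "continuous_on UNIV (h ^^ m)"
  proof (induction m)
    case (Suc m)
    have "continuous_on UNIV (\<lambda>x. h ((h ^^ m) x))"
      by (rule continuous_on_compose2[OF henon_composition_continuous[OF h] Suc]) auto
    then show ?case by (simp add: o_def)
  qed (simp add: id_def)
  then have "continuous_on UNIV (\<lambda>p. (h ^^ m) (\<phi> p))"
    using polynomial_map_continuous[OF p\<phi>] by (rule continuous_on_compose2) auto
  then have "continuous_on UNIV (\<lambda>p. logp ((h ^^ m) (\<phi> p)))"
    unfolding logp_def by (intro continuous_intros) auto
  then have "(\<lambda>p. logp ((h ^^ m) (\<phi> p))) \<midarrow>x\<rightarrow> logp ((h ^^ m) (\<phi> x))"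
    by (simp add: continuous_on_eq_continuous_at isCont_def)
  then have "((\<lambda>p. logp ((h ^^ m) (\<phi> p))) \<longlongrightarrow> logp ((h ^^ m) (\<phi> x))) (nhds x)"
    by (rule tendsto_at_iff_tendsto_nhds[THEN iffD1])
  then have "eventually (\<lambda>p. logp ((h ^^ m) (\<phi> p)) < B' + 1) (nhds x)"
    using hB[of m] by (intro order_tendstoD(2)) auto
  then show ?thesis
  proof eventually_elim
    case (elim p)
    have "M * (logp ((h ^^ m) (\<phi> p)) + C) / real d ^ m \<le> M * (B' + 1 + C) / real d ^ m"
      using elim M(1) d(1) by (intro divide_right_mono mult_left_mono) auto
    then show ?case using G_le[of p] m by linarith
  qed
qed

section \<open>Derivatives of iterates\<close>

text \<open>The map \<open>D\<close> is the derivative of \<open>F\<close>, and it depends continuously on the point.\<close>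

definition C1_deriv :: "(C2 \<Rightarrow> C2) \<Rightarrow> (C2 \<Rightarrow> C2 \<Rightarrow>\<^sub>L C2) \<Rightarrow> bool" where
  "C1_deriv F D \<longleftrightarrow> (\<forall>x. (F has_derivative blinfun_apply (D x)) (at x)) \<and> continuous_on UNIV D"

lemma bipoly_has_derivative:
  fixes z :: C2
  shows "((\<lambda>z. bipoly n r (z $ 1) (z $ 2)) has_derivative
     (\<lambda>v. (\<Sum>j\<le>n. \<Sum>i\<le>n. r j i * (of_nat j * (z $ 1) ^ (j - 1)) * (z $ 2) ^ i) * v $ 1
        + (\<Sum>j\<le>n. \<Sum>i\<le>n. r j i * (z $ 1) ^ j * (of_nat i * (z $ 2) ^ (i - 1))) * v $ 2)) (at z)"
proof -
  have comp: "((\<lambda>z :: C2. z $ k) has_derivative (\<lambda>v. v $ k)) (at z)" for k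
    by (rule bounded_linear.has_derivative[OF bounded_linear_vec_nth has_derivative_ident])
  have mono: "((\<lambda>z :: C2. r j i * (z $ 1) ^ j * (z $ 2) ^ i) has_derivative
      (\<lambda>v. r j i * (of_nat j * (z $ 1) ^ (j - 1)) * (z $ 2) ^ i * v $ 1
         + r j i * (z $ 1) ^ j * (of_nat i * (z $ 2) ^ (i - 1)) * v $ 2)) (at z)" for j i
    by (rule has_derivative_eq_rhs, rule has_derivative_mult[OF has_derivative_mult[OF has_derivative_const
          has_derivative_power[OF comp]] has_derivative_power[OF comp]])
       (auto simp: fun_eq_iff algebra_simps)
  have "((\<lambda>z :: C2. \<Sum>j\<le>n. \<Sum>i\<le>n. r j i * (z $ 1) ^ j * (z $ 2) ^ i) has_derivative
      (\<lambda>v. \<Sum>j\<le>n. \<Sum>i\<le>n. r j i * (of_nat j * (z $ 1) ^ (j - 1)) * (z $ 2) ^ i * v $ 1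
         + r j i * (z $ 1) ^ j * (of_nat i * (z $ 2) ^ (i - 1)) * v $ 2)) (at z)"
    by (intro has_derivative_sum mono)
  then show ?thesis
    unfolding bipoly_def by (simp add: sum.distrib sum_distrib_right)
qed

lemma polynomial_map_C1:
  assumes "polynomial_map F"
  shows "\<exists>D. C1_deriv F D"
proof -
  obtain n r where F: "\<And>(z :: C2) i. F z $ i = bipoly n (r i) (z $ 1) (z $ 2)"
    using polynomial_map_bipoly[OF assms] by metis
  define a where "a i z = (\<Sum>j\<le>n. \<Sum>l\<le>n. r i j l * (of_nat j * (z $ 1) ^ (j - 1)) * (z $ 2) ^ l)" for i and z :: C2
  define b where "b i z = (\<Sum>j\<le>n. \<Sum>l\<le>n. r i j l * (z $ 1) ^ j * (of_nat l * (z $ 2) ^ (l - 1)))" for i and z :: C2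
  define L :: "C2 \<Rightarrow> C2 \<Rightarrow> C2" where "L z v = (\<chi> i. a i z * v $ 1 + b i z * v $ 2)" for z v
  have "linear (L z)" for z
    by (intro linearI) (simp_all add: L_def vec_eq_iff algebra_simps scaleR_right_distrib)
  then have lin: "bounded_linear (L z)" for z by (simp add: linear_conv_bounded_linear)
  have ap: "blinfun_apply (Blinfun (L z)) = L z" for z using lin by (rule bounded_linear_Blinfun_apply)
  have der: "(F has_derivative L z) (at z)" for z
    unfolding has_derivative_at_within
  proof (intro conjI lin vec_tendstoI)
    fix i
    have "((\<lambda>z. F z $ i) has_derivative (\<lambda>v. a i z * v $ 1 + b i z * v $ 2)) (at z)"
      unfolding F a_def b_def by (rule bipoly_has_derivative)
    then show "((\<lambda>y. (((F y - F z) - L z (y - z)) /\<^sub>R norm (y - z)) $ i) \<longlongrightarrow> 0 $ i) (at z)"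
      unfolding has_derivative_at_within by (simp add: L_def)
  qed
  have "continuous_on UNIV (\<lambda>z. Blinfun (L z))"
    unfolding continuous_on_def
  proof (intro ballI tendsto_componentwise1)
    fix z e :: C2
    have "continuous_on UNIV (\<lambda>z. L z e)"
      by (rule continuous_C2) (auto simp: L_def a_def b_def intro!: continuous_intros)
    then show "((\<lambda>z. blinfun_apply (Blinfun (L z)) e) \<longlongrightarrow> blinfun_apply (Blinfun (L z)) e) (at z within UNIV)"
      by (simp add: ap continuous_on_def)
  qed
  then show ?thesis
    unfolding C1_deriv_def using der by (intro exI[of _ "\<lambda>z. Blinfun (L z)"]) (simp add: ap)
qed

lemma C1_onorm:
  assumes "C1_deriv F D"
  shows "onorm (frechet_derivative F (at x)) = norm (D x)"
proof -
  have "(F has_derivative blinfun_apply (D x)) (at x)" using assms by (simp add: C1_deriv_def)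
  then have "frechet_derivative F (at x) = blinfun_apply (D x)" by (rule frechet_derivative_at[symmetric])
  then show ?thesis by (simp add: norm_blinfun.rep_eq)
qed

lemma C1_unique:
  assumes "C1_deriv F D" "(F has_derivative blinfun_apply L) (at x)"
  shows "D x = L"
  using assms by (meson C1_deriv_def blinfun_apply_inject has_derivative_unique)

lemma C1_continuous: "C1_deriv F D \<Longrightarrow> continuous_on UNIV F"
  unfolding C1_deriv_def using has_derivative_continuous
  by (metis continuous_at_imp_continuous_on)

lemma C1_compose_deriv:
  assumes "C1_deriv F D" "C1_deriv G E"
  shows "((F \<circ> G) has_derivative blinfun_apply (D (G x) o\<^sub>L E x)) (at x)"
proof -
  have "((F \<circ> G) has_derivative (blinfun_apply (D (G x)) \<circ> blinfun_apply (E x))) (at x)"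
    using assms by (intro diff_chain_at) (auto simp: C1_deriv_def)
  then show ?thesis by (rule has_derivative_eq_rhs) (auto simp: fun_eq_iff)
qed

lemma C1_compose:
  assumes "C1_deriv F D" "C1_deriv G E"
  shows "C1_deriv (F \<circ> G) (\<lambda>x. D (G x) o\<^sub>L E x)"
  unfolding C1_deriv_def
proof (intro conjI allI C1_compose_deriv assms)
  have "continuous_on UNIV (\<lambda>x. D (G x))"
    by (rule continuous_on_compose2[of UNIV D]) (use assms C1_continuous in \<open>auto simp: C1_deriv_def\<close>)
  then show "continuous_on UNIV (\<lambda>x. D (G x) o\<^sub>L E x)"
    using assms(2) by (intro continuous_intros) (auto simp: C1_deriv_def)
qed

lemma C1_iterates:
  assumes "C1_deriv F D"
  obtains Dn where "\<And>n. C1_deriv (F ^^ n) (Dn n)"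
proof -
  have "\<exists>E. C1_deriv (F ^^ n) E" for n
  proof (induction n)
    case 0
    have "C1_deriv (F ^^ 0) (\<lambda>_. id_blinfun)" by (auto simp: C1_deriv_def intro!: derivative_eq_intros simp: id_def)
    then show ?case by blast
  next
    case (Suc n)
    then obtain E where E: "C1_deriv (F ^^ n) E" by blast
    show ?case using C1_compose[OF assms E] by (auto simp: o_def)
  qed
  then show ?thesis using that by metis
qed

lemma C1_iterates_chain:
  assumes "\<And>n. C1_deriv (F ^^ n) (Dn n)"
  shows "Dn (m + n) x = Dn m ((F ^^ n) x) o\<^sub>L Dn n x"
  by (rule C1_unique[OF assms]) (use C1_compose_deriv[OF assms[of m] assms[of n]] in \<open>simp add: funpow_add\<close>)

text \<open>On a compact forward invariant set the derivatives of the iterates grow at most exponentially.\<close>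

lemma C1_iterates_bound:
  assumes Dn: "\<And>n. C1_deriv (F ^^ n) (Dn n)" and J: "compact J" "F ` J \<subseteq> J"
  shows "\<exists>K\<ge>1. \<forall>n. \<forall>x\<in>J. norm (Dn n x) \<le> K ^ n"
proof -
  have "continuous_on J (\<lambda>x. norm (Dn 1 x))"
    using Dn[of 1] by (intro continuous_intros) (auto simp: C1_deriv_def intro: continuous_on_subset)
  then have "bounded ((\<lambda>x. norm (Dn 1 x)) ` J)"
    using J(1) by (intro compact_imp_bounded compact_continuous_image)
  then obtain K0 where K0: "\<And>x. x \<in> J \<Longrightarrow> norm (Dn 1 x) \<le> K0" by (auto simp: bounded_iff)
  define K where "K = max 1 K0"
  have inv: "x \<in> J \<Longrightarrow> (F ^^ n) x \<in> J" for n x using J(2) by (induction n) auto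
  have "norm (Dn n x) \<le> K ^ n" if "x \<in> J" for n x
  proof (induction n)
    case 0
    have "Dn 0 x = id_blinfun"
      by (rule C1_unique[OF Dn[of 0]]) (auto intro!: derivative_eq_intros simp: id_def)
    then show ?case by (simp add: norm_blinfun_id_le)
  next
    case (Suc n)
    have "norm (Dn (Suc n) x) \<le> norm (Dn 1 ((F ^^ n) x)) * norm (Dn n x)"
      using C1_iterates_chain[OF Dn, of 1 n x] norm_blinfun_compose[of "Dn 1 ((F ^^ n) x)" "Dn n x"] by simp
    also have "\<dots> \<le> K * K ^ n"
      using K0[OF inv[OF that, of n]] Suc by (intro mult_mono) (auto simp: K_def)
    finally show ?case by simp
  qed
  then show ?thesis by (intro exI[of _ K]) (auto simp: K_def)
qed

lemma iterate_inv_cancel: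
  assumes "bij F"
  shows "(inv F ^^ n) ((F ^^ n) x) = x" "(F ^^ n) ((inv F ^^ n) x) = x"
proof -
  have "inv F (F y) = y" "F (inv F y) = y" for y
    using assms by (simp_all add: bij_is_inj bij_is_surj surj_f_inv_f)
  then show "(inv F ^^ n) ((F ^^ n) x) = x" "(F ^^ n) ((inv F ^^ n) x) = x"
    by (induction n arbitrary: x) (simp_all add: funpow_swap1)
qed

section \<open>Subadditivity and a lower bound for asymptotic averages\<close>

text \<open>Fekete's lemma for subadditive sequences with a linear lower bound.\<close>

lemma fekete_convergent:
  fixes a :: "nat \<Rightarrow> real"
  assumes sub: "\<And>m n. a (m + n) \<le> a m + a n" and low: "\<And>n. - C * real n \<le> a n"
  shows "convergent (\<lambda>n. a n / real n)"
proof -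
  let ?S = "(\<lambda>n. a n / real n) ` {1..}"
  define L where "L = Inf ?S"
  have bdd: "bdd_below ?S"
    using low by (intro bdd_belowI[of _ "- C"]) (auto simp: field_simps)
  have L_le: "L \<le> a n / real n" if "n \<ge> 1" for n
    unfolding L_def using bdd that by (intro cInf_lower) auto
  have mult: "a (q * m + r) \<le> real q * a m + a r" for q m r
  proof (induction q)
    case (Suc q)
    have "a (Suc q * m + r) \<le> a m + a (q * m + r)" using sub[of m "q * m + r"] by (simp add: add.assoc)
    then show ?case using Suc by (simp add: algebra_simps)
  qed simp
  have "(\<lambda>n. a n / real n) \<longlonglongrightarrow> L"
  proof (rule order_tendstoI)
    fix y assume "y < L"
    then show "eventually (\<lambda>n. y < a n / real n) sequentially"
      using L_le by (intro eventually_sequentiallyI[of 1]) (auto intro: less_le_trans)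
  next
    fix y assume "L < y"
    then obtain m where m: "m \<ge> 1" "a m / real m < y"
      using cInf_less_iff[OF _ bdd, of y] unfolding L_def by auto
    define s where "s = a m / real m"
    have am: "a m = s * real m" using m(1) by (simp add: s_def)
    define M where "M = Max (a ` {..<m})"
    have M: "a r \<le> M" if "r < m" for r unfolding M_def using that by (intro Max_ge) auto
    have ub: "a n \<le> s * real n + (\<bar>s\<bar> * real m + M)" for n
    proof -
      have r: "n mod m < m" using m(1) by simp
      have 1: "a n \<le> real (n div m) * a m + a (n mod m)" using mult[of "n div m" m "n mod m"] by simp
      have 2: "real (n div m) * (s * real m) = s * real n - s * real (n mod m)"
      proof -
        have "real n = real (n div m) * real m + real (n mod m)"
          by (metis div_mult_mod_eq of_nat_add of_nat_mult)
        then show ?thesis by (simp add: algebra_simps)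
      qed
      have 3: "- (s * real (n mod m)) \<le> \<bar>s\<bar> * real m"
      proof -
        have "- (s * real (n mod m)) \<le> \<bar>s\<bar> * real (n mod m)"
          by (metis abs_ge_minus_self abs_mult abs_of_nat)
        also have "\<dots> \<le> \<bar>s\<bar> * real m" using r by (intro mult_left_mono) auto
        finally show ?thesis .
      qed
      show ?thesis using 1 2 3 M[OF r] unfolding am by linarith
    qed
    have "(\<lambda>n. s + (\<bar>s\<bar> * real m + M) / real n) \<longlonglongrightarrow> s + 0"
      by (intro tendsto_add tendsto_const lim_const_over_n)
    then have "eventually (\<lambda>n. s + (\<bar>s\<bar> * real m + M) / real n < y) sequentially"
      using m(2) by (intro order_tendstoD(2)) (auto simp: s_def)
    then show "eventually (\<lambda>n. a n / real n < y) sequentially"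
      using eventually_ge_at_top[of 1]
    proof eventually_elim
      case (elim n)
      have "a n / real n \<le> (s * real n + (\<bar>s\<bar> * real m + M)) / real n"
        using ub[of n] by (intro divide_right_mono) auto
      also have "\<dots> = s + (\<bar>s\<bar> * real m + M) / real n" using elim by (simp add: add_divide_distrib)
      finally show ?case using elim by linarith
    qed
  qed
  then show ?thesis by (rule convergentI)
qed

text \<open>Averages of a subadditive cocycle \<open>g\<close>. It is enough to have the lower bound \<open>n * \<Theta> - c\<close> at
those points which \<open>f ^^ n\<close> sends to \<open>E j\<close>, where \<open>c\<close> may depend on \<open>j\<close> and the measure of
\<open>E j\<close> tends to \<open>1\<close>.\<close>

lemma lyapunov_lower_bound:
  fixes \<nu> :: "'a::topological_space measure" and g :: "nat \<Rightarrow> 'a \<Rightarrow> real"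
  assumes prob: "prob_space \<nu>" and sets: "sets \<nu> = sets borel"
    and fc: "continuous_on UNIV f" and inv: "distr \<nu> \<nu> f = \<nu>"
    and J: "AE x in \<nu>. x \<in> J" "f ` J \<subseteq> J"
    and g: "\<And>n. continuous_on UNIV (g n)" and C: "C \<ge> 0" "\<And>n x. x \<in> J \<Longrightarrow> \<bar>g n x\<bar> \<le> C * real n"
    and sub: "\<And>m n x. x \<in> J \<Longrightarrow> g (m + n) x \<le> g m ((f ^^ n) x) + g n x"
    and E: "\<And>j. E j \<in> sets \<nu>" "(\<lambda>j. measure \<nu> (E j)) \<longlonglongrightarrow> 1"
    and low: "\<And>j. \<exists>c\<ge>0. \<forall>n. \<forall>x\<in>J. (f ^^ n) x \<in> E j \<longrightarrow> real n * \<Theta> - c \<le> g n x"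
  shows "lim (\<lambda>n. (\<integral>x. g n x \<partial>\<nu>) / real n) \<ge> \<Theta>"
proof -
  interpret prob_space \<nu> by (rule prob)
  have meas: "h \<in> measurable \<nu> borel" if "continuous_on UNIV h" for h :: "'a \<Rightarrow> real"
    using that measurable_cong_sets[OF sets refl] by (metis borel_measurable_continuous_onI)
  have fm: "f \<in> measurable \<nu> \<nu>"
    using fc sets measurable_cong_sets[OF sets sets] by (metis borel_measurable_continuous_onI)
  have fnm: "f ^^ n \<in> measurable \<nu> \<nu>" for n
    by (induction n) (use fm in \<open>auto simp: id_def\<close>)
  have fnd: "distr \<nu> \<nu> (f ^^ n) = \<nu>" for n
  proof (induction n)
    case 0 then show ?case by (simp add: id_def)
  next
    case (Suc n)
    have "distr \<nu> \<nu> (f \<circ> f ^^ n) = distr (distr \<nu> \<nu> (f ^^ n)) \<nu> f"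
      by (rule distr_distr[OF fm fnm, symmetric])
    then show ?case using Suc inv by (simp add: o_def)
  qed
  have Jn: "x \<in> J \<Longrightarrow> (f ^^ n) x \<in> J" for n x using J(2) by (induction n) auto
  have int: "integrable \<nu> (g n)" for n
    by (rule integrable_const_bound[of _ "C * real n"]) (use J(1) C meas[OF g] in auto)
  have intn: "integrable \<nu> (\<lambda>x. g m ((f ^^ n) x))" for m n
    using integrable_distr[OF fnm[of n], of "g m"] int[of m] by (simp add: fnd)
  have eqn: "(\<integral>x. g m ((f ^^ n) x) \<partial>\<nu>) = (\<integral>x. g m x \<partial>\<nu>)" for m n
    using integral_distr[OF fnm[of n] meas[OF g[of m]]] by (simp add: fnd)
  define a where "a n = (\<integral>x. g n x \<partial>\<nu>)" for n
  have "a (m + n) \<le> a m + a n" for m n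
  proof -
    have "a (m + n) \<le> (\<integral>x. g m ((f ^^ n) x) + g n x \<partial>\<nu>)"
      unfolding a_def using J(1) sub by (intro integral_mono_AE int Bochner_Integration.integrable_add intn) auto
    also have "\<dots> = a m + a n" by (simp add: intn int eqn a_def)
    finally show ?thesis .
  qed
  moreover have "- C * real n \<le> a n" for n
  proof -
    have "(\<integral>x. - C * real n \<partial>\<nu>) \<le> a n"
      unfolding a_def
    proof (intro integral_mono_AE int)
      show "AE x in \<nu>. - C * real n \<le> g n x"
        using J(1)
      proof eventually_elim
        case (elim x)
        show ?case using C(2)[OF elim, of n] by (simp add: abs_le_iff)
      qed
    qed simp
    then show ?thesis by (simp add: prob_space)
  qed
  ultimately have "convergent (\<lambda>n. a n / real n)" by (rule fekete_convergent)
  then have lim: "(\<lambda>n. a n / real n) \<longlonglongrightarrow> lim (\<lambda>n. a n / real n)" by (simp add: convergent_LIMSEQ_iff)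
  have ej: "(\<Theta> + C) * prob (E j) - C \<le> lim (\<lambda>n. a n / real n)" for j
  proof -
    obtain c where c: "c \<ge> 0" "\<And>n x. x \<in> J \<Longrightarrow> (f ^^ n) x \<in> E j \<Longrightarrow> real n * \<Theta> - c \<le> g n x"
      using low[of j] by blast
    have lb: "((\<Theta> + C) * real n - c) * prob (E j) - C * real n \<le> a n" for n
    proof -
      \<comment> \<open>By invariance the preimage of \<open>E j\<close> has the same measure for every \<open>n\<close>.\<close>
      define En where "En = (f ^^ n) -` E j \<inter> space \<nu>"
      have En: "En \<in> sets \<nu>" unfolding En_def using fnm E(1) by (rule measurable_sets)
      have "prob En = measure (distr \<nu> \<nu> (f ^^ n)) (E j)"
        unfolding En_def by (rule measure_distr[OF fnm E(1), symmetric])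
      then have pE: "prob En = prob (E j)" by (simp add: fnd)
      have "(\<integral>x. ((\<Theta> + C) * real n - c) * indicator En x - C * real n \<partial>\<nu>) \<le> a n"
        unfolding a_def
      proof (intro integral_mono_AE int)
        show "integrable \<nu> (\<lambda>x. ((\<Theta> + C) * real n - c) * indicator En x - C * real n)"
          using En by (intro Bochner_Integration.integrable_diff integrable_mult_right) (auto simp: emeasure_eq_measure)
        show "AE x in \<nu>. ((\<Theta> + C) * real n - c) * indicator En x - C * real n \<le> g n x"
          using J(1)
        proof eventually_elim
          case (elim x)
          show ?case
            using c(2)[OF elim, of n] C(2)[OF elim, of n]
            by (auto simp: indicator_def En_def algebra_simps abs_le_iff)
        qed
      qed
      moreover have "(\<integral>x. ((\<Theta> + C) * real n - c) * indicator En x - C * real n \<partial>\<nu>)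
          = ((\<Theta> + C) * real n - c) * prob (E j) - C * real n"
        using En by (subst Bochner_Integration.integral_diff) (auto simp: emeasure_eq_measure prob_space pE)
      ultimately show ?thesis by simp
    qed
    have "(\<lambda>n. (\<Theta> + C - c / real n) * prob (E j) - C) \<longlonglongrightarrow> (\<Theta> + C - 0) * prob (E j) - C"
      by (intro tendsto_intros lim_const_over_n)
    moreover have "eventually (\<lambda>n. (\<Theta> + C - c / real n) * prob (E j) - C \<le> a n / real n) sequentially"
      using eventually_ge_at_top[of 1]
    proof eventually_elim
      case (elim n)
      have "(\<Theta> + C - c / real n) * prob (E j) - C = (((\<Theta> + C) * real n - c) * prob (E j) - C * real n) / real n"
        using elim by (simp add: field_simps)
      also have "\<dots> \<le> a n / real n" using lb[of n] by (intro divide_right_mono) auto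
      finally show ?case .
    qed
    ultimately show ?thesis using tendsto_le[OF _ lim] by (metis diff_zero trivial_limit_sequentially)
  qed
  have "(\<lambda>j. (\<Theta> + C) * prob (E j) - C) \<longlonglongrightarrow> (\<Theta> + C) * 1 - C"
    by (intro tendsto_intros E(2))
  then have "(\<Theta> + C) * 1 - C \<le> lim (\<lambda>n. a n / real n)"
    by (rule LIMSEQ_le_const2) (use ej in blast)
  then show ?thesis by (simp add: a_def)
qed

section \<open>Entire curves\<close>

lemma entire_curve_continuous: "entire_curve \<phi> \<Longrightarrow> continuous_on A \<phi>"
  unfolding entire_curve_def
  by (rule continuous_C2, rule holomorphic_on_imp_continuous_on, rule holomorphic_on_subset[where s = UNIV]) auto

lemma locally_uniform_limit_pointwise:
  assumes g: "locally_uniform_limit g \<phi>" and \<phi>: "entire_curve \<phi>" and z: "z \<longlonglongrightarrow> \<zeta>"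
  shows "(\<lambda>n. g n (z n)) \<longlonglongrightarrow> \<phi> \<zeta>"
proof -
  have u: "uniform_limit (cball \<zeta> 1) g \<phi> sequentially"
    using g by (simp add: locally_uniform_limit_def)
  have inb: "eventually (\<lambda>n. z n \<in> cball \<zeta> 1) sequentially"
    using tendstoD[OF z, of 1] by (auto elim!: eventually_mono simp: dist_commute)
  have "(\<lambda>n. dist (g n (z n)) (\<phi> (z n))) \<longlonglongrightarrow> 0"
  proof (rule tendstoI)
    fix e :: real assume e: "e > 0"
    show "eventually (\<lambda>n. dist (dist (g n (z n)) (\<phi> (z n))) 0 < e) sequentially"
      using uniform_limitD[OF u e] inb by eventually_elim auto
  qed
  then have diff: "(\<lambda>n. g n (z n) - \<phi> (z n)) \<longlonglongrightarrow> 0"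
    unfolding dist_norm by (rule tendsto_norm_zero_cancel)
  have "(\<lambda>n. \<phi> (z n)) \<longlonglongrightarrow> \<phi> \<zeta>"
    by (rule continuous_on_tendsto_compose[OF entire_curve_continuous[OF \<phi>, of UNIV] z]) auto
  then show ?thesis using diff by (rule Lim_transform)
qed

lemma locally_uniform_limit_subseq:
  assumes "locally_uniform_limit g \<phi>" "strict_mono (r :: nat \<Rightarrow> nat)"
  shows "locally_uniform_limit (\<lambda>n. g (r n)) \<phi>"
  unfolding locally_uniform_limit_def
proof (intro allI impI)
  fix K :: "complex set" assume "compact K"
  then have "uniform_limit K g \<phi> sequentially" using assms(1) by (simp add: locally_uniform_limit_def)
  then show "uniform_limit K (\<lambda>n. g (r n)) \<phi> sequentially"
    by (rule filterlim_compose[OF _ filterlim_subseq[OF assms(2)]])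
qed

lemma curve_deriv_tendsto:
  assumes g: "locally_uniform_limit g \<phi>" and e: "\<And>n. entire_curve (g n)"
  shows "(\<lambda>n. curve_deriv k (g n) 0) \<longlonglongrightarrow> curve_deriv k \<phi> 0"
proof (rule vec_tendstoI)
  fix i
  have "uniform_limit (cball 0 1) g \<phi> sequentially"
    using g by (simp add: locally_uniform_limit_def)
  then have "uniform_limit (cball 0 1) (\<lambda>n z. g n z $ i) (\<lambda>z. \<phi> z $ i) sequentially"
    by (rule bounded_linear.uniform_limit[OF bounded_linear_vec_nth])
  then have "uniform_limit (ball 0 1) (\<lambda>n z. g n z $ i) (\<lambda>z. \<phi> z $ i) sequentially"
    by (rule uniform_limit_on_subset) auto
  then have "(\<lambda>n. (deriv ^^ k) (\<lambda>z. g n z $ i) 0) \<longlonglongrightarrow> (deriv ^^ k) (\<lambda>z. \<phi> z $ i) 0"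
  proof (rule higher_deriv_complex_uniform_limit)
    have "(\<lambda>z. g n z $ i) holomorphic_on ball 0 1" for n
      using e[of n] unfolding entire_curve_def by (meson holomorphic_on_subset top_greatest)
    then show "eventually (\<lambda>n. (\<lambda>z. g n z $ i) holomorphic_on ball 0 1) sequentially" by simp
  qed auto
  then show "(\<lambda>n. curve_deriv k (g n) 0 $ i) \<longlonglongrightarrow> curve_deriv k \<phi> 0 $ i"
    by (simp add: curve_deriv_def)
qed

lemma entire_curve_const:
  assumes "entire_curve \<phi>" "\<And>k. k \<ge> 1 \<Longrightarrow> curve_deriv k \<phi> 0 = 0"
  shows "\<phi> \<zeta> = \<phi> 0"
proof -
  have "\<phi> \<zeta> $ i = \<phi> 0 $ i" for i
  proof (rule holomorphic_fun_eq_const_on_connected[of "\<lambda>z. \<phi> z $ i" UNIV])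
    show "(\<lambda>z. \<phi> z $ i) holomorphic_on UNIV" using assms(1) by (simp add: entire_curve_def)
    show "(deriv ^^ n) (\<lambda>z. \<phi> z $ i) 0 = 0" if "0 < n" for n
      using assms(2)[of n] that by (simp add: curve_deriv_def vec_eq_iff)
  qed auto
  then show ?thesis by (simp add: vec_eq_iff)
qed

lemma curve_deriv_scale:
  assumes "entire_curve \<phi>"
  shows "curve_deriv k (\<lambda>z. \<phi> (\<sigma> * z)) 0 = \<sigma> ^ k *s curve_deriv k \<phi> 0"
proof -
  have "(deriv ^^ k) (\<lambda>z. \<phi> (\<sigma> * z) $ i) 0 = \<sigma> ^ k * (deriv ^^ k) (\<lambda>z. \<phi> z $ i) (\<sigma> * 0)" for i
    by (rule higher_deriv_compose_linear[of "\<lambda>z. \<phi> z $ i" UNIV UNIV])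
      (use assms in \<open>auto simp: entire_curve_def\<close>)
  then show ?thesis by (simp add: curve_deriv_def vec_eq_iff)
qed

lemma entire_curve_scale:
  assumes "entire_curve \<phi>"
  shows "entire_curve (\<lambda>z. \<phi> (\<sigma> * z))"
  unfolding entire_curve_def
proof
  fix i
  have "((\<lambda>z. \<phi> z $ i) \<circ> (\<lambda>z. \<sigma> * z)) holomorphic_on UNIV"
  proof (rule holomorphic_on_compose)
    show "(\<lambda>z. \<phi> z $ i) holomorphic_on (\<lambda>z. \<sigma> * z) ` UNIV"
      using assms unfolding entire_curve_def by (meson holomorphic_on_subset top_greatest)
  qed (intro holomorphic_intros)
  then show "(\<lambda>z. \<phi> (\<sigma> * z) $ i) holomorphic_on UNIV" by (simp add: o_def)
qed

text \<open>Only the derivatives of orders \<open>1, ..., k - 1\<close> are assumed to vanish; the one of order \<open>k\<close> may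
vanish too.\<close>

lemma holomorphic_leading_term:
  fixes g :: "complex \<Rightarrow> complex"
  assumes g: "g holomorphic_on UNIV" and k: "k \<ge> 1" and z: "\<And>i. 1 \<le> i \<Longrightarrow> i < k \<Longrightarrow> (deriv ^^ i) g 0 = 0"
  shows "((\<lambda>z. (g z - g 0) / z ^ k) \<longlongrightarrow> (deriv ^^ k) g 0 / fact k) (at 0)"
proof -
  have hol: "(deriv ^^ i) g holomorphic_on UNIV" for i using g by (intro holomorphic_higher_deriv) auto
  have "bounded ((deriv ^^ Suc k) g ` cball 0 1)"
    by (intro compact_imp_bounded compact_continuous_image holomorphic_on_imp_continuous_on
        holomorphic_on_subset[OF hol]) auto
  then obtain B where B: "\<forall>w\<in>cball 0 1. norm ((deriv ^^ Suc k) g w) \<le> B"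
    unfolding bounded_iff by blast
  have taylor: "norm (g w - (g 0 + (deriv ^^ k) g 0 * w ^ k / fact k)) \<le> B * norm w ^ Suc k / fact k" if "w \<in> cball 0 1" for w
  proof -
    have "norm ((deriv ^^ 0) g w - (\<Sum>i\<le>k. (deriv ^^ i) g 0 * (w - 0) ^ i / fact i)) \<le> B * norm (w - 0) ^ Suc k / fact k"
    proof (rule complex_Taylor[where S = "cball 0 1" and f = "\<lambda>i. (deriv ^^ i) g"])
      fix i x
      have "((deriv ^^ i) g has_field_derivative deriv ((deriv ^^ i) g) x) (at x)"
        using holomorphic_derivI[OF hol] by auto
      then show "((deriv ^^ i) g has_field_derivative (deriv ^^ Suc i) g x) (at x within cball 0 1)"
        by (simp add: has_field_derivative_at_within)
    qed (use B that in auto)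
    moreover have "(\<Sum>i\<le>k. (deriv ^^ i) g 0 * (w - 0) ^ i / fact i) = (\<Sum>i\<in>{0, k}. (deriv ^^ i) g 0 * w ^ i / fact i)"
      using z by (intro sum.mono_neutral_cong_right) (auto simp: Suc_le_eq)
    ultimately show ?thesis using k by simp
  qed
  show ?thesis
  proof (rule Lim_transform2)
    show "((\<lambda>z. (deriv ^^ k) g 0 / fact k) \<longlongrightarrow> (deriv ^^ k) g 0 / fact k) (at 0)" by simp
    show "((\<lambda>w. (deriv ^^ k) g 0 / fact k - (g w - g 0) / w ^ k) \<longlongrightarrow> 0) (at 0)"
    proof (rule Lim_null_comparison)
      have "((\<lambda>w :: complex. B * norm w / fact k) \<longlongrightarrow> B * norm (0 :: complex) / fact k) (at 0)"
        by (intro tendsto_intros) auto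
      then show "((\<lambda>w :: complex. B * norm w / fact k) \<longlongrightarrow> 0) (at 0)" by simp
      show "eventually (\<lambda>w. norm ((deriv ^^ k) g 0 / fact k - (g w - g 0) / w ^ k) \<le> B * norm w / fact k) (at 0)"
        using eventually_at_ball'[of 1 0 UNIV, simplified]
      proof eventually_elim
        case (elim w)
        have w: "w \<noteq> 0" "w \<in> cball 0 1" using elim by auto
        have "(deriv ^^ k) g 0 / fact k - (g w - g 0) / w ^ k = - (g w - (g 0 + (deriv ^^ k) g 0 * w ^ k / fact k)) / w ^ k"
          using w(1) by (simp add: field_simps)
        then have "norm ((deriv ^^ k) g 0 / fact k - (g w - g 0) / w ^ k)
            = norm (g w - (g 0 + (deriv ^^ k) g 0 * w ^ k / fact k)) / norm w ^ k"
          by (simp only: norm_divide norm_minus_cancel norm_power)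
        also have "\<dots> \<le> (B * norm w ^ Suc k / fact k) / norm w ^ k"
          using taylor[OF w(2)] by (intro divide_right_mono) auto
        also have "\<dots> = B * norm w / fact k" using w(1) by simp
        finally show ?case .
      qed
    qed
  qed
qed

lemma curve_leading_term:
  assumes \<phi>: "entire_curve \<phi>" and k: "k \<ge> 1" and z: "\<And>i. 1 \<le> i \<Longrightarrow> i < k \<Longrightarrow> curve_deriv i \<phi> 0 = 0"
  shows "((\<lambda>t. (\<phi> (of_real t) - \<phi> 0) /\<^sub>R t ^ k) \<longlongrightarrow> curve_deriv k \<phi> 0 /\<^sub>R fact k) (at_right 0)"
proof (rule vec_tendstoI)
  fix i
  have zi: "(deriv ^^ j) (\<lambda>z. \<phi> z $ i) 0 = 0" if "1 \<le> j" "j < k" for j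
    using z[OF that] by (simp add: curve_deriv_def vec_eq_iff)
  have 1: "((\<lambda>z. (\<phi> z $ i - \<phi> 0 $ i) / z ^ k) \<longlongrightarrow> (deriv ^^ k) (\<lambda>z. \<phi> z $ i) 0 / fact k) (at 0)"
    using \<phi> zi by (intro holomorphic_leading_term k) (auto simp: entire_curve_def)
  have 2: "filterlim (of_real :: real \<Rightarrow> complex) (at 0) (at_right 0)"
    unfolding filterlim_at by (auto simp: eventually_at_filter intro!: tendsto_eq_intros)
  have eq: "((\<phi> (of_real t) - \<phi> 0) /\<^sub>R t ^ k) $ i = (\<phi> (of_real t) $ i - \<phi> 0 $ i) / of_real t ^ k" for t
    by (simp add: divide_inverse scaleR_conv_of_real[where 'a = complex] mult.commute)
  have eq2: "(curve_deriv k \<phi> 0 /\<^sub>R fact k) $ i = (deriv ^^ k) (\<lambda>z. \<phi> z $ i) 0 / fact k"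
    by (simp add: curve_deriv_def divide_inverse scaleR_conv_of_real[where 'a = complex] mult.commute)
  show "((\<lambda>t. ((\<phi> (of_real t) - \<phi> 0) /\<^sub>R t ^ k) $ i) \<longlongrightarrow> (curve_deriv k \<phi> 0 /\<^sub>R fact k) $ i) (at_right 0)"
    unfolding eq eq2 using filterlim_compose[OF 1 2] .
qed

text \<open>A differentiable map transports the first-order behaviour of \<open>u\<close> at any rate \<open>s\<close>, which need
not be the parameter itself.\<close>

lemma has_derivative_along_rate:
  fixes F :: "'a::real_normed_vector \<Rightarrow> 'b::real_normed_vector"
  assumes F: "(F has_derivative L) (at a)" and u: "(u \<longlongrightarrow> a) G"
    and w: "((\<lambda>t. (u t - a) /\<^sub>R s t) \<longlongrightarrow> w) G"
  shows "((\<lambda>t. (F (u t) - F a) /\<^sub>R s t) \<longlongrightarrow> L w) G"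
proof -
  have L: "bounded_linear L" using F by (rule has_derivative_bounded_linear)
  interpret L: bounded_linear L by (rule L)
  \<comment> \<open>At \<open>y = a\<close> the quotient is \<open>0\<close>, so \<open>e\<close> is continuous at \<open>a\<close> and no case distinction on \<open>u t = a\<close> is needed.\<close>
  define e where "e y = norm (F y - F a - L (y - a)) / norm (y - a)" for y
  have "(e \<longlongrightarrow> e a) (at a)"
    using F unfolding has_derivative_iff_norm e_def by simp
  then have "(e \<longlongrightarrow> e a) (nhds a)" by (rule tendsto_at_iff_tendsto_nhds[THEN iffD1])
  then have eu: "((\<lambda>t. e (u t)) \<longlongrightarrow> 0) G"
    using filterlim_compose[OF _ u] by (fastforce simp: e_def)
  have "((\<lambda>t. (F (u t) - F a) /\<^sub>R s t - L ((u t - a) /\<^sub>R s t)) \<longlongrightarrow> 0) G"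
  proof (rule Lim_null_comparison)
    show "((\<lambda>t. e (u t) * norm ((u t - a) /\<^sub>R s t)) \<longlongrightarrow> 0) G"
      using tendsto_mult[OF eu tendsto_norm[OF w]] by simp
    have "norm ((F (u t) - F a) /\<^sub>R s t - L ((u t - a) /\<^sub>R s t)) = e (u t) * norm ((u t - a) /\<^sub>R s t)" for t
    proof -
      have "(F (u t) - F a) /\<^sub>R s t - L ((u t - a) /\<^sub>R s t) = (F (u t) - F a - L (u t - a)) /\<^sub>R s t"
        unfolding L.scaleR by (simp only: scaleR_diff_right)
      then show ?thesis by (cases "u t = a") (auto simp: e_def)
    qed
    then show "eventually (\<lambda>t. norm ((F (u t) - F a) /\<^sub>R s t - L ((u t - a) /\<^sub>R s t)) \<le> e (u t) * norm ((u t - a) /\<^sub>R s t)) G"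
      by simp
  qed
  moreover have "((\<lambda>t. L ((u t - a) /\<^sub>R s t)) \<longlongrightarrow> L w) G" by (rule L.tendsto[OF w])
  ultimately show ?thesis using tendsto_add by fastforce
qed

text \<open>If \<open>\<omega>\<close> has order \<open>k\<close>, then so does \<open>\<phi>\<close>, since the derivative \<open>L\<close> is injective and orders
can be read off from the rate of convergence along the positive real axis.\<close>

lemma semiconjugate_leading_coefficient:
  assumes \<omega>: "entire_curve \<omega>" and \<phi>: "entire_curve \<phi>"
    and eq: "\<And>\<zeta>. \<omega> \<zeta> = F (\<phi> (\<sigma> * \<zeta>))"
    and F: "(F has_derivative L) (at (\<phi> 0))" and inj: "\<And>v. L v = 0 \<Longrightarrow> v = 0"
    and k: "k \<ge> 1" and z: "\<And>i. 1 \<le> i \<Longrightarrow> i < k \<Longrightarrow> curve_deriv i \<omega> 0 = 0"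
    and nz: "curve_deriv k \<omega> 0 \<noteq> 0"
  shows "curve_deriv k \<omega> 0 = L (\<sigma> ^ k *s curve_deriv k \<phi> 0)"
proof -
  define u where "u = (\<lambda>\<zeta>. \<phi> (\<sigma> * \<zeta>))"
  have u: "entire_curve u" unfolding u_def using \<phi> by (rule entire_curve_scale)
  have u0: "u 0 = \<phi> 0" by (simp add: u_def)
  have ud: "curve_deriv j u 0 = \<sigma> ^ j *s curve_deriv j \<phi> 0" for j
    unfolding u_def using \<phi> by (rule curve_deriv_scale)
  have L: "bounded_linear L" using F by (rule has_derivative_bounded_linear)
  interpret L: bounded_linear L by (rule L)
  have \<omega>lim: "((\<lambda>t. (\<omega> (of_real t) - \<omega> 0) /\<^sub>R t ^ k) \<longlongrightarrow> curve_deriv k \<omega> 0 /\<^sub>R fact k) (at_right 0)"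
    by (rule curve_leading_term[OF \<omega> k z])
  have "\<exists>m. m \<ge> 1 \<and> curve_deriv m u 0 \<noteq> 0"
  proof (rule ccontr)
    assume "\<not> ?thesis"
    then have "u \<zeta> = u 0" for \<zeta> using entire_curve_const[OF u] by blast
    then have "\<omega> \<zeta> = \<omega> 0" for \<zeta> using eq by (metis u_def)
    then have "(\<omega> (of_real t) - \<omega> 0) /\<^sub>R t ^ k = 0" for t :: real by (metis diff_self scaleR_zero_right)
    then have "((\<lambda>t :: real. 0) \<longlongrightarrow> curve_deriv k \<omega> 0 /\<^sub>R fact k) (at_right 0)" using \<omega>lim by (simp only:)
    then have "curve_deriv k \<omega> 0 /\<^sub>R fact k = 0"
      by (metis tendsto_const tendsto_unique trivial_limit_at_right_real)
    then show False using nz by simp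
  qed
  define m where "m = (LEAST m. m \<ge> 1 \<and> curve_deriv m u 0 \<noteq> 0)"
  have m: "m \<ge> 1" "curve_deriv m u 0 \<noteq> 0"
    using LeastI_ex[OF \<open>\<exists>m. _\<close>] by (auto simp: m_def)
  have mz: "curve_deriv i u 0 = 0" if "1 \<le> i" "i < m" for i
    using that not_less_Least unfolding m_def by blast
  let ?w = "curve_deriv m u 0 /\<^sub>R fact m"
  have ulim: "((\<lambda>t. (u (of_real t) - u 0) /\<^sub>R t ^ m) \<longlongrightarrow> ?w) (at_right 0)"
    by (rule curve_leading_term[OF u m(1) mz])
  have "((\<lambda>t :: real. u (of_real t)) \<longlongrightarrow> u (of_real 0)) (at_right 0)"
    using entire_curve_continuous[OF u, of UNIV]
    by (intro continuous_on_tendsto_compose[of UNIV u] tendsto_of_real) auto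
  then have "((\<lambda>t. (F (u (of_real t)) - F (u 0)) /\<^sub>R t ^ m) \<longlongrightarrow> L ?w) (at_right 0)"
    using F by (intro has_derivative_along_rate[OF _ _ ulim]) (auto simp: u0)
  then have Flim: "((\<lambda>t. (\<omega> (of_real t) - \<omega> 0) /\<^sub>R t ^ m) \<longlongrightarrow> L ?w) (at_right 0)"
    by (simp add: eq u_def)
  have Lw: "L ?w \<noteq> 0" using inj m(2) by (metis fact_nonzero inverse_zero_imp_zero scaleR_eq_0_iff)
  have pw0: "((\<lambda>t :: real. t ^ Suc j) \<longlongrightarrow> 0) (at_right 0)" for j
    by (auto intro!: tendsto_eq_intros)
  have higher_zero: "b = 0"
    if lim: "((\<lambda>t. (\<omega> (of_real t) - \<omega> 0) /\<^sub>R t ^ p) \<longlongrightarrow> c) (at_right 0)"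
      and lim': "((\<lambda>t. (\<omega> (of_real t) - \<omega> 0) /\<^sub>R t ^ q) \<longlongrightarrow> b) (at_right 0)" and pq: "q < p" for p q b c
  proof -
    obtain j where j: "p = q + Suc j" using pq less_iff_Suc_add by auto
    have "((\<lambda>t. t ^ Suc j *\<^sub>R ((\<omega> (of_real t) - \<omega> 0) /\<^sub>R t ^ p)) \<longlongrightarrow> 0 *\<^sub>R c) (at_right 0)"
      by (intro tendsto_scaleR pw0 lim)
    moreover have "eventually (\<lambda>t. t ^ Suc j *\<^sub>R ((\<omega> (of_real t) - \<omega> 0) /\<^sub>R t ^ p) = (\<omega> (of_real t) - \<omega> 0) /\<^sub>R t ^ q) (at_right 0)"
      using eventually_at_right_less[of "0::real"]
    proof eventually_elim
      case (elim t)
      then have "t ^ Suc j * inverse (t ^ p) = inverse (t ^ q)"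
        by (simp add: j power_add divide_simps)
      then show ?case by (metis scaleR_scaleR)
    qed
    ultimately have "((\<lambda>t. (\<omega> (of_real t) - \<omega> 0) /\<^sub>R t ^ q) \<longlongrightarrow> 0 *\<^sub>R c) (at_right 0)"
      by (rule Lim_transform_eventually)
    then have "0 *\<^sub>R c = b" using lim' by (intro tendsto_unique[OF trivial_limit_at_right_real])
    then show ?thesis by simp
  qed
  have "\<not> m < k" using higher_zero[OF \<omega>lim Flim] Lw by blast
  moreover have "\<not> k < m" using higher_zero[OF Flim \<omega>lim] nz by auto
  ultimately have mk: "m = k" by simp
  have "L ?w = curve_deriv k \<omega> 0 /\<^sub>R fact k"
    using tendsto_unique[OF _ Flim[unfolded mk] \<omega>lim] by (simp add: mk)
  then have "L (curve_deriv k u 0) /\<^sub>R fact k = curve_deriv k \<omega> 0 /\<^sub>R fact k"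
    by (simp add: mk L.scaleR)
  then show ?thesis by (simp add: ud)
qed

section \<open>Normalized families and the growth of the derivative\<close>

lemma norm_vector_smult_C2: "norm (c *s v) = norm c * norm v" for v :: C2
  by (simp add: norm_vec_def norm_mult L2_set_right_distrib)

text \<open>For a normal family, the set of points with a limit curve whose derivatives at \<open>0\<close> of orders
\<open>1, ..., k - 1\<close> vanish and whose \<open>k\<close>-th derivative at \<open>0\<close> has norm at least \<open>\<epsilon>\<close> (see
\<open>order_setE\<close> and \<open>order_setI\<close>). Defining it by approximating members of the family makes it
closed, hence measurable, by construction.\<close>

definition order_set :: "C2 set \<Rightarrow> (C2 \<Rightarrow> complex \<Rightarrow> C2) \<Rightarrow> nat \<Rightarrow> real \<Rightarrow> C2 set" where
  "order_set S \<psi> k \<epsilon> = (\<Inter>j. closure {y \<in> S.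
     (\<forall>i\<in>{1..<k}. norm (curve_deriv i (\<psi> y) 0) < 1 / Suc j) \<and>
     norm (curve_deriv k (\<psi> y) 0) > \<epsilon> - 1 / Suc j})"

text \<open>The curve is not constant and \<open>k\<close> is its order at \<open>0\<close>.\<close>

definition has_order :: "nat \<Rightarrow> (complex \<Rightarrow> C2) \<Rightarrow> bool" where
  "has_order k \<phi> \<longleftrightarrow> k \<ge> 1 \<and> curve_deriv k \<phi> 0 \<noteq> 0 \<and> (\<forall>i\<in>{1..<k}. curve_deriv i \<phi> 0 = 0)"

lemma closed_order_set: "closed (order_set S \<psi> k \<epsilon>)"
  unfolding order_set_def by (intro closed_INT ballI closed_closure)

lemma order_set_antimono:
  assumes "\<epsilon> \<le> \<epsilon>'"
  shows "order_set S \<psi> k \<epsilon>' \<subseteq> order_set S \<psi> k \<epsilon>"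
  unfolding order_set_def
proof (rule INT_greatest)
  fix j :: nat
  show "(\<Inter>j. closure {y \<in> S. (\<forall>i\<in>{1..<k}. norm (curve_deriv i (\<psi> y) 0) < 1 / Suc j) \<and>
        norm (curve_deriv k (\<psi> y) 0) > \<epsilon>' - 1 / Suc j})
      \<subseteq> closure {y \<in> S. (\<forall>i\<in>{1..<k}. norm (curve_deriv i (\<psi> y) 0) < 1 / Suc j) \<and>
        norm (curve_deriv k (\<psi> y) 0) > \<epsilon> - 1 / Suc j}"
    by (rule INF_lower2[OF UNIV_I[of j]], rule closure_mono) (use assms in auto)
qed

lemma has_order_Ord:
  assumes "\<exists>k\<ge>1. curve_deriv k \<phi> 0 \<noteq> 0"
  shows "has_order (Ord \<phi>) \<phi>"
proof -
  have "Ord \<phi> \<ge> 1 \<and> curve_deriv (Ord \<phi>) \<phi> 0 \<noteq> 0"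
    unfolding Ord_def by (rule LeastI_ex) (use assms in auto)
  moreover have "curve_deriv i \<phi> 0 = 0" if "1 \<le> i" "i < Ord \<phi>" for i
    using that not_less_Least unfolding Ord_def by blast
  ultimately show ?thesis by (auto simp: has_order_def)
qed

text \<open>A quasi-expanding map together with its normalized family and multipliers.\<close>

locale expanding_family =
  fixes f :: "C2 \<Rightarrow> C2" and d :: nat
    and S :: "C2 set" and \<psi> :: "C2 \<Rightarrow> complex \<Rightarrow> C2" and lam :: "C2 \<Rightarrow> complex" and \<kappa> :: real
  assumes diffeo: "polynomial_diffeo f"
    and deg: "dynamical_degree f = real d" "d > 1"
    and conj: "conjugate_to_henon_composition f d"
    and fam: "normalized_invariant_family f S \<psi>"
    and lam: "\<forall>x\<in>S. \<forall>\<zeta>. f (\<psi> x \<zeta>) = \<psi> (f x) (lam x * \<zeta>)"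
    and normal: "normal_family S \<psi>"
    and \<kappa>: "\<kappa> > 1" and lam_ge: "\<forall>x\<in>S. cmod (lam x) \<ge> \<kappa>"
begin

lemma bij_f: "bij f" and poly_f: "polynomial_map f" and poly_inv: "polynomial_map (inv f)"
  using diffeo by (auto simp: polynomial_diffeo_def)

lemma S_sub: "S \<subseteq> J_star f" and fS: "f ` S = S"
  and entire: "x \<in> S \<Longrightarrow> entire_curve (\<psi> x)"
  and base: "x \<in> S \<Longrightarrow> \<psi> x 0 = x"
  and attained: "x \<in> S \<Longrightarrow> \<exists>\<zeta>\<in>cball 0 1. G_plus f (\<psi> x \<zeta>) = 1"
proof -
  have *: "S \<subseteq> J_star f" "f ` S = S" "\<forall>x\<in>S. injective_immersion (\<psi> x)" "\<forall>x\<in>S. \<psi> x 0 = x"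
    "\<forall>x\<in>S. \<exists>\<zeta>\<in>cball 0 1. G_plus f (\<psi> x \<zeta>) = 1"
    using fam unfolding normalized_invariant_family_def by (elim conjE; blast)+
  show "S \<subseteq> J_star f" "f ` S = S" by (fact *(1), fact *(2))
  show "entire_curve (\<psi> x)" if "x \<in> S" using *(3) that unfolding injective_immersion_def by blast
  show "\<psi> x 0 = x" "\<exists>\<zeta>\<in>cball 0 1. G_plus f (\<psi> x \<zeta>) = 1" if "x \<in> S"
    using *(4,5) that by blast+
qed

lemma J_closure: "J_star f = closure S"
proof
  show "J_star f \<subseteq> closure S" using fam unfolding normalized_invariant_family_def by (elim conjE)
  show "closure S \<subseteq> J_star f" using S_sub by (simp add: J_star_def closure_minimal)
qed

lemma inv_S: "inv f ` S = S"
proof -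
  have "inv f ` f ` S = S" by (rule image_inv_f_f[OF bij_is_inj[OF bij_f]])
  then show ?thesis by (simp add: fS)
qed

lemma cont_f: "continuous_on UNIV f" and cont_inv: "continuous_on UNIV (inv f)"
  using poly_f poly_inv by (simp_all add: polynomial_map_continuous)

lemma J_invariant: "f ` J_star f \<subseteq> J_star f" "inv f ` J_star f \<subseteq> J_star f"
proof -
  have *: "g ` closure S \<subseteq> closure (g ` S)" if "continuous_on UNIV g" for g :: "C2 \<Rightarrow> C2"
    by (rule image_closure_subset[OF continuous_on_subset[OF that subset_UNIV] closed_closure closure_subset])
  show "f ` J_star f \<subseteq> J_star f" using *[OF cont_f] by (simp add: J_closure fS)
  show "inv f ` J_star f \<subseteq> J_star f" using *[OF cont_inv] by (simp add: J_closure inv_S)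
qed

lemma normal_subsequence:
  fixes s :: "nat \<Rightarrow> C2"
  assumes "range s \<subseteq> S"
  obtains r \<phi> where "strict_mono r" "entire_curve \<phi>" "locally_uniform_limit (\<lambda>n. \<psi> (s (r n))) \<phi>"
proof -
  have "\<exists>r \<phi>. strict_mono r \<and> entire_curve \<phi> \<and> locally_uniform_limit (\<lambda>n. \<psi> (s (r n))) \<phi>"
    by (rule normal[unfolded normal_family_def, rule_format, OF assms])
  then show ?thesis by (elim exE conjE) (rule that)
qed

text \<open>Normality already forces \<open>S\<close> to be bounded, since \<open>\<psi> y 0 = y\<close>.\<close>

lemma compact_J: "compact (J_star f)"
proof -
  have "bounded S"
  proof (rule ccontr)
    assume "\<not> bounded S"
    then have "\<forall>n. \<exists>y\<in>S. norm y > real n" by (simp add: bounded_iff not_le)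
    then obtain s where s: "\<And>n. s n \<in> S" "\<And>n. norm (s n) > real n" by metis
    obtain r \<phi> where r: "strict_mono r" "entire_curve \<phi>" "locally_uniform_limit (\<lambda>n. \<psi> (s (r n))) \<phi>"
      using normal_subsequence[of s] s by blast
    have "(\<lambda>n. \<psi> (s (r n)) 0) \<longlonglongrightarrow> \<phi> 0"
      by (rule locally_uniform_limit_pointwise[OF r(3,2)]) simp
    then have "(\<lambda>n. s (r n)) \<longlonglongrightarrow> \<phi> 0" using s(1) by (simp add: base)
    then have "Bseq (\<lambda>n. s (r n))" by (intro convergent_imp_Bseq convergentI)
    then obtain B where B: "\<And>n. norm (s (r n)) \<le> B" by (auto simp: Bseq_def)
    obtain n where "B < real n" using reals_Archimedean2 by blast
    moreover have "real n \<le> real (r n)" using seq_suble[OF r(1)] by simp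
    ultimately show False using B[of n] s(2)[of "r n"] by linarith
  qed
  then show ?thesis by (simp add: J_closure compact_closure)
qed

lemma deriv_bounded: "\<exists>A. \<forall>y\<in>S. norm (curve_deriv k (\<psi> y) 0) \<le> A"
proof (rule ccontr)
  assume "\<not> ?thesis"
  then have "\<forall>n. \<exists>y\<in>S. norm (curve_deriv k (\<psi> y) 0) > real n" by (simp add: not_le)
  then obtain s where s: "\<And>n. s n \<in> S" "\<And>n. norm (curve_deriv k (\<psi> (s n)) 0) > real n" by metis
  obtain r \<phi> where r: "strict_mono r" "entire_curve \<phi>" "locally_uniform_limit (\<lambda>n. \<psi> (s (r n))) \<phi>"
    using normal_subsequence[of s] s by blast
  have "(\<lambda>n. curve_deriv k (\<psi> (s (r n))) 0) \<longlonglongrightarrow> curve_deriv k \<phi> 0"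
    using s(1) by (intro curve_deriv_tendsto r(3) entire)
  then have "Bseq (\<lambda>n. curve_deriv k (\<psi> (s (r n))) 0)" by (intro convergent_imp_Bseq convergentI)
  then obtain B where B: "\<And>n. norm (curve_deriv k (\<psi> (s (r n))) 0) \<le> B" by (auto simp: Bseq_def)
  obtain n where "B < real n" using reals_Archimedean2 by blast
  moreover have "real n \<le> real (r n)" using seq_suble[OF r(1)] by simp
  ultimately show False using B[of n] s(2)[of "r n"] by linarith
qed

lemma limit_curvesE:
  assumes "\<phi> \<in> limit_curves S \<psi> x"
  obtains y where "\<And>n. y n \<in> S" "y \<longlonglongrightarrow> x" "locally_uniform_limit (\<lambda>j. \<psi> (y j)) \<phi>" "entire_curve \<phi>"
proof -
  have "\<exists>y. range y \<subseteq> S \<and> y \<longlonglongrightarrow> x \<and> locally_uniform_limit (\<lambda>j. \<psi> (y j)) \<phi>" "entire_curve \<phi>"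
    using assms unfolding limit_curves_def by simp_all
  then obtain y where y: "range y \<subseteq> S" "y \<longlonglongrightarrow> x" "locally_uniform_limit (\<lambda>j. \<psi> (y j)) \<phi>" by (elim exE conjE)
  show ?thesis by (rule that[OF _ y(2,3) \<open>entire_curve \<phi>\<close>]) (use y(1) in auto)
qed

lemma limit_curves_base:
  assumes "\<phi> \<in> limit_curves S \<psi> x"
  shows "\<phi> 0 = x"
proof -
  obtain y where y: "\<And>n. y n \<in> S" "y \<longlonglongrightarrow> x" "locally_uniform_limit (\<lambda>j. \<psi> (y j)) \<phi>" "entire_curve \<phi>"
    using limit_curvesE[OF assms] by metis
  have "(\<lambda>n. \<psi> (y n) 0) \<longlonglongrightarrow> \<phi> 0"
    by (rule locally_uniform_limit_pointwise[OF y(3,4)]) simp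
  then have "y \<longlonglongrightarrow> \<phi> 0" using y(1) by (simp add: base)
  then show ?thesis using y(2) by (rule LIMSEQ_unique)
qed

lemma limit_curves_deriv_tendsto:
  assumes "\<And>n. y n \<in> S" "locally_uniform_limit (\<lambda>j. \<psi> (y j)) \<phi>"
  shows "(\<lambda>n. curve_deriv k (\<psi> (y n)) 0) \<longlonglongrightarrow> curve_deriv k \<phi> 0"
  using assms by (intro curve_deriv_tendsto entire)

lemma limit_curves_subseq:
  assumes "\<And>n. y n \<in> S" "y \<longlonglongrightarrow> x"
  obtains r \<phi> where "strict_mono r" "\<phi> \<in> limit_curves S \<psi> x" "locally_uniform_limit (\<lambda>n. \<psi> (y (r n))) \<phi>"
    "entire_curve \<phi>"
proof -
  obtain r \<phi> where r: "strict_mono r" "entire_curve \<phi>" "locally_uniform_limit (\<lambda>n. \<psi> (y (r n))) \<phi>"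
    using normal_subsequence[of y] assms(1) by blast
  have "(\<lambda>n. y (r n)) \<longlonglongrightarrow> x" using LIMSEQ_subseq_LIMSEQ[OF assms(2) r(1)] by (simp add: o_def)
  then have "\<phi> \<in> limit_curves S \<psi> x"
    unfolding limit_curves_def using r assms(1) by (auto intro!: exI[of _ "\<lambda>n. y (r n)"])
  then show ?thesis using that r by blast
qed

lemma limit_curves_nonempty: "x \<in> J_star f \<Longrightarrow> limit_curves S \<psi> x \<noteq> {}"
proof -
  assume "x \<in> J_star f"
  then obtain y where "\<And>n. y n \<in> S" "y \<longlonglongrightarrow> x" unfolding J_closure closure_sequential by blast
  then show ?thesis using limit_curves_subseq by (metis empty_iff)
qed

lemma limit_curves_nonconstant:
  assumes x: "x \<in> J_star f" and \<phi>: "\<phi> \<in> limit_curves S \<psi> x"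
  shows "\<exists>k\<ge>1. curve_deriv k \<phi> 0 \<noteq> 0"
proof (rule ccontr)
  assume no: "\<not> ?thesis"
  obtain y where y: "\<And>n. y n \<in> S" "y \<longlonglongrightarrow> x" "locally_uniform_limit (\<lambda>j. \<psi> (y j)) \<phi>" "entire_curve \<phi>"
    using limit_curvesE[OF \<phi>] by metis
  \<comment> \<open>A constant limit pulls the points where the Green function equals \<open>1\<close> into \<open>x\<close>.\<close>
  have const: "\<phi> \<zeta> = x" for \<zeta>
    using entire_curve_const[OF y(4)] no limit_curves_base[OF \<phi>] by metis
  have "\<exists>\<zeta>. \<forall>n. \<zeta> n \<in> cball 0 1 \<and> G_plus f (\<psi> (y n) (\<zeta> n)) = 1"
    using attained[OF y(1)] by (intro choice) blast
  then obtain \<zeta> where \<zeta>: "\<And>n. \<zeta> n \<in> cball 0 1" "\<And>n. G_plus f (\<psi> (y n) (\<zeta> n)) = 1" by blast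
  have u: "uniform_limit (cball 0 1) (\<lambda>j. \<psi> (y j)) \<phi> sequentially"
    using y(3) by (simp add: locally_uniform_limit_def)
  have "(\<lambda>n. \<psi> (y n) (\<zeta> n)) \<longlonglongrightarrow> x"
  proof (rule tendstoI)
    fix e :: real assume "e > 0"
    from uniform_limitD[OF u this] show "eventually (\<lambda>n. dist (\<psi> (y n) (\<zeta> n)) x < e) sequentially"
      by eventually_elim (use \<zeta>(1) const in metis)
  qed
  moreover have "bounded (range (\<lambda>n. (f ^^ n) x))"
  proof (rule bounded_subset[OF compact_imp_bounded[OF compact_J]])
    have "(f ^^ n) x \<in> J_star f" for n using x J_invariant(1) by (induction n) auto
    then show "range (\<lambda>n. (f ^^ n) x) \<subseteq> J_star f" by blast
  qed
  then have "eventually (\<lambda>p. G_plus f p < 1) (nhds x)"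
    by (rule G_plus_less_one_near_bounded_orbit[OF conj deg(2,1)])
  ultimately have "eventually (\<lambda>n. G_plus f (\<psi> (y n) (\<zeta> n)) < 1) sequentially"
    by (rule eventually_compose_filterlim[rotated])
  then show False using \<zeta>(2) by simp
qed

lemma has_order_limit_curve:
  "x \<in> J_star f \<Longrightarrow> \<phi> \<in> limit_curves S \<psi> x \<Longrightarrow> has_order (Ord \<phi>) \<phi>"
  by (intro has_order_Ord limit_curves_nonconstant)

lemma order_setE:
  assumes x: "x \<in> order_set S \<psi> k \<epsilon>"
  obtains \<phi> where "\<phi> \<in> limit_curves S \<psi> x" "\<And>i. 1 \<le> i \<Longrightarrow> i < k \<Longrightarrow> curve_deriv i \<phi> 0 = 0"
    "norm (curve_deriv k \<phi> 0) \<ge> \<epsilon>"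
proof -
  have "\<exists>y\<in>S. dist y x < 1 / Suc j \<and> (\<forall>i\<in>{1..<k}. norm (curve_deriv i (\<psi> y) 0) < 1 / Suc j) \<and>
     norm (curve_deriv k (\<psi> y) 0) > \<epsilon> - 1 / Suc j" for j
  proof -
    have "x \<in> closure {y \<in> S. (\<forall>i\<in>{1..<k}. norm (curve_deriv i (\<psi> y) 0) < 1 / Suc j) \<and>
       norm (curve_deriv k (\<psi> y) 0) > \<epsilon> - 1 / Suc j}" using x unfolding order_set_def by blast
    then have "\<exists>y\<in>{y \<in> S. (\<forall>i\<in>{1..<k}. norm (curve_deriv i (\<psi> y) 0) < 1 / Suc j) \<and>
       norm (curve_deriv k (\<psi> y) 0) > \<epsilon> - 1 / Suc j}. dist y x < 1 / Suc j"
      unfolding closure_approachable by simp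
    then show ?thesis by blast
  qed
  then obtain y where y: "\<And>j. y j \<in> S" "\<And>j. dist (y j) x < 1 / Suc j"
    "\<And>j i. i \<in> {1..<k} \<Longrightarrow> norm (curve_deriv i (\<psi> (y j)) 0) < 1 / Suc j"
    "\<And>j. norm (curve_deriv k (\<psi> (y j)) 0) > \<epsilon> - 1 / Suc j" by metis
  have inv0: "(\<lambda>j. 1 / real (Suc j)) \<longlonglongrightarrow> 0"
    using LIMSEQ_inverse_real_of_nat by (simp add: inverse_eq_divide)
  have "y \<longlonglongrightarrow> x"
  proof (rule tendsto_dist_iff[THEN iffD2], rule tendsto_sandwich[OF _ _ tendsto_const inv0])
    show "eventually (\<lambda>j. dist (y j) x \<le> 1 / Suc j) sequentially"
      using y(2) by (intro always_eventually allI less_imp_le)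
  qed simp
  then obtain r \<phi> where r: "strict_mono r" "\<phi> \<in> limit_curves S \<psi> x" "locally_uniform_limit (\<lambda>n. \<psi> (y (r n))) \<phi>"
    using limit_curves_subseq[of y x] y(1) by metis
  have inv0r: "(\<lambda>j. 1 / real (Suc (r j))) \<longlonglongrightarrow> 0"
    using LIMSEQ_subseq_LIMSEQ[OF inv0 r(1)] by (simp add: o_def)
  have lim: "(\<lambda>n. norm (curve_deriv i (\<psi> (y (r n))) 0)) \<longlonglongrightarrow> norm (curve_deriv i \<phi> 0)" for i
    by (intro tendsto_norm limit_curves_deriv_tendsto y(1) r(3))
  have "curve_deriv i \<phi> 0 = 0" if "1 \<le> i" "i < k" for i
  proof -
    have "norm (curve_deriv i \<phi> 0) \<le> 0"
      by (rule LIMSEQ_le[OF lim inv0r]) (use y(3)[of i] that in \<open>auto intro: less_imp_le\<close>)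
    then show ?thesis by simp
  qed
  moreover have "\<epsilon> - 0 \<le> norm (curve_deriv k \<phi> 0)"
    by (rule LIMSEQ_le[OF tendsto_diff[OF tendsto_const inv0r] lim]) (use y(4) in \<open>auto intro: less_imp_le\<close>)
  ultimately show ?thesis using that r(2) by simp
qed

lemma order_setI:
  assumes \<phi>: "\<phi> \<in> limit_curves S \<psi> x" "\<And>i. 1 \<le> i \<Longrightarrow> i < k \<Longrightarrow> curve_deriv i \<phi> 0 = 0"
    and \<epsilon>: "norm (curve_deriv k \<phi> 0) \<ge> \<epsilon>"
  shows "x \<in> order_set S \<psi> k \<epsilon>"
  unfolding order_set_def
proof
  fix j :: nat
  obtain y where y: "\<And>n. y n \<in> S" "y \<longlonglongrightarrow> x" "locally_uniform_limit (\<lambda>j. \<psi> (y j)) \<phi>" "entire_curve \<phi>"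
    using limit_curvesE[OF \<phi>(1)] by metis
  have lim: "(\<lambda>n. norm (curve_deriv i (\<psi> (y n)) 0)) \<longlonglongrightarrow> norm (curve_deriv i \<phi> 0)" for i
    by (intro tendsto_norm limit_curves_deriv_tendsto y(1,3))
  let ?A = "{y \<in> S. (\<forall>i\<in>{1..<k}. norm (curve_deriv i (\<psi> y) 0) < 1 / Suc j) \<and>
     norm (curve_deriv k (\<psi> y) 0) > \<epsilon> - 1 / Suc j}"
  have "eventually (\<lambda>n. norm (curve_deriv i (\<psi> (y n)) 0) < 1 / Suc j) sequentially" if "i \<in> {1..<k}" for i
    using \<phi>(2)[of i] that by (intro order_tendstoD(2)[OF lim]) auto
  then have "eventually (\<lambda>n. \<forall>i\<in>{1..<k}. norm (curve_deriv i (\<psi> (y n)) 0) < 1 / Suc j) sequentially"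
    by (intro eventually_ball_finite) auto
  moreover have "eventually (\<lambda>n. norm (curve_deriv k (\<psi> (y n)) 0) > \<epsilon> - 1 / Suc j) sequentially"
  proof (rule order_tendstoD(1)[OF lim])
    have "0 < 1 / real (Suc j)" by simp
    then show "\<epsilon> - 1 / Suc j < norm (curve_deriv k \<phi> 0)" using \<epsilon> by linarith
  qed
  ultimately have "eventually (\<lambda>n. y n \<in> ?A) sequentially"
    by eventually_elim (simp add: y(1))
  then have ev: "eventually (\<lambda>n. y n \<in> closure ?A) sequentially"
    by (rule eventually_mono) (rule closure_subset[THEN subsetD])
  show "x \<in> closure ?A"
    by (rule Lim_in_closed_set[OF closed_closure ev trivial_limit_sequentially y(2)])
qed

lemma iterate_family:
  assumes "y \<in> S"
  shows "(f ^^ n) y \<in> S \<and> (\<exists>\<mu>. \<kappa> ^ n \<le> cmod \<mu> \<and> (\<forall>\<zeta>. (f ^^ n) (\<psi> y \<zeta>) = \<psi> ((f ^^ n) y) (\<mu> * \<zeta>)))"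
proof (induction n)
  case 0
  then show ?case using assms by (auto intro!: exI[of _ 1])
next
  case (Suc n)
  then obtain \<mu> where \<mu>: "\<kappa> ^ n \<le> cmod \<mu>" "\<And>\<zeta>. (f ^^ n) (\<psi> y \<zeta>) = \<psi> ((f ^^ n) y) (\<mu> * \<zeta>)" by blast
  have y: "(f ^^ n) y \<in> S" using Suc by blast
  show ?case
  proof (intro conjI exI allI)
    show "(f ^^ Suc n) y \<in> S" using y fS by auto
    have "\<kappa> * \<kappa> ^ n \<le> cmod (lam ((f ^^ n) y)) * cmod \<mu>"
      using lam_ge y \<mu>(1) \<kappa> by (intro mult_mono) auto
    then show "\<kappa> ^ Suc n \<le> cmod (lam ((f ^^ n) y) * \<mu>)" by (simp add: norm_mult)
    fix \<zeta>
    show "(f ^^ Suc n) (\<psi> y \<zeta>) = \<psi> ((f ^^ Suc n) y) (lam ((f ^^ n) y) * \<mu> * \<zeta>)"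
      using \<mu>(2) lam y by (simp add: mult.assoc)
  qed
qed

text \<open>The factor \<open>\<sigma>\<close> is a limit of inverse multipliers, which stay in a compact disc. It may be \<open>0\<close> if
\<open>\<omega>\<close> is constant.\<close>

lemma pull_back_limit_curve:
  assumes \<omega>: "\<omega> \<in> limit_curves S \<psi> ((f ^^ n) x)"
  obtains \<phi> \<sigma> where "\<phi> \<in> limit_curves S \<psi> x" "cmod \<sigma> \<le> inverse (\<kappa> ^ n)" "\<And>\<zeta>. \<omega> \<zeta> = (f ^^ n) (\<phi> (\<sigma> * \<zeta>))"
proof -
  obtain y where y: "\<And>n. y n \<in> S" "y \<longlonglongrightarrow> (f ^^ n) x" "locally_uniform_limit (\<lambda>j. \<psi> (y j)) \<omega>" "entire_curve \<omega>"
    using limit_curvesE[OF \<omega>] by metis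
  define w where "w j = (inv f ^^ n) (y j)" for j
  have "(inv f ^^ m) z \<in> S" if "z \<in> S" for m z using that inv_S by (induction m) auto
  then have wS: "w j \<in> S" for j using y(1) by (simp add: w_def)
  have fw: "(f ^^ n) (w j) = y j" for j by (simp add: w_def iterate_inv_cancel[OF bij_f])
  have cont_pow: "continuous_on UNIV (g ^^ m)" if "continuous_on UNIV g" for g :: "C2 \<Rightarrow> C2" and m
  proof (induction m)
    case (Suc m)
    have "continuous_on UNIV (\<lambda>x. g ((g ^^ m) x))"
      by (rule continuous_on_compose2[OF that Suc]) auto
    then show ?case by (simp add: o_def)
  qed (simp add: id_def)
  have "(\<lambda>j. (inv f ^^ n) (y j)) \<longlonglongrightarrow> (inv f ^^ n) ((f ^^ n) x)"
    by (rule continuous_on_tendsto_compose[OF cont_pow[OF cont_inv] y(2)]) auto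
  then have wx: "w \<longlonglongrightarrow> x" by (simp add: w_def[abs_def] iterate_inv_cancel[OF bij_f])
  obtain r \<phi> where r: "strict_mono r" "\<phi> \<in> limit_curves S \<psi> x" "locally_uniform_limit (\<lambda>j. \<psi> (w (r j))) \<phi>" "entire_curve \<phi>"
    using limit_curves_subseq[OF wS wx] by metis
  have "\<forall>j. \<exists>\<mu>. \<kappa> ^ n \<le> cmod \<mu> \<and> (\<forall>\<zeta>. (f ^^ n) (\<psi> (w j) \<zeta>) = \<psi> (y j) (\<mu> * \<zeta>))"
    using iterate_family[OF wS, of n] by (simp add: fw)
  then obtain \<mu> where \<mu>: "\<And>j. \<kappa> ^ n \<le> cmod (\<mu> j)" "\<And>j \<zeta>. (f ^^ n) (\<psi> (w j) \<zeta>) = \<psi> (y j) (\<mu> j * \<zeta>)"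
    by metis
  have \<kappa>n: "\<kappa> ^ n > 0" using \<kappa> by simp
  have \<mu>0: "\<mu> j \<noteq> 0" for j using \<mu>(1)[of j] \<kappa>n by auto
  define s where "s j = inverse (\<mu> (r j))" for j
  have s: "s j \<in> cball 0 (inverse (\<kappa> ^ n))" for j
    using le_imp_inverse_le[OF \<mu>(1)[of "r j"] \<kappa>n] by (simp add: s_def norm_inverse)
  obtain \<sigma> r' where \<sigma>: "\<sigma> \<in> cball 0 (inverse (\<kappa> ^ n))" "strict_mono r'" "(s \<circ> r') \<longlonglongrightarrow> \<sigma>"
    using compact_cball[of "0::complex" "inverse (\<kappa> ^ n)"] s unfolding compact_def by metis
  have "\<omega> \<zeta> = (f ^^ n) (\<phi> (\<sigma> * \<zeta>))" for \<zeta>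
  proof -
    have lw: "locally_uniform_limit (\<lambda>j. \<psi> (w (r (r' j)))) \<phi>"
      using locally_uniform_limit_subseq[OF r(3) \<sigma>(2)] .
    have "(\<lambda>j. s (r' j) * \<zeta>) \<longlonglongrightarrow> \<sigma> * \<zeta>"
      using \<sigma>(3) by (intro tendsto_mult tendsto_const) (simp add: o_def)
    then have "(\<lambda>j. \<psi> (w (r (r' j))) (s (r' j) * \<zeta>)) \<longlonglongrightarrow> \<phi> (\<sigma> * \<zeta>)"
      by (rule locally_uniform_limit_pointwise[OF lw r(4)])
    then have "(\<lambda>j. (f ^^ n) (\<psi> (w (r (r' j))) (s (r' j) * \<zeta>))) \<longlonglongrightarrow> (f ^^ n) (\<phi> (\<sigma> * \<zeta>))"
      by (rule continuous_on_tendsto_compose[OF cont_pow[OF cont_f]]) auto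
    moreover have "(f ^^ n) (\<psi> (w (r (r' j))) (s (r' j) * \<zeta>)) = \<psi> (y (r (r' j))) \<zeta>" for j
      using \<mu>0[of "r (r' j)"] by (simp add: \<mu>(2) s_def mult.assoc[symmetric])
    moreover have "(\<lambda>j. \<psi> (y j) \<zeta>) \<longlonglongrightarrow> \<omega> \<zeta>"
      by (rule locally_uniform_limit_pointwise[OF y(3,4) tendsto_const])
    then have "(\<lambda>j. \<psi> (y (r (r' j))) \<zeta>) \<longlonglongrightarrow> \<omega> \<zeta>"
      using LIMSEQ_subseq_LIMSEQ[OF _ strict_mono_o[OF r(1) \<sigma>(2)]] by (fastforce simp: o_def)
    ultimately show ?thesis by (simp add: LIMSEQ_unique)
  qed
  then show ?thesis using that r(2) \<sigma>(1) by simp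
qed

lemma derivative_lower_bound:
  assumes Dn: "C1_deriv (f ^^ n) Dn" and inj: "\<And>v. blinfun_apply (Dn x) v = 0 \<Longrightarrow> v = 0"
    and x: "(f ^^ n) x \<in> order_set S \<psi> k \<epsilon>" and \<epsilon>: "\<epsilon> > 0" and k: "k \<ge> 1"
    and A: "\<And>y. y \<in> S \<Longrightarrow> norm (curve_deriv k (\<psi> y) 0) \<le> A"
  shows "\<kappa> ^ (n * k) * \<epsilon> \<le> norm (Dn x) * A"
proof -
  obtain \<omega> where \<omega>: "\<omega> \<in> limit_curves S \<psi> ((f ^^ n) x)" "\<And>i. 1 \<le> i \<Longrightarrow> i < k \<Longrightarrow> curve_deriv i \<omega> 0 = 0"
    "norm (curve_deriv k \<omega> 0) \<ge> \<epsilon>"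
    using order_setE[OF x] by metis
  obtain \<phi> \<sigma> where \<phi>: "\<phi> \<in> limit_curves S \<psi> x" "cmod \<sigma> \<le> inverse (\<kappa> ^ n)" "\<And>\<zeta>. \<omega> \<zeta> = (f ^^ n) (\<phi> (\<sigma> * \<zeta>))"
    using pull_back_limit_curve[OF \<omega>(1)] by metis
  have e: "entire_curve \<omega>" "entire_curve \<phi>" using \<omega>(1) \<phi>(1) by (auto simp: limit_curves_def)
  have der: "((f ^^ n) has_derivative blinfun_apply (Dn x)) (at (\<phi> 0))"
    using Dn by (simp add: C1_deriv_def limit_curves_base[OF \<phi>(1)])
  have "curve_deriv k \<omega> 0 = Dn x (\<sigma> ^ k *s curve_deriv k \<phi> 0)"
    by (rule semiconjugate_leading_coefficient[OF e \<phi>(3) der inj k \<omega>(2)]) (use \<omega>(3) \<epsilon> in auto)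
  then have "\<epsilon> \<le> norm (Dn x) * (cmod \<sigma> ^ k * norm (curve_deriv k \<phi> 0))"
    using \<omega>(3) norm_blinfun[of "Dn x" "\<sigma> ^ k *s curve_deriv k \<phi> 0"]
    by (simp add: norm_vector_smult_C2 norm_power)
  also have "\<dots> \<le> norm (Dn x) * (inverse (\<kappa> ^ n) ^ k * A)"
  proof (intro mult_left_mono mult_mono power_mono)
    obtain y where y: "\<And>n. y n \<in> S" "locally_uniform_limit (\<lambda>j. \<psi> (y j)) \<phi>"
      using limit_curvesE[OF \<phi>(1)] by metis
    have "(\<lambda>n. norm (curve_deriv k (\<psi> (y n)) 0)) \<longlonglongrightarrow> norm (curve_deriv k \<phi> 0)"
      by (intro tendsto_norm limit_curves_deriv_tendsto y)
    then show "norm (curve_deriv k \<phi> 0) \<le> A" by (rule LIMSEQ_le_const2) (use A y(1) in blast)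
  qed (use \<phi>(2) \<kappa> in auto)
  finally have "\<kappa> ^ (n * k) * \<epsilon> \<le> \<kappa> ^ (n * k) * (norm (Dn x) * (inverse (\<kappa> ^ n) ^ k * A))"
    using \<kappa> by (intro mult_left_mono) auto
  also have "\<dots> = norm (Dn x) * A"
  proof -
    have "\<kappa> ^ (n * k) * inverse (\<kappa> ^ n) ^ k = 1"
      using \<kappa> by (simp add: power_mult flip: power_mult_distrib)
    moreover have "\<kappa> ^ (n * k) * (norm (Dn x) * (inverse (\<kappa> ^ n) ^ k * A))
        = (\<kappa> ^ (n * k) * inverse (\<kappa> ^ n) ^ k) * (norm (Dn x) * A)" by (simp only: mult_ac)
    ultimately show ?thesis by simp
  qed
  finally show ?thesis .
qed

text \<open>Both claims about the Lyapunov exponent are instances: \<open>k0 = 1\<close>, where every limit curve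
qualifies, and \<open>k0 = k\<close> on \<open>J_level f S \<psi> k\<close>.\<close>

lemma lyapunov_ge:
  assumes erg: "ergodic_invariant f \<nu>" and J: "AE x in \<nu>. x \<in> J_star f"
    and k0: "k0 \<ge> 1"
    and ord: "AE x in \<nu>. \<exists>\<phi>\<in>limit_curves S \<psi> x. \<exists>k\<ge>k0. has_order k \<phi>"
  shows "lyapunov_exponent f \<nu> \<ge> real k0 * ln \<kappa>"
proof -
  have prob: "prob_space \<nu>" and sets: "sets \<nu> = sets borel" and inv: "distr \<nu> \<nu> f = \<nu>"
    using erg by (auto simp: ergodic_invariant_def)
  interpret prob_space \<nu> by (rule prob)
  obtain Df where Df: "C1_deriv f Df" using polynomial_map_C1[OF poly_f] by blast
  obtain Dn where Dn: "\<And>n. C1_deriv (f ^^ n) (Dn n)" using C1_iterates[OF Df] by metis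
  obtain Di where Di: "C1_deriv (inv f) Di" using polynomial_map_C1[OF poly_inv] by blast
  obtain En where En: "\<And>n. C1_deriv (inv f ^^ n) (En n)" using C1_iterates[OF Di] by metis
  have inverse: "En n ((f ^^ n) x) o\<^sub>L Dn n x = id_blinfun" for n x
  proof (rule blinfun_eqI)
    fix v
    have "((inv f ^^ n \<circ> f ^^ n) has_derivative blinfun_apply (En n ((f ^^ n) x) o\<^sub>L Dn n x)) (at x)"
      by (rule C1_compose_deriv[OF En Dn])
    moreover have "(inv f ^^ n \<circ> f ^^ n) = (\<lambda>x. x)"
      by (simp add: fun_eq_iff iterate_inv_cancel[OF bij_f])
    ultimately have "blinfun_apply (En n ((f ^^ n) x) o\<^sub>L Dn n x) = (\<lambda>v. v)"
      by (metis has_derivative_ident has_derivative_unique)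
    then show "blinfun_apply (En n ((f ^^ n) x) o\<^sub>L Dn n x) v = blinfun_apply id_blinfun v" by simp
  qed
  have inj: "v = 0" if "blinfun_apply (Dn n x) v = 0" for n x v
  proof -
    have "blinfun_apply (En n ((f ^^ n) x) o\<^sub>L Dn n x) v = 0" using that by simp
    then show ?thesis by (simp add: inverse)
  qed
  \<comment> \<open>The derivatives of the inverse map bound those of \<open>f\<close> from below.\<close>
  have one_le: "1 \<le> norm (En n ((f ^^ n) x)) * norm (Dn n x)" for n x
  proof -
    have "norm (id_blinfun :: C2 \<Rightarrow>\<^sub>L C2) = 1" by simp
    then show ?thesis using norm_blinfun_compose[of "En n ((f ^^ n) x)" "Dn n x"] by (simp add: inverse)
  qed
  have pos: "norm (Dn n x) > 0" for n x using one_le[of n x] by (cases "Dn n x = 0") auto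
  define g where "g n x = ln (norm (Dn n x))" for n x
  have Jn: "x \<in> J_star f \<Longrightarrow> (f ^^ n) x \<in> J_star f" for n x using J_invariant(1) by (induction n) auto
  obtain K where K: "K \<ge> 1" "\<And>n x. x \<in> J_star f \<Longrightarrow> norm (Dn n x) \<le> K ^ n"
    using C1_iterates_bound[where F = f and Dn = Dn, OF Dn compact_J J_invariant(1)] by (elim exE conjE) simp
  obtain K' where K': "K' \<ge> 1" "\<And>n x. x \<in> J_star f \<Longrightarrow> norm (En n x) \<le> K' ^ n"
    using C1_iterates_bound[where F = "inv f" and Dn = En, OF En compact_J J_invariant(2)] by (elim exE conjE) simp
  obtain A where A: "\<And>k y. y \<in> S \<Longrightarrow> norm (curve_deriv k (\<psi> y) 0) \<le> A k" using deriv_bounded by metis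
  \<comment> \<open>Only finitely many orders \<open>k\<close> occur in each \<open>E j\<close>, so that the bounds \<open>A k\<close> can be combined.\<close>
  define E where "E j = (\<Union>k\<in>{k0..k0 + j}. order_set S \<psi> k (1 / Suc j))" for j
  have "lim (\<lambda>n. (\<integral>x. g n x \<partial>\<nu>) / real n) \<ge> real k0 * ln \<kappa>"
  proof (rule lyapunov_lower_bound[OF prob sets cont_f inv J J_invariant(1)])
    fix n
    show "continuous_on UNIV (g n)"
      unfolding g_def using Dn[of n] pos[of n]
      by (intro continuous_intros) (auto simp: C1_deriv_def)
  next
    show "0 \<le> max (ln K) (ln K')" using K(1) by (simp add: le_max_iff_disj)
  next
    fix n x assume x: "x \<in> J_star f"
    have "g n x \<le> ln (K ^ n)" unfolding g_def using K pos x by (subst ln_le_cancel_iff) auto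
    then have "g n x \<le> real n * ln K" using K(1) by (simp add: ln_realpow)
    moreover have "0 \<le> real n * ln K' + g n x"
    proof -
      have "norm (En n ((f ^^ n) x)) * norm (Dn n x) \<le> K' ^ n * norm (Dn n x)"
        using K'(2)[OF Jn[OF x]] by (intro mult_right_mono) auto
      then have "1 \<le> K' ^ n * norm (Dn n x)" using one_le[of n x] by linarith
      then have "0 \<le> ln (K' ^ n * norm (Dn n x))" by simp
      also have "\<dots> = real n * ln K' + g n x" using K'(1) pos[of n x] by (simp add: g_def ln_mult ln_realpow)
      finally show ?thesis .
    qed
    moreover have "real n * ln K \<le> real n * max (ln K) (ln K')" "real n * ln K' \<le> real n * max (ln K) (ln K')"
      by (simp_all add: mult_left_mono)
    ultimately have "\<bar>g n x\<bar> \<le> real n * max (ln K) (ln K')" by linarith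
    then show "\<bar>g n x\<bar> \<le> max (ln K) (ln K') * real n" by (simp add: mult.commute)
  next
    fix m n x
    have "norm (Dn (m + n) x) \<le> norm (Dn m ((f ^^ n) x)) * norm (Dn n x)"
      unfolding C1_iterates_chain[OF Dn] by (rule norm_blinfun_compose)
    then have "g (m + n) x \<le> ln (norm (Dn m ((f ^^ n) x)) * norm (Dn n x))"
      unfolding g_def using pos by (subst ln_le_cancel_iff) auto
    then show "g (m + n) x \<le> g m ((f ^^ n) x) + g n x" using pos by (simp add: g_def ln_mult)
  next
    fix j
    have "closed (E j)" unfolding E_def by (auto intro!: closed_UN closed_order_set)
    then show "E j \<in> sets \<nu>" using sets by simp
  next
    have Es: "range E \<subseteq> sets \<nu>"
      using sets unfolding E_def by (auto intro!: borel_closed closed_UN closed_order_set)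
    have Einc: "incseq E"
    proof (rule incseq_SucI)
      fix j
      have "order_set S \<psi> k (1 / Suc j) \<subseteq> order_set S \<psi> k (1 / Suc (Suc j))" for k
        by (intro order_set_antimono) (simp add: frac_le)
      moreover have "{k0..k0 + j} \<subseteq> {k0..k0 + Suc j}" by auto
      ultimately show "E j \<subseteq> E (Suc j)" unfolding E_def by (meson UN_mono)
    qed
    have "AE x in \<nu>. x \<in> (\<Union>j. E j)"
      using ord
    proof eventually_elim
      case (elim x)
      then obtain \<phi> k where \<phi>: "\<phi> \<in> limit_curves S \<psi> x" "k \<ge> k0" "has_order k \<phi>" by blast
      then have "norm (curve_deriv k \<phi> 0) > 0" by (simp add: has_order_def)
      then obtain n where n: "1 / Suc n < norm (curve_deriv k \<phi> 0)" using nat_approx_posE by blast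
      define j where "j = max n k"
      have "1 / real (Suc j) \<le> 1 / Suc n" by (intro frac_le) (auto simp: j_def)
      then have "x \<in> order_set S \<psi> k (1 / Suc j)"
        using n \<phi>(3) by (intro order_setI[OF \<phi>(1)]) (auto simp: has_order_def)
      moreover have "k \<in> {k0..k0 + j}" using \<phi>(2) by (auto simp: j_def)
      ultimately show ?case unfolding E_def by blast
    qed
    then have "prob (\<Union>j. E j) = 1" using Es by (subst prob_eq_1) auto
    then show "(\<lambda>j. prob (E j)) \<longlonglongrightarrow> 1" using finite_Lim_measure_incseq[OF Es Einc] by simp
  next
    fix j
    define \<epsilon> where "\<epsilon> = 1 / real (Suc j)"
    have \<epsilon>: "\<epsilon> > 0" "\<epsilon> \<le> 1" by (auto simp: \<epsilon>_def)
    define B where "B = 1 + (\<Sum>k\<in>{k0..k0 + j}. \<bar>A k\<bar>)"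
    have B1: "B \<ge> 1" by (simp add: B_def sum_nonneg)
    have AB: "A k \<le> B" if "k \<in> {k0..k0 + j}" for k
      using member_le_sum[of k "{k0..k0 + j}" "\<lambda>k. \<bar>A k\<bar>"] that by (simp add: B_def)
    show "\<exists>c\<ge>0. \<forall>n. \<forall>x\<in>J_star f. (f ^^ n) x \<in> E j \<longrightarrow> real n * (real k0 * ln \<kappa>) - c \<le> g n x"
    proof (intro exI conjI allI ballI impI)
      have "ln \<epsilon> \<le> 0" using \<epsilon> by simp
      moreover have "ln B \<ge> 0" using B1 by simp
      ultimately show "0 \<le> ln B - ln \<epsilon>" by linarith
      fix n x assume "x \<in> J_star f" "(f ^^ n) x \<in> E j"
      then obtain k where k: "k \<in> {k0..k0 + j}" "(f ^^ n) x \<in> order_set S \<psi> k \<epsilon>"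
        unfolding E_def \<epsilon>_def by blast
      have "\<kappa> ^ (n * k) * \<epsilon> \<le> norm (Dn n x) * B"
        using k k0 by (intro derivative_lower_bound[OF Dn inj k(2) \<epsilon>(1)] order_trans[OF A AB]) auto
      then have "ln (\<kappa> ^ (n * k) * \<epsilon>) \<le> ln (norm (Dn n x) * B)"
        using \<kappa> \<epsilon>(1) pos[of n x] B1 by (subst ln_le_cancel_iff) auto
      then have "real (n * k) * ln \<kappa> + ln \<epsilon> \<le> g n x + ln B"
        using \<kappa> \<epsilon>(1) pos[of n x] B1 by (simp add: ln_mult ln_realpow g_def)
      moreover have "real n * (real k0 * ln \<kappa>) \<le> real (n * k) * ln \<kappa>"
        using k(1) \<kappa> by (simp add: mult.assoc[symmetric] mult_left_mono mult_right_mono)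
      ultimately show "real n * (real k0 * ln \<kappa>) - (ln B - ln \<epsilon>) \<le> g n x" by linarith
    qed
  qed
  then show ?thesis
    unfolding lyapunov_exponent_def C1_onorm[OF Dn] g_def .
qed

text \<open>A finite supremum of a nonempty set of natural numbers is attained.\<close>

lemma J_level_order:
  assumes "x \<in> J_level f S \<psi> k"
  shows "\<exists>\<phi>\<in>limit_curves S \<psi> x. has_order k \<phi>"
proof -
  have x: "x \<in> J_star f" and \<tau>: "(SUP \<phi>\<in>limit_curves S \<psi> x. enat (Ord \<phi>)) = enat k"
    using assms by (auto simp: J_level_def tau_def)
  let ?O = "(\<lambda>\<phi>. enat (Ord \<phi>)) ` limit_curves S \<psi> x"
  have ne: "?O \<noteq> {}" using limit_curves_nonempty[OF x] by simp
  moreover have "finite ?O" using \<tau> ne unfolding Sup_enat_def by (auto split: if_splits)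
  ultimately have "Sup ?O \<in> ?O" unfolding Sup_enat_def using Max_in by auto
  then obtain \<phi> where "\<phi> \<in> limit_curves S \<psi> x" "Ord \<phi> = k" using \<tau> by auto
  then show ?thesis using has_order_limit_curve[OF x] by blast
qed

end

theorem theorem6p2:
  fixes f :: "C2 \<Rightarrow> C2" and d :: nat
    and S :: "C2 set" and \<psi> :: "C2 \<Rightarrow> complex \<Rightarrow> C2" and lam :: "C2 \<Rightarrow> complex"
    and \<kappa> :: real and \<nu> :: "C2 measure"
  assumes "polynomial_diffeo f"
    and "dynamical_degree f = real d" and "d > 1"
    and "conjugate_to_henon_composition f d"
    and "normalized_invariant_family f S \<psi>"
    and "\<forall>x\<in>S. \<forall>\<zeta>. f (\<psi> x \<zeta>) = \<psi> (f x) (lam x * \<zeta>)"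
    and "normal_family S \<psi>"
    and "\<kappa> > 1" and "\<forall>x\<in>S. cmod (lam x) \<ge> \<kappa>"
    and "ergodic_invariant f \<nu>"
    and "AE x in \<nu>. x \<in> J_star f"
  shows "lyapunov_exponent f \<nu> \<ge> ln \<kappa> \<and> ln \<kappa> > 0 \<and>
    (\<forall>k. (AE x in \<nu>. x \<in> J_level f S \<psi> k) \<longrightarrow>
       lyapunov_exponent f \<nu> \<ge> real k * ln \<kappa> \<and> real k * ln \<kappa> > 0)"
proof -
  interpret expanding_family f d S \<psi> lam \<kappa>
    using assms by unfold_locales
  interpret prob_space \<nu> using assms(10) by (simp add: ergodic_invariant_def)
  have ln_pos: "ln \<kappa> > 0" using \<kappa> by simp
  have "AE x in \<nu>. \<exists>\<phi>\<in>limit_curves S \<psi> x. \<exists>k\<ge>1. has_order k \<phi>"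
    using assms(11)
  proof eventually_elim
    case (elim x)
    then show ?case using limit_curves_nonempty[OF elim] has_order_limit_curve[OF elim]
      by (metis all_not_in_conv has_order_def)
  qed
  then have "lyapunov_exponent f \<nu> \<ge> real 1 * ln \<kappa>"
    by (intro lyapunov_ge assms(10,11)) auto
  moreover have "lyapunov_exponent f \<nu> \<ge> real k * ln \<kappa> \<and> real k * ln \<kappa> > 0"
    if k: "AE x in \<nu>. x \<in> J_level f S \<psi> k" for k
  proof -
    have ord: "AE x in \<nu>. \<exists>\<phi>\<in>limit_curves S \<psi> x. \<exists>k'\<ge>k. has_order k' \<phi>"
      using k by eventually_elim (use J_level_order in blast)
    have "k \<ge> 1"
    proof (rule ccontr)
      assume "\<not> k \<ge> 1"
      then have "x \<notin> J_level f S \<psi> k" for x using J_level_order[of x k] by (auto simp: has_order_def)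
      then show False using k by simp
    qed
    then show ?thesis using lyapunov_ge[OF assms(10,11) _ ord] ln_pos by simp
  qed
  ultimately show ?thesis using ln_pos by simp
qed

end
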